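(* Let $a^-=(0,-1)$ and $a^+=(0,1)$. (i) If $W(y)=|y|^{4n}(1-|y|^{2m})^2$ for some $n,m\in\mathbb{N}$, then $$\mathcal{E}(a^-,a^+)=\frac{4m}{(2n+1)(2n+2m+1)}.$$ (ii) Suppose that $W(y)=(1-|y|^2)^{2\beta}$ for some $\beta\in(0,1)$. If $(u_\epsilon)_{\epsilon>0}\in\mathcal{U}(a^-,a^+)$ is a family of vector fields such that $|u_\epsilon|\le1$ for every $\epsilon>0$, then $$\liminf_{\epsilon\searrow0}E_\epsilon(u_\epsilon;B_1(0))\ge4\int_0^1(1-t^2)^\beta\,dt .$$
   Context: $\mathbb{N}=\{1,2,3,\dots\}$ and $B_1(0)$ is the open unit disc in $\mathbb{R}^2$. Given $W$, for $\epsilon>0$ and $u\in W^{1,2}(B_1(0);\mathbb{R}^2)$ let $E_\epsilon(u;B_1(0))=\frac12\int_{B_1(0)}\left(\epsilon|Du|^2+\frac1\epsilon W(u)\right)dx$. (In (ii) only the values of $W$ on the closed unit disc matter, since $|u_\epsilon|\le1$.) Let $u_0(x)=a^+$ if $x_1>0$ and $u_0(x)=a^-$ if $x_1<0$. Let $\mathcal{U}(a^-,a^+)$ be the set of all families $(u_\epsilon)_{\epsilon>0}$ in $W^{1,2}(B_1(0);\mathbb{R}^2)$ such that $u_\epsilon\to u_0$ in $L^1(B_1(0);\mathbb{R}^2)$ as $\epsilon\searrow0$ and such that there exist $\tau>0$ and $s>2$ with $\lim_{\epsilon\searrow0}\epsilon^{-\tau}\|\operatorname{div}u_\epsilon\|_{L^s(B_1(0))}=0$.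 Define $$\mathcal{E}(a^-,a^+)=\tfrac12\inf\Bigl\{\liminf_{\epsilon\searrow0}E_\epsilon(u_\epsilon;B_1(0)) : (u_\epsilon)_{\epsilon>0}\in\mathcal{U}(a^-,a^+)\Bigr\}.$$ *)

theory Defs
  imports "HOL-Analysis.Analysis"
begin

primrec C_k :: "nat \<Rightarrow> (real ^ 'n \<Rightarrow> real) \<Rightarrow> bool" where
  "C_k 0 f \<longleftrightarrow> continuous_on UNIV f"
| "C_k (Suc k) f \<longleftrightarrow>
     (\<forall>x. f differentiable at x) \<and> (\<forall>j. C_k k (\<lambda>x. frechet_derivative f (at x) (axis j 1)))"

definition test_functions :: "(real ^ 'n) set \<Rightarrow> (real ^ 'n \<Rightarrow> real) set" where
  "test_functions \<Omega> =
     {\<phi>. (\<forall>k. C_k k \<phi>) \<and> compact (closure {x. \<phi> x \<noteq> 0}) \<and> closure {x. \<phi> x \<noteq> 0} \<subseteq> \<Omega>}"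

definition locally_integrable_on ::
    "('a::euclidean_space \<Rightarrow> 'b::euclidean_space) \<Rightarrow> 'a set \<Rightarrow> bool"
    (infixr "locally'_integrable'_on" 46) where
  "f locally_integrable_on \<Omega> \<longleftrightarrow> (\<forall>K. compact K \<and> K \<subseteq> \<Omega> \<longrightarrow> f absolutely_integrable_on K)"

text \<open>Functions on \<open>\<Omega>\<close> are represented by total functions whose values outside \<open>\<Omega>\<close> are irrelevant.
  The entry \<open>G x $ i $ j\<close> is the weak derivative of the \<open>i\<close>-th component in direction \<open>j\<close>.\<close>

definition has_weak_deriv ::
    "(real ^ 'n \<Rightarrow> real ^ 'm) \<Rightarrow> (real ^ 'n \<Rightarrow> real ^ 'n ^ 'm) \<Rightarrow> (real ^ 'n) set \<Rightarrow> bool" where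
  "has_weak_deriv u G \<Omega> \<longleftrightarrow>
     u locally_integrable_on \<Omega> \<and> G locally_integrable_on \<Omega> \<and>
     (\<forall>\<phi>\<in>test_functions \<Omega>. \<forall>i j.
        (\<integral>x. u x $ i * frechet_derivative \<phi> (at x) (axis j 1) \<partial>lebesgue_on \<Omega>) =
        - (\<integral>x. G x $ i $ j * \<phi> x \<partial>lebesgue_on \<Omega>))"

text \<open>The weak derivative is unique only up to null sets; the choice of representative does not
  affect the integrals below.\<close>

definition weak_deriv ::
    "(real ^ 'n) set \<Rightarrow> (real ^ 'n \<Rightarrow> real ^ 'm) \<Rightarrow> real ^ 'n \<Rightarrow> real ^ 'n ^ 'm" where
  "weak_deriv \<Omega> u = (SOME G. has_weak_deriv u G \<Omega>)"

definition weak_div :: "(real ^ 'n) set \<Rightarrow> (real ^ 'n \<Rightarrow> real ^ 'n) \<Rightarrow> real ^ 'n \<Rightarrow> real" where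
  "weak_div \<Omega> u x = trace (weak_deriv \<Omega> u x)"

text \<open>Extended-valued, because the divergence of a \<open>W\<^sup>1\<^sup>,\<^sup>2\<close> field need not lie in \<open>L\<^sup>s\<close> for \<open>s > 2\<close>.\<close>

definition Lp_norm :: "real \<Rightarrow> 'a::euclidean_space set \<Rightarrow> ('a \<Rightarrow> 'b::real_normed_vector) \<Rightarrow> ennreal" where
  "Lp_norm p \<Omega> f =
     (let I = (\<integral>\<^sup>+x. ennreal (norm (f x) powr p) \<partial>lebesgue_on \<Omega>)
      in if I = \<infinity> then \<infinity> else ennreal (enn2real I powr (1 / p)))"

definition Lp :: "real \<Rightarrow> 'a::euclidean_space set \<Rightarrow> ('a \<Rightarrow> 'b::euclidean_space) set" where
  "Lp p \<Omega> = {f \<in> borel_measurable (lebesgue_on \<Omega>). Lp_norm p \<Omega> f < \<infinity>}"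

definition W12 :: "(real ^ 'n) set \<Rightarrow> (real ^ 'n \<Rightarrow> real ^ 'm) set" where
  "W12 \<Omega> = {u \<in> Lp 2 \<Omega>. \<exists>G\<in>Lp 2 \<Omega>. has_weak_deriv u G \<Omega>}"

text \<open>The norm on \<^typ>\<open>real ^ 'n ^ 'm\<close> is the Frobenius norm.\<close>

definition energy ::
    "(real ^ 'm \<Rightarrow> real) \<Rightarrow> real \<Rightarrow> (real ^ 'n \<Rightarrow> real ^ 'm) \<Rightarrow> (real ^ 'n) set \<Rightarrow> ennreal" where
  "energy W \<epsilon> u \<Omega> =
     (\<integral>\<^sup>+x. ennreal (\<epsilon> * (norm (weak_deriv \<Omega> u x))\<^sup>2 + W (u x) / \<epsilon>) \<partial>lebesgue_on \<Omega>) / 2"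

definition jump :: "real ^ 2 \<Rightarrow> real ^ 2 \<Rightarrow> real ^ 2 \<Rightarrow> real ^ 2" where
  "jump am ap x = (if x $ 1 > 0 then ap else if x $ 1 < 0 then am else 0)"

definition families :: "real ^ 2 \<Rightarrow> real ^ 2 \<Rightarrow> (real \<Rightarrow> real ^ 2 \<Rightarrow> real ^ 2) set" where
  "families am ap =
     {u. (\<forall>\<epsilon>>0. u \<epsilon> \<in> W12 (ball 0 1)) \<and>
         ((\<lambda>\<epsilon>. Lp_norm 1 (ball 0 1) (\<lambda>x. u \<epsilon> x - jump am ap x)) \<longlongrightarrow> 0) (at_right 0) \<and>
         (\<exists>\<tau>>0. \<exists>s>2.
            ((\<lambda>\<epsilon>. ennreal (\<epsilon> powr (- \<tau>)) * Lp_norm s (ball 0 1) (weak_div (ball 0 1) (u \<epsilon>)))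
               \<longlongrightarrow> 0) (at_right 0))}"

definition min_energy :: "(real ^ 2 \<Rightarrow> real) \<Rightarrow> real ^ 2 \<Rightarrow> real ^ 2 \<Rightarrow> ennreal" where
  "min_energy W am ap =
     (INF u\<in>families am ap. Liminf (at_right 0) (\<lambda>\<epsilon>. energy W \<epsilon> (u \<epsilon>) (ball 0 1))) / 2"

end

theory Submission
  imports Defs
begin

text \<open>
  Lower bounds come from calibrations: a pair \<open>(p, q)\<close> of functions on the target such that the
  divergence of \<open>(p \<circ> u, q \<circ> u)\<close> is at most the energy density plus a multiple of \<open>div u\<close> and a multiple
  \<open>\<epsilon> \<kappa>\<close> of \<open>det Du\<close>. Testing with a cutoff function of the disc, the left-hand side converges to
  \<open>p a\<^sup>+ - p a\<^sup>-\<close> times the length of the interface. The divergence term vanishes in the limit, and the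
  determinant, being a null Lagrangian, can be integrated by parts, which leaves a term of order
  \<open>sqrt \<epsilon>\<close>. Since \<open>u\<close> is only a Sobolev function, both steps use mollification.

  For \<open>W = (1 - |y|\<^sup>2) ^ (2 \<beta>)\<close> the calibration splits in the coordinates \<open>y\<^sub>1 + y\<^sub>2\<close> and \<open>y\<^sub>2 - y\<^sub>1\<close>, and
  concavity of \<open>t ^ \<beta>\<close> is what makes it admissible. For the radial potentials the calibration has the form
  \<open>p = y\<^sub>2 (\<kappa> v y\<^sub>1\<^sup>2 + Q y\<^sub>2\<^sup>2)\<close>, \<open>q = y\<^sub>1 (\<kappa> v y\<^sub>2\<^sup>2 + Q y\<^sub>1\<^sup>2)\<close> with \<open>v\<close> and \<open>Q\<close> depending on \<open>|y|\<^sup>2\<close>. There the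
  bound is attained in the limit by the divergence-free fields \<open>(0, g (x\<^sub>1 / \<epsilon>))\<close> with a nearly optimal
  one-dimensional profile \<open>g\<close>.
\<close>

subsection \<open>Smooth functions of one variable\<close>

text \<open>The coefficient of \<open>div u\<close> in the calibration inequality is half the trace
  of the differential of \<open>(p, q)\<close>, so only the trace-free part of that differential
  must be controlled. By Young's inequality it suffices that its pairing with \<open>A\<close>,
  squared, is at most \<open>W y\<close> times |A|^2 - 2 \<kappa> det A. Sharpness forces
  \<open>p\<close> to be an antiderivative of a square root of \<open>W\<close> on the segment
  between the wells. The determinant leaves room for the other entries: for \<kappa> = 1 the form is
  (A11 - A22)^2 + (A12 + A21)^2, so two equal off-diagonal entries \<open>w\<close> cost w^2 and not
  the 2 w^2 of the Frobenius norm.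

  Two obstacles shape the rest. For the radial potentials nothing bounds \<open>u\<close>, while the
  natural calibration has polynomial growth, so it must be truncated at an arbitrarily small loss.
  And \<open>weak_deriv\<close> is an arbitrary choice, so the energy of an explicit competitor is
  known only after uniqueness of weak derivatives has been shown.

  The interface in the disc has length 2, which the division by 2 in \<open>min_energy\<close>
  removes.\<close>

primrec smooth_upto :: "nat \<Rightarrow> (real \<Rightarrow> real) \<Rightarrow> bool" where
  "smooth_upto 0 f \<longleftrightarrow> continuous_on UNIV f"
| "smooth_upto (Suc k) f \<longleftrightarrow>
     (\<exists>f'. (\<forall>x. (f has_real_derivative f' x) (at x)) \<and> smooth_upto k f')"

text \<open>The test functions constructed below are products of functions of one variable, for
  which \<open>C_k\<close> reduces to this notion. Since the derivative in
  \<open>smooth_upto\<close> is existentially quantified, each closure rule only has to exhibit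
  one.\<close>

definition smooth :: "(real \<Rightarrow> real) \<Rightarrow> bool" where
  "smooth f \<longleftrightarrow> (\<forall>k. smooth_upto k f)"

lemma smooth_upto_SucI:
  "(\<And>x. (f has_real_derivative f' x) (at x)) \<Longrightarrow> smooth_upto k f' \<Longrightarrow> smooth_upto (Suc k) f"
  by auto

lemma smooth_upto_Suc_D: "smooth_upto (Suc k) f \<Longrightarrow> smooth_upto k f"
proof (induction k arbitrary: f)
  case 0
  then show ?case
    using DERIV_continuous_on[of UNIV f] by auto
next
  case (Suc k)
  then obtain f' where "\<And>x. (f has_real_derivative f' x) (at x)" "smooth_upto (Suc k) f'"
    by auto
  with Suc.IH show ?case by auto
qed

lemma smooth_upto_const: "smooth_upto k (\<lambda>_. c)"
proof (induction k arbitrary: c)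
  case (Suc k)
  show ?case
    using Suc[of 0] by (auto intro!: exI[of _ "\<lambda>_. 0"])
qed auto

lemma smooth_upto_add:
  "smooth_upto k f \<Longrightarrow> smooth_upto k g \<Longrightarrow> smooth_upto k (\<lambda>x. f x + g x)"
proof (induction k arbitrary: f g)
  case (Suc k)
  then obtain f' g' where d: "\<And>x. (f has_real_derivative f' x) (at x)" "smooth_upto k f'"
    "\<And>x. (g has_real_derivative g' x) (at x)" "smooth_upto k g'"
    by auto
  then show ?case
    using Suc.IH[of f' g'] by (auto intro!: exI[of _ "\<lambda>x. f' x + g' x"] derivative_eq_intros)
qed (auto intro!: continuous_intros)

lemma smooth_upto_mult:
  "smooth_upto k f \<Longrightarrow> smooth_upto k g \<Longrightarrow> smooth_upto k (\<lambda>x. f x * g x)"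
proof (induction k arbitrary: f g)
  case (Suc k)
  then obtain f' g' where d: "\<And>x. (f has_real_derivative f' x) (at x)" "smooth_upto k f'"
    "\<And>x. (g has_real_derivative g' x) (at x)" "smooth_upto k g'"
    by auto
  have "smooth_upto k f" "smooth_upto k g"
    using Suc.prems smooth_upto_Suc_D by blast+
  with Suc.IH d have "smooth_upto k (\<lambda>x. f' x * g x + g' x * f x)"
    by (intro smooth_upto_add Suc.IH) auto
  moreover have "((\<lambda>x. f x * g x) has_real_derivative f' x * g x + g' x * f x) (at x)" for x
    using d by (auto intro!: derivative_eq_intros)
  ultimately show ?case by (rule smooth_upto_SucI[rotated])
qed (auto intro!: continuous_intros)

lemma smooth_upto_affine:
  "smooth_upto k f \<Longrightarrow> smooth_upto k (\<lambda>x. f (c * x + d))"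
proof (induction k arbitrary: f)
  case 0
  then have "continuous_on UNIV f" by simp
  then have "continuous_on UNIV (\<lambda>x. f (c * x + d))"
    by (rule continuous_on_compose2) (auto intro!: continuous_intros)
  then show ?case by simp
next
  case (Suc k)
  then obtain f' where d: "\<And>x. (f has_real_derivative f' x) (at x)" "smooth_upto k f'"
    by auto
  have "((\<lambda>x. f (c * x + d)) has_real_derivative f' (c * x + d) * c) (at x)" for x
    by (rule DERIV_chain2[OF d(1)]) (auto intro!: derivative_eq_intros)
  moreover have "smooth_upto k (\<lambda>x. f' (c * x + d) * c)"
    using Suc.IH[OF d(2)] by (intro smooth_upto_mult smooth_upto_const)
  ultimately show ?case by (rule smooth_upto_SucI)
qed

lemma smooth_const: "smooth (\<lambda>_. c)"
  and smooth_add: "smooth f \<Longrightarrow> smooth g \<Longrightarrow> smooth (\<lambda>x. f x + g x)"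
  and smooth_mult: "smooth f \<Longrightarrow> smooth g \<Longrightarrow> smooth (\<lambda>x. f x * g x)"
  and smooth_affine: "smooth f \<Longrightarrow> smooth (\<lambda>x. f (c * x + d))"
  by (simp_all add: smooth_def smooth_upto_const smooth_upto_add smooth_upto_mult smooth_upto_affine)

lemma smooth_deriv:
  assumes "smooth f"
  shows "(f has_real_derivative deriv f x) (at x)" "smooth (deriv f)"
proof -
  from assms have "smooth_upto (Suc k) f" for k by (simp add: smooth_def del: smooth_upto.simps)
  then have ex: "\<exists>f'. (\<forall>x. (f has_real_derivative f' x) (at x)) \<and> smooth_upto k f'" for k by simp
  then show d: "(f has_real_derivative deriv f x) (at x)" for x
    by (metis DERIV_imp_deriv)
  show "smooth (deriv f)"
    unfolding smooth_def
  proof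
    fix k
    from ex[of k] obtain f' where f': "\<And>x. (f has_real_derivative f' x) (at x)" "smooth_upto k f'"
      by auto
    then have "f' = deriv f" by (intro ext) (metis DERIV_imp_deriv)
    with f' show "smooth_upto k (deriv f)" by simp
  qed
qed

lemma smooth_antideriv:
  assumes "\<And>x. (f has_real_derivative f' x) (at x)" "smooth f'"
  shows "smooth f"
proof -
  have "smooth_upto (Suc k) f" for k using assms by (auto simp: smooth_def)
  then show ?thesis unfolding smooth_def using smooth_upto_Suc_D by blast
qed

lemma smooth_continuous: "smooth f \<Longrightarrow> continuous_on A f"
  by (metis continuous_on_subset smooth_def smooth_upto.simps(1) top_greatest)

section \<open>Flat exponentials, bump functions and cutoffs\<close>

definition exp_step :: "nat \<Rightarrow> real \<Rightarrow> real" where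
  "exp_step j x = (if x > 0 then (1 / x) ^ j * exp (- (1 / x)) else 0)"

lemma exp_step_tendsto: "(exp_step j \<longlongrightarrow> 0) (at_right 0)"
proof -
  have "((\<lambda>t::real. t ^ j / exp t) \<longlongrightarrow> 0) at_top" by (rule tendsto_power_div_exp_0)
  from filterlim_compose[OF this filterlim_inverse_at_top_right]
  show ?thesis
    by (rule Lim_transform_eventually)
      (auto simp: exp_step_def eventually_at_filter exp_minus field_simps)
qed

text \<open>The powers of 1/x are carried along because they make the family closed under
  differentiation up to linear combinations; smoothness then follows by induction with
  \<open>j\<close> arbitrary.\<close>

lemma exp_step_deriv:
  "(exp_step j has_real_derivative (exp_step (j + 2) x - real j * exp_step (j + 1) x)) (at x)"
proof -
  consider "x > 0" | "x < 0" | "x = 0" by linarith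
  then show ?thesis
  proof cases
    case 1
    have i: "((\<lambda>x. 1 / x) has_real_derivative - ((1 / x) * (1 / x))) (at x)"
      using 1 by (auto intro!: derivative_eq_intros)
    have p: "((\<lambda>x. (1 / x) ^ j) has_real_derivative - real j * (1 / x) ^ (j + 1)) (at x)"
      using DERIV_power[OF i, of j]
      by (cases j) (simp_all add: algebra_simps del: power_one_over times_divide_eq_right times_divide_eq_left)
    have "((\<lambda>x. (1 / x) ^ j * exp (- (1 / x))) has_real_derivative
        (exp_step (j + 2) x - real j * exp_step (j + 1) x)) (at x)"
      using DERIV_mult[OF p DERIV_fun_exp[OF DERIV_minus[OF i]]] 1
      by (simp add: exp_step_def algebra_simps power_add power2_eq_square del: power_one_over)
    moreover have "\<forall>\<^sub>F y in nhds x. exp_step j y = (1 / y) ^ j * exp (- (1 / y))"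
      using eventually_nhds_in_open[of "{0<..}" x] 1
      by (auto elim!: eventually_mono simp: exp_step_def)
    ultimately show ?thesis by (subst DERIV_cong_ev[OF refl _ refl]) auto
  next
    case 2
    have "((\<lambda>x. 0) has_real_derivative
        (exp_step (j + 2) x - real j * exp_step (j + 1) x)) (at x)"
      using 2 by (auto simp: exp_step_def)
    moreover have "\<forall>\<^sub>F y in nhds x. exp_step j y = 0"
      using eventually_nhds_in_open[of "{..<0}" x] 2
      by (auto elim!: eventually_mono simp: exp_step_def)
    ultimately show ?thesis by (subst DERIV_cong_ev[OF refl _ refl]) auto
  next
    case 3
    \<comment> \<open>This is the difference quotient at 0. From the right it equals
      \<open>exp_step (j + 1)\<close>, which tends to 0.\<close>
    have "((\<lambda>y. exp_step j y / y) \<longlongrightarrow> 0) (at 0)"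
    proof (rule filterlim_split_at_real)
      show "((\<lambda>y. exp_step j y / y) \<longlongrightarrow> 0) (at_left 0)"
        by (rule tendsto_eventually) (auto simp: eventually_at_filter exp_step_def)
      have "\<forall>\<^sub>F y in at_right 0. exp_step (j + 1) y = exp_step j y / y"
        by (auto simp: eventually_at_filter exp_step_def)
      then show "((\<lambda>y. exp_step j y / y) \<longlongrightarrow> 0) (at_right 0)"
        by (rule Lim_transform_eventually[OF exp_step_tendsto])
    qed
    then show ?thesis
      unfolding 3 by (auto simp: has_field_derivative_iff exp_step_def)
  qed
qed

lemma smooth_exp_step: "smooth (exp_step j)"
proof -
  have "smooth_upto k (exp_step j)" for k
  proof (induction k arbitrary: j)
    case 0
    show ?case
      using DERIV_continuous_on[of UNIV "exp_step j", OF exp_step_deriv] by simp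
  next
    case (Suc k)
    have "smooth_upto k (\<lambda>x. exp_step (j + 2) x + (- real j) * exp_step (j + 1) x)"
      by (intro smooth_upto_add smooth_upto_mult smooth_upto_const Suc)
    then show ?case
      using exp_step_deriv[of j] by (intro smooth_upto_SucI[of _ _ k]) auto
  qed
  then show ?thesis by (simp add: smooth_def)
qed

text \<open>A flat exponential times its reflection, positive exactly on the open unit interval. The
  argument \<open>-1 * x + 1\<close> has literally the shape that \<open>smooth_affine\<close>
  expects; \<open>cutoff\<close> and \<open>moll\<close> are written in the same way.\<close>

definition bump0 :: "real \<Rightarrow> real" where
  "bump0 x = exp_step 0 x * exp_step 0 (-1 * x + 1)"

definition bump :: "real \<Rightarrow> real" where
  "bump x = bump0 x / integral {0..1} bump0"

lemma bump0: "smooth bump0" "bump0 x \<ge> 0" "x \<notin> {0<..<1} \<Longrightarrow> bump0 x = 0"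
    "x \<in> {0<..<1} \<Longrightarrow> bump0 x > 0"
proof -
  show "smooth bump0" unfolding bump0_def[abs_def]
    by (intro smooth_mult smooth_exp_step smooth_affine)
qed (auto simp: bump0_def exp_step_def)

lemma bump0_integral: "integral {0..1} bump0 > 0"
proof (rule ccontr)
  assume "\<not> ?thesis"
  then have "integral {0..1} bump0 = 0"
    using integral_nonneg[of bump0 "{0..1}"] bump0
    by (metis integrable_continuous_real leI order.antisym smooth_continuous)
  then have "\<forall>x\<in>{0..1}. bump0 x = 0"
    using integral_eq_0_iff[of 0 1 bump0] bump0 smooth_continuous by auto
  then show False using bump0(4)[of "1/2"] by auto
qed

lemma bump: "smooth bump" "bump x \<ge> 0" "x \<notin> {0<..<1} \<Longrightarrow> bump x = 0"
  "(bump has_integral 1) {0..1}"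
proof -
  have "smooth (\<lambda>x. bump0 x * (1 / integral {0..1} bump0))"
    by (intro smooth_mult smooth_const bump0)
  then show "smooth bump" by (simp add: bump_def[abs_def] field_simps)
  show "bump x \<ge> 0" "x \<notin> {0<..<1} \<Longrightarrow> bump x = 0"
    using bump0_integral bump0 by (auto simp: bump_def)
  have "(bump0 has_integral (integral {0..1} bump0)) {0..1}"
    using bump0(1) smooth_continuous integrable_continuous_real by blast
  from has_integral_divide[OF this, of "integral {0..1} bump0"] bump0_integral
  show "(bump has_integral 1) {0..1}" by (simp add: bump_def[abs_def])
qed

definition ramp :: "real \<Rightarrow> real" where
  "ramp x = (if x \<le> 0 then 0 else integral {0..x} bump)"

lemma ramp:
  "(ramp has_real_derivative bump x) (at x)" "smooth ramp" "x \<le> 0 \<Longrightarrow> ramp x = 0"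
  "x \<ge> 1 \<Longrightarrow> ramp x = 1" "0 \<le> ramp x" "ramp x \<le> 1"
proof -
  have cont: "continuous_on A bump" for A using bump smooth_continuous by blast
  show R: "(ramp has_real_derivative bump x) (at x)" for x
  proof -
    \<comment> \<open>A base point strictly to the left of \<open>x\<close> and of 0 removes the
      case distinction and puts \<open>x\<close> into the interior of the interval on which the
      fundamental theorem is applied.\<close>
    have eq: "ramp y = integral {-1 - \<bar>x\<bar>..y} bump" if "y > -1 - \<bar>x\<bar>" for y
    proof (cases "y \<le> 0")
      case True
      then have "integral {-1 - \<bar>x\<bar>..y} bump = integral {-1 - \<bar>x\<bar>..y} (\<lambda>_. 0)"
        by (intro integral_cong) (auto intro!: bump)
      then show ?thesis using True by (simp add: ramp_def)
    next
      case False
      have "integral {-1 - \<bar>x\<bar>..0} bump = integral {-1 - \<bar>x\<bar>..0} (\<lambda>_. 0)"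
        by (intro integral_cong) (auto intro!: bump)
      then show ?thesis
        using False Henstock_Kurzweil_Integration.integral_combine[of "-1-\<bar>x\<bar>" 0 y bump]
          integrable_continuous_real[OF cont]
        by (simp add: ramp_def)
    qed
    have "((\<lambda>y. integral {-1 - \<bar>x\<bar>..y} bump) has_real_derivative bump x) (at x within {-1-\<bar>x\<bar>..\<bar>x\<bar>+1})"
      by (rule integral_has_real_derivative[OF cont]) auto
    then have "((\<lambda>y. integral {-1 - \<bar>x\<bar>..y} bump) has_real_derivative bump x) (at x)"
      by (subst (asm) at_within_interior) auto
    moreover have "\<forall>\<^sub>F y in nhds x. ramp y = integral {-1 - \<bar>x\<bar>..y} bump"
    proof -
      have "x \<in> {-1 - \<bar>x\<bar><..}" by (auto simp: abs_if)
      from eventually_nhds_in_open[OF _ this] show ?thesis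
        by (auto elim!: eventually_mono simp: eq)
    qed
    ultimately show ?thesis by (subst DERIV_cong_ev[OF refl _ refl]) auto
  qed
  show "smooth ramp" using R bump(1) by (rule smooth_antideriv)
  show "x \<le> 0 \<Longrightarrow> ramp x = 0" by (simp add: ramp_def)
  have mono: "x \<le> y \<Longrightarrow> ramp x \<le> ramp y" for x y
    using DERIV_nonneg_imp_nondecreasing[of x y ramp] R bump(2) by blast
  show ge1: "ramp x = 1" if "x \<ge> 1" for x
  proof -
    have "integral {1..x} bump = integral {1..x} (\<lambda>_. 0)"
      by (intro integral_cong) (auto intro!: bump)
    then show ?thesis
      using that Henstock_Kurzweil_Integration.integral_combine[of 0 1 x bump]
          integrable_continuous_real[OF cont] bump(4)
      by (simp add: ramp_def integral_unique)
  qed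
  show "0 \<le> ramp x" using mono[of 0 x] by (cases "x \<le> 0") (auto simp: ramp_def)
  show "ramp x \<le> 1" using mono[of x 1] ge1[of 1] ge1[of x] by (cases "x \<le> 1") auto
qed

text \<open>The factors are \<open>ramp ((R + t) / (R - r))\<close>, the rising edge on the left,
  and \<open>ramp ((R - t) / (R - r))\<close>, the falling edge on the right.\<close>

definition cutoff :: "real \<Rightarrow> real \<Rightarrow> real \<Rightarrow> real" where
  "cutoff r R t = ramp ((1 / (R - r)) * t + R / (R - r)) * ramp ((- (1 / (R - r))) * t + R / (R - r))"

lemma cutoff:
  assumes "r < R"
  shows "smooth (cutoff r R)" "0 \<le> cutoff r R t" "cutoff r R t \<le> 1"
    "\<bar>t\<bar> \<le> r \<Longrightarrow> cutoff r R t = 1" "\<bar>t\<bar> \<ge> R \<Longrightarrow> cutoff r R t = 0"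
proof -
  show "smooth (cutoff r R)" unfolding cutoff_def[abs_def]
    by (intro smooth_mult smooth_affine ramp)
  show "0 \<le> cutoff r R t" "cutoff r R t \<le> 1"
    by (auto simp: cutoff_def ramp intro!: mult_le_one)
  have eq: "(1 / (R - r)) * t + R / (R - r) = (R + t) / (R - r)"
    "(- (1 / (R - r))) * t + R / (R - r) = (R - t) / (R - r)"
    by (simp_all add: add_divide_distrib diff_divide_distrib)
  show "cutoff r R t = 1" if "\<bar>t\<bar> \<le> r"
  proof -
    have "(R + t) / (R - r) \<ge> 1" "(R - t) / (R - r) \<ge> 1"
      using assms that by (auto simp: le_divide_eq)
    then show ?thesis unfolding cutoff_def eq by (simp add: ramp)
  qed
  show "cutoff r R t = 0" if "\<bar>t\<bar> \<ge> R"
  proof -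
    have "(R + t) / (R - r) \<le> 0 \<or> (R - t) / (R - r) \<le> 0"
      using assms that by (auto simp: divide_le_0_iff)
    then show ?thesis unfolding cutoff_def eq by (auto simp: ramp)
  qed
qed

subsection \<open>Gradients and integration in the plane\<close>

definition vec2 :: "real \<Rightarrow> real \<Rightarrow> real ^ 2" where
  "vec2 s t = (\<chi> i. if i = 1 then s else t)"

lemma vec2_nth [simp]: "vec2 s t $ 1 = s" "vec2 s t $ 2 = t"
  by (simp_all add: vec2_def)

lemma vec2_collapse [simp]: "vec2 (x $ 1) (x $ 2) = x"
  by (simp add: vec_eq_iff forall_2)

lemma norm_vec2_sq: "(norm (x :: real ^ 2))\<^sup>2 = (x $ 1)\<^sup>2 + (x $ 2)\<^sup>2"
  by (simp add: norm_vec_def L2_set_def sum_2)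

lemma continuous_on_vec2 [continuous_intros]:
  "continuous_on A f \<Longrightarrow> continuous_on A g \<Longrightarrow> continuous_on A (\<lambda>x. vec2 (f x) (g x))"
  unfolding vec2_def
proof (intro continuous_on_vec_lambda)
  show "continuous_on A (\<lambda>x. if i = 1 then f x else g x)"
    if "continuous_on A f" "continuous_on A g" for i :: 2
    using that by (cases "i = 1") auto
qed

lemma measurable_vec2 [measurable]: "(\<lambda>p. vec2 (fst p) (snd p)) \<in> borel_measurable borel"
  by (intro borel_measurable_continuous_onI continuous_intros)

lemma measurable_vec2' [measurable (raw)]:
  "f \<in> borel_measurable M \<Longrightarrow> g \<in> borel_measurable M \<Longrightarrow> (\<lambda>x. vec2 (f x) (g x)) \<in> borel_measurable M"
  using measurable_compose[OF _ measurable_vec2, of "\<lambda>x. (f x, g x)" M] by simp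

text \<open>Lebesgue measure is determined by its values on boxes, and a box pulls back to a product
  of intervals. This carries Fubini's theorem from pairs over to \<open>real ^ 2\<close>.\<close>

lemma lborel_vec2: "distr (lborel :: (real \<times> real) measure) borel (\<lambda>p. vec2 (fst p) (snd p)) = lborel"
proof (rule sym, rule lborel_eqI)
  fix l u :: "real ^ 2" assume *: "\<And>b. b \<in> Basis \<Longrightarrow> l \<bullet> b \<le> u \<bullet> b"
  have ax: "axis 1 1 \<in> (Basis :: (real ^ 2) set)" "axis 2 1 \<in> (Basis :: (real ^ 2) set)"
    by (auto simp: Basis_vec_def)
  have le: "l $ 1 \<le> u $ 1" "l $ 2 \<le> u $ 2"
    using *[OF ax(1)] *[OF ax(2)] by (simp_all add: inner_axis)
  have vim: "(\<lambda>p. vec2 (fst p) (snd p)) -` box l u = {l $ 1 <..< u $ 1} \<times> {l $ 2 <..< u $ 2}"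
    by (auto simp: mem_box_cart forall_2)
  have B: "(Basis :: (real ^ 2) set) = {axis 1 1, axis 2 1}"
    by (auto simp: Basis_vec_def UNIV_2)
  have "axis 1 1 \<noteq> (axis 2 1 :: real ^ 2)" by (simp add: axis_eq_axis)
  then have "(\<Prod>b\<in>Basis. (u - l) \<bullet> b) = (u $ 1 - l $ 1) * (u $ 2 - l $ 2)"
    unfolding B by (simp add: inner_axis)
  moreover have "emeasure lborel ({l $ 1 <..< u $ 1} \<times> {l $ 2 <..< u $ 2}) =
     ennreal (u $ 1 - l $ 1) * ennreal (u $ 2 - l $ 2)"
    using le by (simp add: lborel_prod[symmetric] lborel.emeasure_pair_measure_Times)
  ultimately show "emeasure (distr lborel borel (\<lambda>p. vec2 (fst p) (snd p))) (box l u) =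
      ennreal (\<Prod>b\<in>Basis. (u - l) \<bullet> b)"
    using le by (simp add: emeasure_distr vim ennreal_mult)
qed simp

lemma nn_integral_vec2:
  assumes [measurable]: "f \<in> borel_measurable borel"
  shows "(\<integral>\<^sup>+x. f x \<partial>lborel) = (\<integral>\<^sup>+s. \<integral>\<^sup>+t. f (vec2 s t) \<partial>lborel \<partial>lborel)"
proof -
  have "(\<integral>\<^sup>+x. f x \<partial>lborel) = (\<integral>\<^sup>+p. f (vec2 (fst p) (snd p)) \<partial>(lborel \<Otimes>\<^sub>M lborel))"
    by (subst lborel_vec2[symmetric], subst nn_integral_distr) (auto simp: lborel_prod)
  also have "\<dots> = (\<integral>\<^sup>+s. \<integral>\<^sup>+t. f (vec2 s t) \<partial>lborel \<partial>lborel)"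
    by (subst lborel.nn_integral_fst[symmetric]) auto
  finally show ?thesis .
qed

lemma integral_vec2:
  fixes f :: "real ^ 2 \<Rightarrow> real"
  assumes "integrable lborel f"
  shows "(\<integral>x. f x \<partial>lborel) = (\<integral>s. \<integral>t. f (vec2 s t) \<partial>lborel \<partial>lborel)"
    and "(\<integral>x. f x \<partial>lborel) = (\<integral>t. \<integral>s. f (vec2 s t) \<partial>lborel \<partial>lborel)"
proof -
  have [measurable]: "f \<in> borel_measurable borel" using assms by auto
  have "integrable (distr lborel borel (\<lambda>p. vec2 (fst p) (snd p))) f"
    unfolding lborel_vec2 by (rule assms)
  then have i: "integrable (lborel \<Otimes>\<^sub>M lborel) (\<lambda>(s, t). f (vec2 s t))"
    by (subst (asm) integrable_distr_eq) (auto simp: lborel_prod split_beta')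
  have eq: "(\<integral>x. f x \<partial>lborel) = (\<integral>p. f (vec2 (fst p) (snd p)) \<partial>(lborel \<Otimes>\<^sub>M lborel))"
    by (subst lborel_vec2[symmetric], subst integral_distr) (auto simp: lborel_prod)
  show "(\<integral>x. f x \<partial>lborel) = (\<integral>s. \<integral>t. f (vec2 s t) \<partial>lborel \<partial>lborel)"
    unfolding eq using lborel_pair.integral_fst'[of "\<lambda>(s, t). f (vec2 s t)"] i
    by (simp add: split_beta')
  show "(\<integral>x. f x \<partial>lborel) = (\<integral>t. \<integral>s. f (vec2 s t) \<partial>lborel \<partial>lborel)"
    unfolding eq using lborel_pair.integral_snd[of "\<lambda>s t. f (vec2 s t)"] i
    by (simp add: split_beta')
qed

text \<open>Keeping both partial derivatives as explicit functions lets gradients be computed by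
  composing rules; their continuity is stated separately wherever it is used.\<close>

definition has_grad :: "(real ^ 2 \<Rightarrow> real) \<Rightarrow> (real ^ 2 \<Rightarrow> real) \<Rightarrow> (real ^ 2 \<Rightarrow> real) \<Rightarrow> bool" where
  "has_grad h h1 h2 \<longleftrightarrow> (\<forall>x. (h has_derivative (\<lambda>k. h1 x * k $ 1 + h2 x * k $ 2)) (at x))"

lemma has_grad_continuous: "has_grad h h1 h2 \<Longrightarrow> continuous_on A h"
  unfolding has_grad_def
  by (meson continuous_at_imp_continuous_on has_derivative_continuous)

lemma has_grad_add:
  "has_grad f f1 f2 \<Longrightarrow> has_grad g g1 g2 \<Longrightarrow>
    has_grad (\<lambda>x. f x + g x) (\<lambda>x. f1 x + g1 x) (\<lambda>x. f2 x + g2 x)"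
  unfolding has_grad_def by (auto intro!: derivative_eq_intros simp: algebra_simps)

lemma has_grad_mult:
  "has_grad f f1 f2 \<Longrightarrow> has_grad g g1 g2 \<Longrightarrow>
    has_grad (\<lambda>x. f x * g x) (\<lambda>x. f1 x * g x + f x * g1 x) (\<lambda>x. f2 x * g x + f x * g2 x)"
  unfolding has_grad_def
proof safe
  fix x assume "\<forall>x. (f has_derivative (\<lambda>k. f1 x * k $ 1 + f2 x * k $ 2)) (at x)"
     "\<forall>x. (g has_derivative (\<lambda>k. g1 x * k $ 1 + g2 x * k $ 2)) (at x)"
  then have "((\<lambda>x. f x * g x) has_derivative
     (\<lambda>h. f x * (g1 x * h $ 1 + g2 x * h $ 2) + (f1 x * h $ 1 + f2 x * h $ 2) * g x)) (at x)"
    by (intro has_derivative_mult) auto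
  then show "((\<lambda>x. f x * g x) has_derivative
     (\<lambda>k. (f1 x * g x + f x * g1 x) * k $ 1 + (f2 x * g x + f x * g2 x) * k $ 2)) (at x)"
    by (rule has_derivative_eq_rhs) (auto simp: algebra_simps)
qed

lemma has_grad_const: "has_grad (\<lambda>_. c) (\<lambda>_. 0) (\<lambda>_. 0)"
  by (simp add: has_grad_def)

lemma has_grad_nth: "has_grad (\<lambda>x. x $ 1) (\<lambda>_. 1) (\<lambda>_. 0)" "has_grad (\<lambda>x. x $ 2) (\<lambda>_. 0) (\<lambda>_. 1)"
  unfolding has_grad_def
  by (auto intro!: derivative_eq_intros bounded_linear.has_derivative[OF bounded_linear_vec_nth])

text \<open>Asks for the derivative of the outer function only at values of the inner one. This
  matters for the logarithmic cutoff of the squared norm, whose derivative is available only on the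
  nonnegative half-line.\<close>

lemma has_grad_chain_at:
  assumes "\<And>x. (f has_real_derivative f' (g x)) (at (g x))" "has_grad g g1 g2"
  shows "has_grad (\<lambda>x. f (g x)) (\<lambda>x. f' (g x) * g1 x) (\<lambda>x. f' (g x) * g2 x)"
  unfolding has_grad_def
proof
  fix x
  have "((\<lambda>x. f (g x)) has_derivative (\<lambda>k. f' (g x) * (g1 x * k $ 1 + g2 x * k $ 2))) (at x)"
    using assms has_derivative_compose[of g _ x UNIV f "\<lambda>h. f' (g x) * h"]
    unfolding has_grad_def has_field_derivative_def by simp
  then show "((\<lambda>x. f (g x)) has_derivative
     (\<lambda>k. f' (g x) * g1 x * k $ 1 + f' (g x) * g2 x * k $ 2)) (at x)"
    by (rule has_derivative_eq_rhs) (auto simp: algebra_simps)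
qed

lemma has_grad_chain:
  assumes "\<And>x. (f has_real_derivative f' x) (at x)" "has_grad g g1 g2"
  shows "has_grad (\<lambda>x. f (g x)) (\<lambda>x. f' (g x) * g1 x) (\<lambda>x. f' (g x) * g2 x)"
  using assms by (rule has_grad_chain_at)

lemma has_grad_compose:
  assumes "has_grad p p1 p2" "has_grad u u1 u2" "has_grad v v1 v2"
  shows "has_grad (\<lambda>x. p (vec2 (u x) (v x)))
     (\<lambda>x. p1 (vec2 (u x) (v x)) * u1 x + p2 (vec2 (u x) (v x)) * v1 x)
     (\<lambda>x. p1 (vec2 (u x) (v x)) * u2 x + p2 (vec2 (u x) (v x)) * v2 x)"
  unfolding has_grad_def
proof
  fix x
  have d: "(u has_derivative (\<lambda>k. u1 x * k $ 1 + u2 x * k $ 2)) (at x)"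
    "(v has_derivative (\<lambda>k. v1 x * k $ 1 + v2 x * k $ 2)) (at x)"
    using assms by (auto simp: has_grad_def)
  have eq: "vec2 s t = s *\<^sub>R axis 1 1 + t *\<^sub>R axis 2 1" for s t
    by (simp add: vec_eq_iff forall_2 axis_def)
  have "((\<lambda>x. vec2 (u x) (v x)) has_derivative
     (\<lambda>k. vec2 (u1 x * k $ 1 + u2 x * k $ 2) (v1 x * k $ 1 + v2 x * k $ 2))) (at x)"
    unfolding eq by (intro has_derivative_add has_derivative_scaleR_left d)
  moreover have "(p has_derivative (\<lambda>k. p1 (vec2 (u x) (v x)) * k $ 1 + p2 (vec2 (u x) (v x)) * k $ 2))
      (at (vec2 (u x) (v x)))"
    using assms by (auto simp: has_grad_def)
  ultimately have "((\<lambda>x. p (vec2 (u x) (v x))) has_derivative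
     (\<lambda>k. p1 (vec2 (u x) (v x)) * (vec2 (u1 x * k $ 1 + u2 x * k $ 2) (v1 x * k $ 1 + v2 x * k $ 2)) $ 1
       + p2 (vec2 (u x) (v x)) * (vec2 (u1 x * k $ 1 + u2 x * k $ 2) (v1 x * k $ 1 + v2 x * k $ 2)) $ 2)) (at x)"
    by (rule has_derivative_compose)
  then show "((\<lambda>x. p (vec2 (u x) (v x))) has_derivative
     (\<lambda>k. (p1 (vec2 (u x) (v x)) * u1 x + p2 (vec2 (u x) (v x)) * v1 x) * k $ 1 +
          (p1 (vec2 (u x) (v x)) * u2 x + p2 (vec2 (u x) (v x)) * v2 x) * k $ 2)) (at x)"
    by (rule has_derivative_eq_rhs) (auto simp: algebra_simps)
qed

lemma has_grad_partial:
  assumes "has_grad h h1 h2"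
  shows "((\<lambda>s. h (vec2 s t)) has_real_derivative h1 (vec2 s t)) (at s)"
    and "((\<lambda>s. h (vec2 t s)) has_real_derivative h2 (vec2 t s)) (at s)"
proof -
  have eq: "vec2 s t = s *\<^sub>R axis 1 1 + t *\<^sub>R axis 2 1" for s t
    by (simp add: vec_eq_iff forall_2 axis_def)
  have d: "(h has_derivative (\<lambda>k. h1 (vec2 s t) * k $ 1 + h2 (vec2 s t) * k $ 2)) (at (vec2 s t))" for s t
    using assms by (auto simp: has_grad_def)
  have "((\<lambda>s. vec2 s t) has_derivative (\<lambda>k. vec2 k 0)) (at s)"
    unfolding eq by (auto intro!: derivative_eq_intros)
  from has_derivative_compose[OF this d]
  show "((\<lambda>s. h (vec2 s t)) has_real_derivative h1 (vec2 s t)) (at s)"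
    unfolding has_field_derivative_def by (rule has_derivative_eq_rhs) auto
  have "((\<lambda>s. vec2 t s) has_derivative (\<lambda>k. vec2 0 k)) (at s)"
    unfolding eq by (auto intro!: derivative_eq_intros)
  from has_derivative_compose[OF this d]
  show "((\<lambda>s. h (vec2 t s)) has_real_derivative h2 (vec2 t s)) (at s)"
    unfolding has_field_derivative_def by (rule has_derivative_eq_rhs) auto
qed

lemma has_grad_frechet:
  assumes "has_grad h h1 h2"
  shows "h differentiable at x" "frechet_derivative h (at x) (axis 1 1) = h1 x"
    "frechet_derivative h (at x) (axis 2 1) = h2 x"
proof -
  have d: "(h has_derivative (\<lambda>k. h1 x * k $ 1 + h2 x * k $ 2)) (at x)"
    using assms by (auto simp: has_grad_def)
  then show "h differentiable at x" by (auto simp: differentiable_def)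
  have "frechet_derivative h (at x) = (\<lambda>k. h1 x * k $ 1 + h2 x * k $ 2)"
    using frechet_derivative_at[OF d] by simp
  then show "frechet_derivative h (at x) (axis 1 1) = h1 x"
    "frechet_derivative h (at x) (axis 2 1) = h2 x"
    by (auto simp: axis_def)
qed

lemma integrable_compact_support:
  fixes f :: "'a::euclidean_space \<Rightarrow> real"
  assumes "continuous_on UNIV f" "\<And>x. norm x > R \<Longrightarrow> f x = 0"
  shows "integrable lborel f"
proof -
  have "integrable lborel (\<lambda>x. indicator (cball 0 R) x *\<^sub>R f x)"
    using assms by (intro borel_integrable_compact) (auto intro: continuous_on_subset)
  moreover have "(\<lambda>x. indicator (cball 0 R) x *\<^sub>R f x) = f"
    using assms by (auto simp: fun_eq_iff indicator_def)
  ultimately show ?thesis by simp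
qed

lemma integral_deriv_compact_support:
  fixes h :: "real \<Rightarrow> real"
  assumes "\<And>s. (h has_real_derivative h' s) (at s)" "continuous_on UNIV h'"
    "\<And>s. \<bar>s\<bar> > R \<Longrightarrow> h s = 0" "\<And>s. \<bar>s\<bar> > R \<Longrightarrow> h' s = 0"
  shows "(\<integral>s. h' s \<partial>lborel) = 0"
proof -
  have "(\<integral>s. h' s \<partial>lborel) = (\<integral>s. h' s * indicator {-\<bar>R\<bar>-1..\<bar>R\<bar>+1} s \<partial>lborel)"
  proof (intro Bochner_Integration.integral_cong refl)
    fix s show "h' s = h' s * indicator {-\<bar>R\<bar>-1..\<bar>R\<bar>+1} s"
      using assms(4)[of s] by (cases "\<bar>s\<bar> > R") (auto simp: indicator_def)
  qed
  also have "\<dots> = h (\<bar>R\<bar>+1) - h (-\<bar>R\<bar>-1)"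
    using assms(1,2) by (intro integral_FTC_Icc_real) (auto simp: continuous_on_eq_continuous_at)
  also have "\<dots> = 0" using assms(3) by simp
  finally show ?thesis .
qed

lemma has_grad_zero:
  assumes "has_grad h h1 h2" "\<And>x. norm x > R \<Longrightarrow> h x = 0" "norm x > R"
  shows "h1 x = 0" "h2 x = 0"
proof -
  have "open {x :: real ^ 2. norm x > R}" by (intro open_Collect_less continuous_intros)
  then have "\<forall>\<^sub>F y in nhds x. h y = 0"
    using eventually_nhds_in_open[of "{x. norm x > R}" x] assms
    by (auto elim!: eventually_mono)
  then have "\<forall>\<^sub>F y in at x. h y = 0" "h x = 0"
    by (auto simp: eventually_at_filter elim: eventually_mono dest: eventually_nhds_x_imp_x)
  then have "(h has_derivative (\<lambda>_. 0)) (at x)"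
    using has_derivative_transform_eventually[of "\<lambda>_. 0" "\<lambda>_. 0" x UNIV h]
    by (auto elim: eventually_mono)
  moreover have "(h has_derivative (\<lambda>k. h1 x * k $ 1 + h2 x * k $ 2)) (at x)"
    using assms by (auto simp: has_grad_def)
  ultimately have "(\<lambda>k :: real ^ 2. 0) = (\<lambda>k. h1 x * k $ 1 + h2 x * k $ 2)"
    by (rule has_derivative_unique)
  from fun_cong[OF this, of "vec2 1 0"] fun_cong[OF this, of "vec2 0 1"]
  show "h1 x = 0" "h2 x = 0" by auto
qed

lemma abs_nth_le_norm: "\<bar>s\<bar> \<le> norm (vec2 s t)" "\<bar>t\<bar> \<le> norm (vec2 s t)"
  using component_le_norm_cart[of "vec2 s t" 1] component_le_norm_cart[of "vec2 s t" 2] by auto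

text \<open>Fubini's theorem with the inner integral along the direction of differentiation, where
  the fundamental theorem of calculus gives 0. All integrations by parts for smooth functions below
  rest on it.\<close>

lemma integral_grad_zero:
  assumes g: "has_grad h h1 h2" and z: "\<And>x. norm x > R \<Longrightarrow> h x = 0"
    and c: "continuous_on UNIV h1" "continuous_on UNIV h2"
  shows "(\<integral>x. h1 x \<partial>lborel) = 0" "(\<integral>x. h2 x \<partial>lborel) = 0"
    "integrable lborel h1" "integrable lborel h2"
proof -
  note z' = has_grad_zero[OF g z]
  show i: "integrable lborel h1" "integrable lborel h2"
    using c z' by (auto intro!: integrable_compact_support)
  have c1: "continuous_on UNIV (\<lambda>s. h1 (vec2 s t))" "continuous_on UNIV (\<lambda>s. h2 (vec2 t s))" for t
    by (auto intro!: continuous_on_compose2[OF c(1)] continuous_on_compose2[OF c(2)] continuous_intros)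
  have "(\<integral>s. h1 (vec2 s t) \<partial>lborel) = 0" for t
    using abs_nth_le_norm z z'
    by (intro integral_deriv_compact_support[OF has_grad_partial(1)[OF g] c1(1), of R])
       (meson less_le_trans)+
  then show "(\<integral>x. h1 x \<partial>lborel) = 0" by (simp add: integral_vec2(2)[OF i(1)])
  have "(\<integral>s. h2 (vec2 t s) \<partial>lborel) = 0" for t
    using abs_nth_le_norm z z'
    by (intro integral_deriv_compact_support[OF has_grad_partial(2)[OF g] c1(2), of R])
       (meson less_le_trans)+
  then show "(\<integral>x. h2 x \<partial>lborel) = 0" by (simp add: integral_vec2(1)[OF i(2)])
qed

subsection \<open>Mollification\<close>

text \<open>Admissible factors of a convolution kernel. The class is closed under
  \<open>deriv\<close>, so derivatives of mollified functions are again convolutions with admissible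
  kernels and can be differentiated once more.\<close>

definition kern :: "(real \<Rightarrow> real) \<Rightarrow> bool" where
  "kern a \<longleftrightarrow> smooth a \<and> (\<exists>R. \<forall>t. \<bar>t\<bar> > R \<longrightarrow> a t = 0)"

lemma kern_deriv_support:
  assumes "smooth a" "\<And>t. t \<notin> {l..u} \<Longrightarrow> a t = 0" "t \<notin> {l..u}"
  shows "deriv a t = 0"
proof -
  have "open (- {l..u})" by (intro open_Compl) auto
  then have "\<forall>\<^sub>F s in nhds t. s \<in> - {l..u}"
    using assms(3) by (intro eventually_nhds_in_open) auto
  then have "\<forall>\<^sub>F s in nhds t. a s = 0"
    by (rule eventually_mono) (use assms(2) in auto)
  then show ?thesis using deriv_cong_ev[of a "\<lambda>_. 0" t t] by auto
qed

lemma kern_deriv: "kern a \<Longrightarrow> kern (deriv a)"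
proof -
  assume "kern a"
  then obtain R where "smooth a" "\<And>t. \<bar>t\<bar> > R \<Longrightarrow> a t = 0" by (auto simp: kern_def)
  then have "deriv a t = 0" if "\<bar>t\<bar> > R" for t
    using that \<open>smooth a\<close> by (intro kern_deriv_support[of a "-R" R t] \<open>\<And>t. \<bar>t\<bar> > R \<Longrightarrow> a t = 0\<close>) auto
  with \<open>smooth a\<close> show ?thesis unfolding kern_def using smooth_deriv by blast
qed

lemma kern_bound:
  assumes "kern a"
  obtains C where "C > 0" "\<And>t. \<bar>a t\<bar> \<le> C"
proof -
  from assms obtain R where R: "smooth a" "\<And>t. \<bar>t\<bar> > R \<Longrightarrow> a t = 0" by (auto simp: kern_def)
  have "compact (a ` {-R..R})"
    using R by (intro compact_continuous_image smooth_continuous) auto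
  then obtain B where B: "B > 0" "\<And>t. t \<in> {-R..R} \<Longrightarrow> \<bar>a t\<bar> \<le> B"
    by (auto simp: bounded_pos dest!: compact_imp_bounded)
  have "\<bar>a t\<bar> \<le> B" for t
    using B(1) B(2)[of t] R(2)[of t] by (cases "\<bar>t\<bar> > R") (auto simp: abs_le_iff not_less)
  with B that show ?thesis by blast
qed

text \<open>Compact support makes all bounds uniform in the base point. The quadratic remainder is
  what later allows a convolution with a merely integrable function to be differentiated
  directly.\<close>

lemma kern_taylor:
  assumes "kern a"
  obtains C where "C > 0" "\<And>t. \<bar>a t\<bar> \<le> C" "\<And>t. \<bar>deriv a t\<bar> \<le> C"
    "\<And>s h. \<bar>a (s + h) - a s\<bar> \<le> C * \<bar>h\<bar>"
    "\<And>s h. \<bar>a (s + h) - a s - deriv a s * h\<bar> \<le> C * h\<^sup>2"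
proof -
  have k: "kern (deriv a)" "kern (deriv (deriv a))" using assms kern_deriv by auto
  obtain C0 C1 C2 where C: "C0 > 0" "\<And>t. \<bar>a t\<bar> \<le> C0" "C1 > 0" "\<And>t. \<bar>deriv a t\<bar> \<le> C1"
    "C2 > 0" "\<And>t. \<bar>deriv (deriv a) t\<bar> \<le> C2"
    using kern_bound[OF assms] kern_bound[OF k(1)] kern_bound[OF k(2)] by metis
  have lip: "\<bar>f (s + h) - f s\<bar> \<le> C * \<bar>h\<bar>" if "kern f" "\<And>t. \<bar>deriv f t\<bar> \<le> C" for f C and s h :: real
    using field_differentiable_bound[of UNIV f "deriv f" C "s + h" s] that smooth_deriv(1)[of f]
    by (auto simp: kern_def)
  define C where "C = C0 + C1 + C2"
  have C': "C > 0" "\<bar>a t\<bar> \<le> C" "\<bar>deriv a t\<bar> \<le> C" "\<bar>deriv (deriv a) t\<bar> \<le> C" for t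
    using C(1,3,5) C(2)[of t] C(4)[of t] C(6)[of t] by (auto simp: C_def)
  have "\<bar>a (s + h) - a s - deriv a s * h\<bar> \<le> C * h\<^sup>2" for s h
  proof -
    \<comment> \<open>Mean value inequality for the Taylor remainder as a function of the increment:
      its derivative is an increment of \<open>deriv a\<close>, which is at most
      \<open>C * \<bar>h\<bar>\<close> because \<open>deriv a\<close> is Lipschitz.\<close>
    have "norm ((\<lambda>\<tau>. a (s + \<tau>) - deriv a s * \<tau>) h - (\<lambda>\<tau>. a (s + \<tau>) - deriv a s * \<tau>) 0)
        \<le> (C * \<bar>h\<bar>) * norm (h - 0)"
    proof (rule field_differentiable_bound[of "{-\<bar>h\<bar>..\<bar>h\<bar>}" _ "\<lambda>\<tau>. deriv a (s + \<tau>) - deriv a s"])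
      fix \<tau> assume \<tau>: "\<tau> \<in> {-\<bar>h\<bar>..\<bar>h\<bar>}"
      have "((\<lambda>\<tau>. a (s + \<tau>)) has_real_derivative deriv a (s + \<tau>)) (at \<tau>)"
        using smooth_deriv(1)[of a "s + \<tau>"] assms DERIV_shift[of a _ \<tau> s]
        by (simp add: kern_def add.commute)
      from DERIV_diff[OF this DERIV_cmult_Id[of "deriv a s"]]
      show "((\<lambda>\<tau>. a (s + \<tau>) - deriv a s * \<tau>) has_field_derivative
         deriv a (s + \<tau>) - deriv a s) (at \<tau> within {-\<bar>h\<bar>..\<bar>h\<bar>})"
        by (rule has_field_derivative_at_within)
      have "\<bar>deriv a (s + \<tau>) - deriv a s\<bar> \<le> C * \<bar>\<tau>\<bar>"
        using lip[OF k(1) C'(4)] .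
      also have "\<dots> \<le> C * \<bar>h\<bar>" using \<tau> C'(1) by (intro mult_left_mono) auto
      finally show "norm (deriv a (s + \<tau>) - deriv a s) \<le> C * \<bar>h\<bar>" by simp
    qed auto
    then show ?thesis by (simp add: power2_eq_square)
  qed
  with C' lip[OF assms C'(3)] that show ?thesis by blast
qed

section \<open>Product kernels and convolution with them\<close>

definition tens :: "(real \<Rightarrow> real) \<Rightarrow> (real \<Rightarrow> real) \<Rightarrow> real ^ 2 \<Rightarrow> real" where
  "tens a b z = a (z $ 1) * b (z $ 2)"

lemma tens_has_grad:
  assumes "smooth a" "smooth b"
  shows "has_grad (tens a b) (tens (deriv a) b) (tens a (deriv b))"
proof -
  have "has_grad (\<lambda>x. a (x $ 1)) (\<lambda>x. deriv a (x $ 1) * 1) (\<lambda>x. deriv a (x $ 1) * 0)"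
    "has_grad (\<lambda>x. b (x $ 2)) (\<lambda>x. deriv b (x $ 2) * 0) (\<lambda>x. deriv b (x $ 2) * 1)"
    by (intro has_grad_chain[of a] has_grad_chain[of b] has_grad_nth smooth_deriv assms)+
  from has_grad_mult[OF this] show ?thesis
    by (simp add: tens_def[abs_def])
qed

lemma tens_continuous: "smooth a \<Longrightarrow> smooth b \<Longrightarrow> continuous_on A (tens a b)"
  using has_grad_continuous[OF tens_has_grad] .

text \<open>Each partial derivative of a product kernel is again a product kernel with one factor
  differentiated, so the induction runs with both factors arbitrary.\<close>

lemma C_k_tens: "smooth a \<Longrightarrow> smooth b \<Longrightarrow> C_k k (tens a b)"
proof (induction k arbitrary: a b)
  case 0
  then show ?case by (simp add: tens_continuous)
next
  case (Suc k)
  note g = tens_has_grad[OF Suc.prems]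
  have "C_k k (\<lambda>x. frechet_derivative (tens a b) (at x) (axis j 1))" for j
    using exhaust_2[of j] Suc by (auto simp: has_grad_frechet[OF g] smooth_deriv(2))
  then show ?case using has_grad_frechet(1)[OF g] by simp
qed

lemma tens_test_function:
  assumes "smooth a" "smooth b" "\<And>t. t \<notin> {l..u} \<Longrightarrow> a t = 0" "\<And>t. t \<notin> {l'..u'} \<Longrightarrow> b t = 0"
    and "\<And>s t. s \<in> {l..u} \<Longrightarrow> t \<in> {l'..u'} \<Longrightarrow> vec2 s t \<in> \<Omega>"
  shows "tens a b \<in> test_functions \<Omega>"
proof -
  have "{x. tens a b x \<noteq> 0} \<subseteq> cbox (vec2 l l') (vec2 u u')"
    using assms(3)[of "x $ 1" for x :: "real ^ 2"] assms(4)[of "x $ 2" for x :: "real ^ 2"]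
    by (fastforce simp: tens_def mem_box_cart forall_2)
  then have cl: "closure {x. tens a b x \<noteq> 0} \<subseteq> cbox (vec2 l l') (vec2 u u')"
    by (rule closure_minimal) auto
  then have "compact (closure {x. tens a b x \<noteq> 0})"
    using bounded_subset[OF bounded_cbox] by (auto simp: compact_eq_bounded_closed)
  moreover have "cbox (vec2 l l') (vec2 u u') \<subseteq> \<Omega>"
  proof
    fix x assume "x \<in> cbox (vec2 l l') (vec2 u u')"
    then show "x \<in> \<Omega>" using assms(5)[of "x $ 1" "x $ 2"] by (auto simp: mem_box_cart forall_2)
  qed
  ultimately show ?thesis
    using cl assms C_k_tens by (auto simp: test_functions_def)
qed

lemma tens_bound:
  assumes "kern a" "kern b"
  obtains C where "C > 0" "\<And>z. \<bar>tens a b z\<bar> \<le> C"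
    "\<And>z k. \<bar>tens a b (z + k) - tens a b z - (tens (deriv a) b z * k $ 1 + tens a (deriv b) z * k $ 2)\<bar>
       \<le> C * (norm k)\<^sup>2"
proof -
  obtain A where A: "A > 0" "\<And>t. \<bar>a t\<bar> \<le> A" "\<And>t. \<bar>deriv a t\<bar> \<le> A"
    "\<And>s h. \<bar>a (s + h) - a s\<bar> \<le> A * \<bar>h\<bar>"
    "\<And>s h. \<bar>a (s + h) - a s - deriv a s * h\<bar> \<le> A * h\<^sup>2"
    using kern_taylor[OF assms(1)] by metis
  obtain B where B: "B > 0" "\<And>t. \<bar>b t\<bar> \<le> B" "\<And>t. \<bar>deriv b t\<bar> \<le> B"
    "\<And>s h. \<bar>b (s + h) - b s\<bar> \<le> B * \<bar>h\<bar>"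
    "\<And>s h. \<bar>b (s + h) - b s - deriv b s * h\<bar> \<le> B * h\<^sup>2"
    using kern_taylor[OF assms(2)] by metis
  have "\<bar>tens a b z\<bar> \<le> 2 * (A * B)" for z
  proof -
    have "\<bar>tens a b z\<bar> \<le> A * B"
      unfolding tens_def abs_mult using A B by (intro mult_mono) (auto intro: less_imp_le)
    moreover have "A * B > 0" using A B by simp
    ultimately show ?thesis by linarith
  qed
  moreover
  have "\<bar>tens a b (z + k) - tens a b z - (tens (deriv a) b z * k $ 1 + tens a (deriv b) z * k $ 2)\<bar>
       \<le> 2 * (A * B) * (norm k)\<^sup>2" for z k
  proof -
    define s t h l where "s = z $ 1" and "t = z $ 2" and "h = k $ 1" and "l = k $ 2"
    \<comment> \<open>The remainder of a product splits into the remainder of \<open>a\<close> times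
      the shifted \<open>b\<close>, \<open>a\<close> times the remainder of \<open>b\<close>, and a
      mixed term of first order in each variable.\<close>
    have "tens a b (z + k) - tens a b z - (tens (deriv a) b z * k $ 1 + tens a (deriv b) z * k $ 2)
      = (a (s + h) - a s - deriv a s * h) * b (t + l) + a s * (b (t + l) - b t - deriv b t * l)
        + (deriv a s * h) * (b (t + l) - b t)"
      by (simp add: tens_def s_def t_def h_def l_def algebra_simps)
    also have "\<bar>\<dots>\<bar> \<le> \<bar>a (s + h) - a s - deriv a s * h\<bar> * \<bar>b (t + l)\<bar>
       + \<bar>a s\<bar> * \<bar>b (t + l) - b t - deriv b t * l\<bar> + (\<bar>deriv a s\<bar> * \<bar>h\<bar>) * \<bar>b (t + l) - b t\<bar>"
      unfolding abs_mult[symmetric] by linarith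
    also have "\<dots> \<le> (A * h\<^sup>2) * B + A * (B * l\<^sup>2) + (A * \<bar>h\<bar>) * (B * \<bar>l\<bar>)"
      using A B by (intro add_mono mult_mono) (auto intro!: mult_nonneg_nonneg less_imp_le[OF A(1)] less_imp_le[OF B(1)])
    also have "\<dots> = A * B * (h\<^sup>2 + l\<^sup>2 + \<bar>h\<bar> * \<bar>l\<bar>)" by (simp add: algebra_simps)
    also have "\<dots> \<le> A * B * (2 * (h\<^sup>2 + l\<^sup>2))"
    proof (intro mult_left_mono)
      have "0 \<le> (\<bar>h\<bar> - \<bar>l\<bar>)\<^sup>2" by simp
      then have "2 * (\<bar>h\<bar> * \<bar>l\<bar>) \<le> h\<^sup>2 + l\<^sup>2" by (simp add: power2_diff)
      then have "\<bar>h\<bar> * \<bar>l\<bar> \<le> h\<^sup>2 + l\<^sup>2"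
        by (smt (verit) zero_le_power2)
      then show "h\<^sup>2 + l\<^sup>2 + \<bar>h\<bar> * \<bar>l\<bar> \<le> 2 * (h\<^sup>2 + l\<^sup>2)"
        by (simp only: mult_2 add_left_mono)
    qed (use A B in auto)
    finally show ?thesis by (simp add: norm_vec2_sq h_def l_def algebra_simps)
  qed
  moreover have "2 * (A * B) > 0" using A B by simp
  ultimately show ?thesis using that by blast
qed

text \<open>The two factors of the kernel are separate arguments so that a partial derivative is
  expressed by the same operation, with \<open>deriv\<close> applied to one of them.\<close>

definition conv :: "(real ^ 2 \<Rightarrow> real) \<Rightarrow> (real \<Rightarrow> real) \<Rightarrow> (real \<Rightarrow> real) \<Rightarrow> real ^ 2 \<Rightarrow> real" where
  "conv f a b x = (\<integral>y. f y * tens a b (x - y) \<partial>lborel)"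

lemma borel_measurable_tens: "kern a \<Longrightarrow> kern b \<Longrightarrow> tens a b \<in> borel_measurable borel"
  by (intro borel_measurable_continuous_onI tens_continuous) (auto simp: kern_def)

lemma conv_integrable:
  assumes "integrable lborel f" "kern a" "kern b"
  shows "integrable lborel (\<lambda>y. f y * tens a b (x - y))"
proof -
  note [measurable] = borel_measurable_tens[OF assms(2,3)]
  have [measurable]: "f \<in> borel_measurable borel" using assms by auto
  obtain C where C: "C > 0" "\<And>z. \<bar>tens a b z\<bar> \<le> C" using tens_bound[OF assms(2,3)] by metis
  show ?thesis
  proof (rule Bochner_Integration.integrable_bound)
    show "integrable lborel (\<lambda>y. C * \<bar>f y\<bar>)" using assms by auto
    show "AE y in lborel. norm (f y * tens a b (x - y)) \<le> norm (C * \<bar>f y\<bar>)"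
      using C by (auto simp: abs_mult mult.commute[of C] intro!: mult_left_mono)
  qed measurable
qed

text \<open>The first-order remainder of the convolution is the integral of \<open>f\<close> against
  the remainder of the kernel, hence at most a constant times the L1 norm of \<open>f\<close> times
  the squared increment.\<close>

lemma conv_has_grad:
  assumes "integrable lborel f" "kern a" "kern b"
  shows "has_grad (conv f a b) (conv f (deriv a) b) (conv f a (deriv b))"
  unfolding has_grad_def
proof
  fix x
  obtain C where C: "C > 0" "\<And>z. \<bar>tens a b z\<bar> \<le> C"
    "\<And>z k. \<bar>tens a b (z + k) - tens a b z - (tens (deriv a) b z * k $ 1 + tens a (deriv b) z * k $ 2)\<bar>
       \<le> C * (norm k)\<^sup>2"
    using tens_bound[OF assms(2,3)] by metis
  define M where "M = C * (\<integral>y. \<bar>f y\<bar> \<partial>lborel)"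
  note i = conv_integrable[OF assms(1)]
  have i1: "integrable lborel (\<lambda>y. f y * tens (deriv a) b (x - y))"
    "integrable lborel (\<lambda>y. f y * tens a (deriv b) (x - y))"
    "integrable lborel (\<lambda>y. f y * tens a b (z - y))" for z
    using i assms kern_deriv by auto
  have bound: "\<bar>conv f a b (x + k) - conv f a b x -
      (conv f (deriv a) b x * k $ 1 + conv f a (deriv b) x * k $ 2)\<bar> \<le> M * (norm k)\<^sup>2" for k
  proof -
    let ?r = "\<lambda>y. tens a b ((x - y) + k) - tens a b (x - y) -
       (tens (deriv a) b (x - y) * k $ 1 + tens a (deriv b) (x - y) * k $ 2)"
    have eq: "f y * ?r y = f y * tens a b (x + k - y) - f y * tens a b (x - y) -
       (f y * tens (deriv a) b (x - y) * k $ 1 + f y * tens a (deriv b) (x - y) * k $ 2)" for y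
      by (simp add: algebra_simps)
    have hb: "has_bochner_integral lborel (\<lambda>y. f y * tens a b (z - y)) (conv f a b z)"
      "has_bochner_integral lborel (\<lambda>y. f y * tens (deriv a) b (x - y)) (conv f (deriv a) b x)"
      "has_bochner_integral lborel (\<lambda>y. f y * tens a (deriv b) (x - y)) (conv f a (deriv b) x)" for z
      unfolding conv_def using i1 by (auto intro: has_bochner_integral_integrable)
    have R: "has_bochner_integral lborel (\<lambda>y. f y * ?r y) (conv f a b (x + k) - conv f a b x -
      (conv f (deriv a) b x * k $ 1 + conv f a (deriv b) x * k $ 2))"
      unfolding eq
      by (intro has_bochner_integral_diff has_bochner_integral_add has_bochner_integral_mult_left hb)
    then have ir: "integrable lborel (\<lambda>y. f y * ?r y)"
      by (simp add: has_bochner_integral_iff)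
    have "\<bar>conv f a b (x + k) - conv f a b x -
      (conv f (deriv a) b x * k $ 1 + conv f a (deriv b) x * k $ 2)\<bar> = \<bar>\<integral>y. f y * ?r y \<partial>lborel\<bar>"
      unfolding has_bochner_integral_integral_eq[OF R] ..
    also have "\<dots> \<le> (\<integral>y. \<bar>f y * ?r y\<bar> \<partial>lborel)" by (rule integral_abs_bound)
    also have "\<dots> \<le> (\<integral>y. (C * (norm k)\<^sup>2) * \<bar>f y\<bar> \<partial>lborel)"
    proof (rule integral_mono[OF integrable_abs[OF ir]])
      show "integrable lborel (\<lambda>y. (C * (norm k)\<^sup>2) * \<bar>f y\<bar>)"
        by (intro integrable_mult_right integrable_abs assms(1))
      have *: "\<bar>f y * r\<bar> \<le> (C * (norm k)\<^sup>2) * \<bar>f y\<bar>" if "\<bar>r\<bar> \<le> C * (norm k)\<^sup>2" for y r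
        using mult_right_mono[OF that, of "\<bar>f y\<bar>"] by (simp add: abs_mult mult.commute)
      show "\<bar>f y * ?r y\<bar> \<le> (C * (norm k)\<^sup>2) * \<bar>f y\<bar>" for y
        by (rule *[OF C(3)])
    qed
    also have "\<dots> = M * (norm k)\<^sup>2" by (simp add: M_def)
    finally show ?thesis .
  qed
  show "(conv f a b has_derivative (\<lambda>k. conv f (deriv a) b x * k $ 1 + conv f a (deriv b) x * k $ 2)) (at x)"
    unfolding has_derivative_at
  proof
    show "bounded_linear (\<lambda>k. conv f (deriv a) b x * k $ 1 + conv f a (deriv b) x * k $ 2)"
      by (intro bounded_linear_add bounded_linear_const_mult bounded_linear_vec_nth)
    show "(\<lambda>k. norm (conv f a b (x + k) - conv f a b x -
       (conv f (deriv a) b x * k $ 1 + conv f a (deriv b) x * k $ 2)) / norm k) \<midarrow>0\<rightarrow> 0"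
    proof (rule Lim_null_comparison)
      have "((\<lambda>k :: real ^ 2. M * norm k) \<longlongrightarrow> M * norm (0 :: real ^ 2)) (at 0)"
        by (intro tendsto_mult tendsto_const tendsto_norm tendsto_ident_at)
      then show "(\<lambda>k :: real ^ 2. M * norm k) \<midarrow>0\<rightarrow> 0" by simp
      show "\<forall>\<^sub>F k in at 0. norm (norm (conv f a b (x + k) - conv f a b x -
       (conv f (deriv a) b x * k $ 1 + conv f a (deriv b) x * k $ 2)) / norm k) \<le> M * norm k"
        using bound by (auto simp: eventually_at_filter divide_le_eq power2_eq_square mult.assoc)
    qed
  qed
qed

lemma conv_continuous: "integrable lborel f \<Longrightarrow> kern a \<Longrightarrow> kern b \<Longrightarrow> continuous_on A (conv f a b)"
  using has_grad_continuous[OF conv_has_grad] .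

lemma conv_diff:
  "integrable lborel f \<Longrightarrow> integrable lborel g \<Longrightarrow> kern a \<Longrightarrow> kern b \<Longrightarrow>
     conv (\<lambda>x. f x - g x) a b x = conv f a b x - conv g a b x"
  unfolding conv_def
  by (simp add: left_diff_distrib conv_integrable)

section \<open>The mollifiers\<close>

definition moll :: "nat \<Rightarrow> real \<Rightarrow> real" where
  "moll n t = bump (real (Suc n) * t + 0) * real (Suc n)"

lemma moll:
  "kern (moll n)" "moll n t \<ge> 0" "t \<notin> {0..1 / real (Suc n)} \<Longrightarrow> moll n t = 0"
  "(\<integral>\<^sup>+t. ennreal (moll n t) \<partial>lborel) = 1"
proof -
  show 1: "moll n t = 0" if "t \<notin> {0..1 / real (Suc n)}" for t
  proof -
    have "real (Suc n) * t + 0 \<notin> {0<..<1}"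
    proof (cases "t < 0")
      case True
      then have "real (Suc n) * t < 0" by (intro mult_pos_neg) auto
      then show ?thesis by simp
    qed (use that in \<open>auto simp: field_simps\<close>)
    from bump(3)[OF this] show ?thesis by (simp only: moll_def mult_zero_left)
  qed
  have "smooth (moll n)" unfolding moll_def[abs_def]
    by (intro smooth_mult smooth_const smooth_affine bump)
  moreover have "moll n t = 0" if "\<bar>t\<bar> > 1 / real (Suc n)" for t
    using that by (intro 1) (auto simp: abs_if split: if_splits)
  ultimately show "kern (moll n)" unfolding kern_def by blast
  show "moll n t \<ge> 0" by (simp add: moll_def bump)
  have [measurable]: "bump \<in> borel_measurable borel"
    by (intro borel_measurable_continuous_onI smooth_continuous bump)
  have "(\<integral>\<^sup>+t. ennreal (bump t) \<partial>lborel) = (\<integral>\<^sup>+t. ennreal (bump t) * indicator {0..1} t \<partial>lborel)"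
    using bump(3) by (intro nn_integral_cong) (auto simp: indicator_def)
  also have "\<dots> = ennreal 1"
    by (rule nn_integral_has_integral_lebesgue'[OF bump(2) bump(4)])
  finally have "(\<integral>\<^sup>+t. ennreal (bump t) \<partial>lborel) = 1" by simp
  moreover have "(\<integral>\<^sup>+t. ennreal (bump t) \<partial>lborel) =
      real (Suc n) * (\<integral>\<^sup>+t. ennreal (bump (0 + real (Suc n) * t)) \<partial>lborel)"
    by (subst nn_integral_real_affine[of _ "real (Suc n)" 0]) auto
  moreover have "(\<integral>\<^sup>+t. ennreal (moll n t) \<partial>lborel) =
     real (Suc n) * (\<integral>\<^sup>+t. ennreal (bump (0 + real (Suc n) * t)) \<partial>lborel)"
  proof -
    have "ennreal (moll n t) = ennreal (real (Suc n)) * ennreal (bump (0 + real (Suc n) * t))" for t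
      unfolding moll_def
      by (subst ennreal_mult[symmetric]) (simp_all add: bump mult.commute del: of_nat_Suc)
    then show ?thesis by (simp only: ) (rule nn_integral_cmult, measurable)
  qed
  ultimately show "(\<integral>\<^sup>+t. ennreal (moll n t) \<partial>lborel) = 1" by simp
qed

lemma nn_integral_shift:
  fixes f :: "real ^ 2 \<Rightarrow> ennreal"
  assumes [measurable]: "f \<in> borel_measurable borel"
  shows "(\<integral>\<^sup>+x. f (x - c) \<partial>lborel) = (\<integral>\<^sup>+x. f x \<partial>lborel)"
    and "(\<integral>\<^sup>+x. f (c - x) \<partial>lborel) = (\<integral>\<^sup>+x. f x \<partial>lborel)"
proof -
  show "(\<integral>\<^sup>+x. f (x - c) \<partial>lborel) = (\<integral>\<^sup>+x. f x \<partial>lborel)"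
    by (subst (2) lborel_distr_plus[symmetric, of "- c"], subst nn_integral_distr) auto
  have "(lborel :: (real ^ 2) measure) = distr lborel borel (\<lambda>x. c - x)"
    using lborel_affine[of "-1" c] by (simp add: density_1)
  then have "(\<integral>\<^sup>+x. f x \<partial>lborel) = (\<integral>\<^sup>+x. f x \<partial>distr lborel borel (\<lambda>x. c - x))" by simp
  also have "\<dots> = (\<integral>\<^sup>+x. f (c - x) \<partial>lborel)" by (subst nn_integral_distr) auto
  finally show "(\<integral>\<^sup>+x. f (c - x) \<partial>lborel) = (\<integral>\<^sup>+x. f x \<partial>lborel)" by simp
qed

definition moll2 :: "nat \<Rightarrow> real ^ 2 \<Rightarrow> real" where
  "moll2 n = tens (moll n) (moll n)"

lemma moll2:
  "moll2 n z \<ge> 0" "norm z > 2 / real (Suc n) \<Longrightarrow> moll2 n z = 0" "moll2 n \<in> borel_measurable borel"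
  "(\<integral>\<^sup>+z. ennreal (moll2 n z) \<partial>lborel) = 1"
  "(\<integral>\<^sup>+y. ennreal (moll2 n (x - y)) \<partial>lborel) = 1"
  "(\<integral>\<^sup>+x. ennreal (moll2 n (x - y)) \<partial>lborel) = 1"
proof -
  show n: "moll2 n z \<ge> 0" for z by (simp add: moll2_def tens_def moll)
  show [measurable]: "moll2 n \<in> borel_measurable borel"
    unfolding moll2_def by (intro borel_measurable_tens moll)
  have [measurable]: "moll n \<in> borel_measurable borel"
    using moll(1) by (intro borel_measurable_continuous_onI smooth_continuous) (auto simp: kern_def)
  show 1: "(\<integral>\<^sup>+z. ennreal (moll2 n z) \<partial>lborel) = 1"
    by (subst nn_integral_vec2)
      (auto simp: moll2_def tens_def ennreal_mult moll nn_integral_cmult nn_integral_multc)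
  show "(\<integral>\<^sup>+y. ennreal (moll2 n (x - y)) \<partial>lborel) = 1"
    "(\<integral>\<^sup>+x. ennreal (moll2 n (x - y)) \<partial>lborel) = 1"
    using nn_integral_shift[of "\<lambda>z. ennreal (moll2 n z)"] 1 by auto
  assume z: "norm z > 2 / real (Suc n)"
  have "norm z \<le> \<bar>z $ 1\<bar> + \<bar>z $ 2\<bar>"
    using norm_le_l1_cart[of z] by (simp add: sum_2)
  then have "\<bar>z $ 1\<bar> > 1 / real (Suc n) \<or> \<bar>z $ 2\<bar> > 1 / real (Suc n)"
    using z by linarith
  then have "moll n (z $ 1) = 0 \<or> moll n (z $ 2) = 0"
    by (metis moll(3) abs_of_nonneg atLeastAtMost_iff not_less)
  then show "moll2 n z = 0" by (auto simp: moll2_def tens_def)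
qed

lemma moll2_integral:
  "integrable lborel (\<lambda>y. moll2 n (x - y))" "(\<integral>y. moll2 n (x - y) \<partial>lborel) = 1"
proof -
  note [measurable] = moll2(3)
  show "integrable lborel (\<lambda>y. moll2 n (x - y))"
    by (rule integrableI_nonneg) (auto simp: moll2)
  show "(\<integral>y. moll2 n (x - y) \<partial>lborel) = 1"
    using moll2(5)[of n x] by (subst integral_eq_nn_integral) (auto simp: moll2)
qed

abbreviation mconv :: "nat \<Rightarrow> (real ^ 2 \<Rightarrow> real) \<Rightarrow> real ^ 2 \<Rightarrow> real" where
  "mconv n f \<equiv> conv f (moll n) (moll n)"

lemma mconv_eq: "mconv n f x = (\<integral>y. f y * moll2 n (x - y) \<partial>lborel)"
  by (simp add: conv_def moll2_def)

lemma mconv_integrable: "integrable lborel f \<Longrightarrow> integrable lborel (\<lambda>y. f y * moll2 n (x - y))"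
  unfolding moll2_def by (intro conv_integrable moll)

section \<open>Convergence of mollifications in L1 and L2\<close>

definition LpN :: "nat \<Rightarrow> (real ^ 2 \<Rightarrow> real) \<Rightarrow> ennreal" where
  "LpN p f = (\<integral>\<^sup>+x. ennreal (\<bar>f x\<bar> ^ p) \<partial>lborel)"

text \<open>Jensen's inequality for the probability density \<open>moll2 n (x - _)\<close>; for \<open>p = 2\<close> it is the
  nonnegativity of the variance.\<close>

lemma mconv_jensen:
  assumes f: "integrable lborel f" and p: "p = 1 \<or> p = 2"
  shows "ennreal (\<bar>mconv n f x\<bar> ^ p) \<le> (\<integral>\<^sup>+y. ennreal (\<bar>f y\<bar> ^ p * moll2 n (x - y)) \<partial>lborel)"
proof (cases "(\<integral>\<^sup>+y. ennreal (\<bar>f y\<bar> ^ p * moll2 n (x - y)) \<partial>lborel) = \<infinity>")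
  case False
  note [measurable] = moll2(3)
  have [measurable]: "f \<in> borel_measurable borel" using f by auto
  have nn: "0 \<le> \<bar>f y\<bar> ^ p * moll2 n (x - y)" for y by (simp add: moll2)
  have i: "integrable lborel (\<lambda>y. \<bar>f y\<bar> ^ p * moll2 n (x - y))"
    using False nn by (intro integrableI_nonneg) (auto simp: less_top)
  note im = mconv_integrable[OF f, of n x]
  have "\<bar>mconv n f x\<bar> ^ p \<le> (\<integral>y. \<bar>f y\<bar> ^ p * moll2 n (x - y) \<partial>lborel)"
    using p
  proof
    assume "p = 1"
    then show ?thesis
      using integral_abs_bound[of lborel "\<lambda>y. f y * moll2 n (x - y)"]
      by (simp add: mconv_eq abs_mult moll2)
  next
    assume p2: "p = 2"
    define m where "m = mconv n f x"
    have eq: "(f y - m)\<^sup>2 * moll2 n (x - y) =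
       \<bar>f y\<bar> ^ p * moll2 n (x - y) - 2 * m * (f y * moll2 n (x - y)) + m\<^sup>2 * moll2 n (x - y)" for y
      by (simp add: p2 power2_diff algebra_simps)
    have "0 \<le> (\<integral>y. (f y - m)\<^sup>2 * moll2 n (x - y) \<partial>lborel)"
      by (intro integral_nonneg_AE) (auto simp: moll2)
    also have "\<dots> = (\<integral>y. \<bar>f y\<bar> ^ p * moll2 n (x - y) \<partial>lborel) - 2 * m * m + m\<^sup>2"
    proof -
      have "has_bochner_integral lborel (\<lambda>y. f y * moll2 n (x - y)) m"
        "has_bochner_integral lborel (\<lambda>y. moll2 n (x - y)) 1"
        using im moll2_integral[of n x] by (auto simp: has_bochner_integral_iff m_def mconv_eq)
      with has_bochner_integral_integrable[OF i]
      have "has_bochner_integral lborel (\<lambda>y. (f y - m)\<^sup>2 * moll2 n (x - y))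
         ((\<integral>y. \<bar>f y\<bar> ^ p * moll2 n (x - y) \<partial>lborel) - 2 * m * m + m\<^sup>2 * 1)"
        unfolding eq
        by (intro has_bochner_integral_diff has_bochner_integral_add has_bochner_integral_mult_right)
      then show ?thesis by (simp add: has_bochner_integral_iff)
    qed
    finally show ?thesis by (simp add: p2 m_def[symmetric] power2_eq_square)
  qed
  also have "ennreal \<dots> = (\<integral>\<^sup>+y. ennreal (\<bar>f y\<bar> ^ p * moll2 n (x - y)) \<partial>lborel)"
    using i nn by (intro nn_integral_eq_integral[symmetric]) auto
  finally show ?thesis by (simp add: ennreal_leI)
qed simp

lemma borel_measurable_mconv: "integrable lborel f \<Longrightarrow> mconv n f \<in> borel_measurable borel"
  by (intro borel_measurable_continuous_onI conv_continuous moll)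

text \<open>Jensen's inequality pointwise, then Tonelli: the kernel has mass 1 in either
  variable.\<close>

lemma LpN_mconv:
  assumes f: "integrable lborel f" and p: "p = 1 \<or> p = 2"
  shows "LpN p (mconv n f) \<le> LpN p f"
proof -
  note [measurable] = moll2(3) borel_measurable_mconv[OF f]
  have [measurable]: "f \<in> borel_measurable borel" using f by auto
  have "LpN p (mconv n f) \<le> (\<integral>\<^sup>+x. \<integral>\<^sup>+y. ennreal (\<bar>f y\<bar> ^ p * moll2 n (x - y)) \<partial>lborel \<partial>lborel)"
    unfolding LpN_def by (intro nn_integral_mono mconv_jensen f p)
  also have "\<dots> = (\<integral>\<^sup>+y. \<integral>\<^sup>+x. ennreal (\<bar>f y\<bar> ^ p * moll2 n (x - y)) \<partial>lborel \<partial>lborel)"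
    by (rule lborel_pair.Fubini') measurable
  also have "\<dots> = LpN p f"
    unfolding LpN_def by (auto simp: ennreal_mult moll2 nn_integral_cmult intro!: nn_integral_cong)
  finally show ?thesis .
qed

lemma abs_add_power:
  fixes a b c :: real
  assumes "p = 1 \<or> p = 2"
  shows "\<bar>a + b + c\<bar> ^ p \<le> 3 * (\<bar>a\<bar> ^ p + \<bar>b\<bar> ^ p + \<bar>c\<bar> ^ p)"
  using assms
proof
  assume "p = 2"
  have "0 \<le> (a - b)\<^sup>2 + (a - c)\<^sup>2 + (b - c)\<^sup>2" by simp
  also have "\<dots> = 3 * (a\<^sup>2 + b\<^sup>2 + c\<^sup>2) - (a + b + c)\<^sup>2"
    by (simp add: power2_eq_square algebra_simps)
  finally show ?thesis using \<open>p = 2\<close> by simp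
qed simp

text \<open>A substitute for the triangle inequality: \<open>LpN\<close> is the power of the norm
  without the root, and the factor 3 comes from convexity of the square for three summands.\<close>

lemma LpN_add:
  assumes p: "p = 1 \<or> p = 2" and [measurable]: "f \<in> borel_measurable borel"
    "g \<in> borel_measurable borel" "h \<in> borel_measurable borel"
  shows "LpN p (\<lambda>x. f x + g x + h x) \<le> 3 * (LpN p f + LpN p g + LpN p h)"
proof -
  have "LpN p (\<lambda>x. f x + g x + h x) \<le>
      (\<integral>\<^sup>+x. 3 * (ennreal (\<bar>f x\<bar> ^ p) + ennreal (\<bar>g x\<bar> ^ p) + ennreal (\<bar>h x\<bar> ^ p)) \<partial>lborel)"
    unfolding LpN_def
  proof (rule nn_integral_mono)
    fix x
    have "ennreal (\<bar>f x + g x + h x\<bar> ^ p) \<le> ennreal (3 * (\<bar>f x\<bar> ^ p + \<bar>g x\<bar> ^ p + \<bar>h x\<bar> ^ p))"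
      by (intro ennreal_leI abs_add_power p)
    then show "ennreal (\<bar>f x + g x + h x\<bar> ^ p)
        \<le> 3 * (ennreal (\<bar>f x\<bar> ^ p) + ennreal (\<bar>g x\<bar> ^ p) + ennreal (\<bar>h x\<bar> ^ p))"
      by (subst (asm) ennreal_mult) (auto simp: ennreal_plus)
  qed
  also have "\<dots> = 3 * (LpN p f + LpN p g + LpN p h)"
    unfolding LpN_def by (simp add: nn_integral_cmult nn_integral_add)
  finally show ?thesis .
qed

text \<open>Density of continuous functions of bounded support. The two approximation errors are
  below e / 6 each, which the factor 3 of \<open>LpN_add\<close> turns into
  \<open>e\<close>.\<close>

lemma LpN_dense:
  assumes f: "integrable lborel f" and p: "p = 1 \<or> p = 2" and fin: "LpN p f < \<infinity>" and e: "(e :: real) > 0"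
  obtains g R where "continuous_on UNIV g" "\<And>x. norm x > R \<Longrightarrow> g x = 0" "LpN p (\<lambda>x. f x - g x) < ennreal e"
proof -
  have [measurable]: "f \<in> borel_measurable borel" using f by auto
  have p0: "(0 :: real) ^ p = 0" using p by auto
  have tp: "((\<lambda>i. ennreal (\<bar>u i\<bar> ^ p)) \<longlongrightarrow> 0) F" if "(u \<longlongrightarrow> 0) F" for u :: "nat \<Rightarrow> real" and F
  proof -
    have "((\<lambda>i. ennreal (\<bar>u i\<bar> ^ p)) \<longlongrightarrow> ennreal (\<bar>0\<bar> ^ p)) F"
      by (intro tendsto_intros that)
    then show ?thesis using p0 by simp
  qed
  \<comment> \<open>Truncation in space and in size at once; the next approximation then has an
    integrable bound.\<close>
  define h where "h k x = (if norm x \<le> real k \<and> \<bar>f x\<bar> \<le> real k then f x else 0)" for k x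
  have [measurable]: "h k \<in> borel_measurable borel" for k unfolding h_def by measurable
  have "(\<lambda>k. \<integral>\<^sup>+x. ennreal (\<bar>f x - h k x\<bar> ^ p) \<partial>lborel) \<longlonglongrightarrow> (\<integral>\<^sup>+_. 0 \<partial>(lborel :: (real ^ 2) measure))"
  proof (rule nn_integral_dominated_convergence[where w = "\<lambda>x. ennreal (\<bar>f x\<bar> ^ p)"])
    show "(\<integral>\<^sup>+x. ennreal (\<bar>f x\<bar> ^ p) \<partial>lborel) < \<infinity>" using fin by (simp add: LpN_def)
    show "AE x in lborel. ennreal (\<bar>f x - h j x\<bar> ^ p) \<le> ennreal (\<bar>f x\<bar> ^ p)" for j
      by (auto simp: h_def p0)
    have "\<forall>\<^sub>F k in sequentially. f x - h k x = 0" for x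
    proof -
      obtain k0 where "norm x + \<bar>f x\<bar> \<le> real k0" using real_arch_simple by blast
      then have "f x - h k x = 0" if "k \<ge> k0" for k
      proof -
        have "norm x + \<bar>f x\<bar> \<le> real k"
          using \<open>norm x + \<bar>f x\<bar> \<le> real k0\<close> that by linarith
        then have "norm x \<le> real k" "\<bar>f x\<bar> \<le> real k"
          using norm_ge_zero[of x] by linarith+
        then show ?thesis by (simp add: h_def)
      qed
      then show ?thesis by (auto simp: eventually_sequentially)
    qed
    then show "AE x in lborel. (\<lambda>i. ennreal (\<bar>f x - h i x\<bar> ^ p)) \<longlonglongrightarrow> 0"
      by (intro AE_I2 tp tendsto_eventually)
  qed measurable
  then have "(\<lambda>k. LpN p (\<lambda>x. f x - h k x)) \<longlonglongrightarrow> 0" by (simp add: LpN_def)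
  moreover have e6: "ennreal (e / 6) > 0" using e by simp
  ultimately have "\<forall>\<^sub>F k in sequentially. LpN p (\<lambda>x. f x - h k x) < ennreal (e / 6)"
    by (rule order_tendstoD(2))
  then obtain k where k: "LpN p (\<lambda>x. f x - h k x) < ennreal (e / 6)"
    using eventually_happens by fastforce
  \<comment> \<open>By definition of \<open>measurable_on\<close> there are continuous functions
    converging to \<open>h k\<close> almost everywhere. This takes the place of Lusin's
    theorem.\<close>
  have "h k measurable_on UNIV"
    by (rule lebesgue_measurable_imp_measurable_on) (auto intro: measurable_completion)
  then obtain N g where N: "negligible N" and g: "\<And>n. continuous_on UNIV (g n)"
    "\<And>x. x \<notin> N \<Longrightarrow> (\<lambda>n. g n x) \<longlonglongrightarrow> h k x"
    unfolding measurable_on_def by (simp only: UNIV_I if_True) blast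
  \<comment> \<open>The continuous approximants have no common bound or support. Clipping to [-k, k]
    and multiplying by this cutoff supplies both and does not change the limit
    \<open>h k\<close>.\<close>
  define c where "c x = max 0 (min 1 (real k + 1 - norm x))" for x :: "real ^ 2"
  define G where "G n x = c x * max (- real k) (min (real k) (g n x))" for n x
  have c: "0 \<le> c x" "c x \<le> 1" "norm x \<le> real k \<Longrightarrow> c x = 1" "norm x > real k + 1 \<Longrightarrow> c x = 0" for x
    by (auto simp: c_def)
  have contG: "continuous_on UNIV (G n)" for n
    unfolding G_def c_def by (intro continuous_intros g)
  then have [measurable]: "G n \<in> borel_measurable borel" for n
    by (rule borel_measurable_continuous_onI)
  have hk: "\<bar>h k x\<bar> \<le> real k" "norm x > real k \<Longrightarrow> h k x = 0" for x by (auto simp: h_def)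
  have Gk: "\<bar>G n x\<bar> \<le> real k" for n x
  proof -
    have "\<bar>G n x\<bar> \<le> 1 * real k" unfolding G_def abs_mult using c[of x]
      by (intro mult_mono) auto
    then show ?thesis by simp
  qed
  have "(\<lambda>n. \<integral>\<^sup>+x. ennreal (\<bar>h k x - G n x\<bar> ^ p) \<partial>lborel) \<longlonglongrightarrow> (\<integral>\<^sup>+_. 0 \<partial>(lborel :: (real ^ 2) measure))"
  proof (rule nn_integral_dominated_convergence[where
        w = "\<lambda>x. ennreal ((2 * real k) ^ p) * indicator (cball 0 (real k + 1)) x"])
    show "(\<integral>\<^sup>+x. ennreal ((2 * real k) ^ p) * indicator (cball (0 :: real ^ 2) (real k + 1)) x \<partial>lborel) < \<infinity>"
      using emeasure_lborel_cball_finite[of "0 :: real ^ 2" "real k + 1"]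
      by (subst nn_integral_cmult_indicator) (auto simp: ennreal_mult_less_top)
    show "AE x in lborel. ennreal (\<bar>h k x - G j x\<bar> ^ p) \<le>
        ennreal ((2 * real k) ^ p) * indicator (cball 0 (real k + 1)) x" for j
    proof (rule AE_I2)
      fix x :: "real ^ 2"
      have "\<bar>h k x - G j x\<bar> \<le> 2 * real k" using hk(1)[of x] Gk[of j x] by linarith
      then have "\<bar>h k x - G j x\<bar> ^ p \<le> (2 * real k) ^ p" by (intro power_mono) auto
      moreover have "\<bar>h k x - G j x\<bar> ^ p = 0" if "norm x > real k + 1"
        using that c(4)[of x] hk(2)[of x] p0 by (simp add: G_def)
      ultimately show "ennreal (\<bar>h k x - G j x\<bar> ^ p) \<le>
        ennreal ((2 * real k) ^ p) * indicator (cball 0 (real k + 1)) x"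
        by (cases "norm x > real k + 1") (auto simp: ennreal_leI)
    qed
    have "AE x in lborel. x \<notin> N"
      using N AE_not_in[of N lebesgue] by (simp add: negligible_iff_null_sets AE_completion_iff)
    then show "AE x in lborel. (\<lambda>i. ennreal (\<bar>h k x - G i x\<bar> ^ p)) \<longlonglongrightarrow> 0"
    proof eventually_elim
      case (elim x)
      have "(\<lambda>i. h k x - G i x) \<longlonglongrightarrow> h k x - c x * max (- real k) (min (real k) (h k x))"
        unfolding G_def by (intro tendsto_intros g(2) elim)
      also have "h k x - c x * max (- real k) (min (real k) (h k x)) = 0"
        using hk[of x] c(3)[of x] by (cases "norm x > real k") auto
      finally show ?case by (rule tp)
    qed
  qed (measurable, simp)
  then have "(\<lambda>n. LpN p (\<lambda>x. h k x - G n x)) \<longlonglongrightarrow> 0" by (simp add: LpN_def)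
  then have "\<forall>\<^sub>F n in sequentially. LpN p (\<lambda>x. h k x - G n x) < ennreal (e / 6)"
    using e6 by (rule order_tendstoD(2))
  then obtain n where n: "LpN p (\<lambda>x. h k x - G n x) < ennreal (e / 6)"
    using eventually_happens by fastforce
  have "LpN p (\<lambda>x. f x - G n x) = LpN p (\<lambda>x. (f x - h k x) + (h k x - G n x) + 0)" by simp
  also have "\<dots> \<le> 3 * (LpN p (\<lambda>x. f x - h k x) + LpN p (\<lambda>x. h k x - G n x) + LpN p (\<lambda>x. 0))"
    by (intro LpN_add p) measurable
  also have "\<dots> = 3 * (LpN p (\<lambda>x. f x - h k x) + LpN p (\<lambda>x. h k x - G n x))"
    using p0 by (simp add: LpN_def)
  also have "\<dots> < 3 * (ennreal (e / 6) + ennreal (e / 6))"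
    using k n by (intro ennreal_mult_strict_left_mono add_strict_mono) auto
  also have "\<dots> = ennreal e"
    using e by (simp add: ennreal_plus[symmetric] ennreal_mult[symmetric] flip: ennreal_numeral del: ennreal_plus)
  finally show ?thesis using that contG c(4) by (fastforce simp: G_def)
qed

lemma ennreal_tendsto_0I:
  assumes "\<And>e::real. e > 0 \<Longrightarrow> \<forall>\<^sub>F n in F. f n \<le> ennreal e"
  shows "(f \<longlongrightarrow> (0::ennreal)) F"
proof (rule order_tendstoI)
  fix a :: ennreal assume a: "0 < a"
  then obtain b where b: "0 < b" "b < a" using dense by blast
  then have "b \<noteq> \<infinity>" by auto
  with b obtain r where r: "b = ennreal r" "r > 0"
    by (cases b) auto
  from assms[OF r(2)] show "\<forall>\<^sub>F n in F. f n < a"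
    by eventually_elim (use b r in auto)
qed auto

lemma LpN_mconv_continuous:
  assumes g: "continuous_on UNIV g" "\<And>x. norm x > R \<Longrightarrow> g x = 0" and p: "p = 1 \<or> p = 2"
  shows "(\<lambda>n. LpN p (\<lambda>x. mconv n g x - g x)) \<longlonglongrightarrow> 0"
proof (rule ennreal_tendsto_0I)
  fix e :: real assume e: "e > 0"
  define R' where "R' = max R 0"
  have gR: "g x = 0" if "norm x > R'" for x using that g(2) by (auto simp: R'_def)
  have gi: "integrable lborel g" using g by (rule integrable_compact_support)
  have [measurable]: "g \<in> borel_measurable borel" using gi by auto
  define M where "M = measure lborel (cball (0 :: real ^ 2) (R' + 2))"
  have M: "M \<ge> 0" "emeasure lborel (cball (0 :: real ^ 2) (R' + 2)) = ennreal M"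
    using emeasure_lborel_cball_finite[of "0 :: real ^ 2" "R' + 2"]
    by (simp_all add: M_def emeasure_eq_ennreal_measure)
  \<comment> \<open>At most 1 so that its power with exponent \<open>p\<close> is no larger than
    itself; the second entry makes the bound times the area of the ball at most
    \<open>e\<close>.\<close>
  define \<eta> where "\<eta> = min 1 (e / (M + 1))"
  have \<eta>: "\<eta> > 0" "\<eta> \<le> 1" "\<eta> * M \<le> e"
  proof -
    show "\<eta> > 0" "\<eta> \<le> 1" using e M by (auto simp: \<eta>_def)
    have "\<eta> * M \<le> (e / (M + 1)) * (M + 1)"
      using e M by (intro mult_mono) (auto simp: \<eta>_def)
    then show "\<eta> * M \<le> e" using M by simp
  qed
  have "uniformly_continuous_on (cball 0 (R' + 3)) g"
    by (intro compact_uniformly_continuous continuous_on_subset[OF g(1)]) auto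
  then obtain d where d: "d > 0"
    "\<And>x y. x \<in> cball 0 (R' + 3) \<Longrightarrow> y \<in> cball 0 (R' + 3) \<Longrightarrow> dist y x < d \<Longrightarrow> dist (g y) (g x) < \<eta>"
    using \<eta>(1) unfolding uniformly_continuous_on_def by metis
  have "(\<lambda>n. 2 * (1 / real (Suc n))) \<longlonglongrightarrow> 2 * 0"
    using LIMSEQ_inverse_real_of_nat unfolding inverse_eq_divide
    by (intro tendsto_mult tendsto_const)
  then have "\<forall>\<^sub>F n in sequentially. 2 * (1 / real (Suc n)) < min d 1"
    using d(1) by (intro order_tendstoD(2)) auto
  then show "\<forall>\<^sub>F n in sequentially. LpN p (\<lambda>x. mconv n g x - g x) \<le> ennreal e"
  proof eventually_elim
    case (elim n)
    then have n: "2 / real (Suc n) < d" "2 / real (Suc n) < 1" by auto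
    note im = mconv_integrable[OF gi] moll2_integral
    have diff: "\<bar>mconv n g x - g x\<bar> \<le> \<eta>" if x: "norm x \<le> R' + 2" for x
    proof -
      have "has_bochner_integral lborel (\<lambda>y. g y * moll2 n (x - y) - g x * moll2 n (x - y))
          (mconv n g x - g x * 1)"
        unfolding mconv_eq using im[of n x]
        by (intro has_bochner_integral_diff has_bochner_integral_mult_right)
           (auto simp: has_bochner_integral_iff)
      then have h: "has_bochner_integral lborel (\<lambda>y. (g y - g x) * moll2 n (x - y)) (mconv n g x - g x)"
        by (simp add: left_diff_distrib)
      then have i: "integrable lborel (\<lambda>y. (g y - g x) * moll2 n (x - y))"
        by (simp add: has_bochner_integral_iff)
      have "\<bar>mconv n g x - g x\<bar> = \<bar>\<integral>y. (g y - g x) * moll2 n (x - y) \<partial>lborel\<bar>"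
        using h by (simp add: has_bochner_integral_iff)
      also have "\<dots> \<le> (\<integral>y. \<bar>(g y - g x) * moll2 n (x - y)\<bar> \<partial>lborel)"
        by (rule integral_abs_bound)
      also have "\<dots> \<le> (\<integral>y. \<eta> * moll2 n (x - y) \<partial>lborel)"
      proof (rule integral_mono)
        show "integrable lborel (\<lambda>y. \<bar>(g y - g x) * moll2 n (x - y)\<bar>)" using i by simp
        show "integrable lborel (\<lambda>y. \<eta> * moll2 n (x - y))" using im by simp
        fix y
        show "\<bar>(g y - g x) * moll2 n (x - y)\<bar> \<le> \<eta> * moll2 n (x - y)"
        proof (cases "norm (x - y) > 2 / real (Suc n)")
          case False
          then have "dist y x < d" "norm (x - y) \<le> 1"
            using n unfolding dist_norm norm_minus_commute[of y x] by linarith+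
          moreover from this have "norm y \<le> R' + 3"
            using norm_triangle_ineq2[of y x] x by (auto simp: norm_minus_commute)
          ultimately have "\<bar>g y - g x\<bar> \<le> \<eta>"
            using d(2)[of x y] x by (auto simp: dist_real_def)
          then show ?thesis by (auto simp: abs_mult moll2 intro!: mult_right_mono)
        qed (simp add: moll2)
      qed
      also have "\<dots> = \<eta>" using im by simp
      finally show ?thesis .
    qed
    have zero: "mconv n g x - g x = 0" if x: "norm x > R' + 2" for x
    proof -
      have "g y * moll2 n (x - y) = 0" for y
      proof (cases "norm y > R'")
        case False
        then have "norm (x - y) > 2 / real (Suc n)"
          using norm_triangle_ineq2[of x y] x n by linarith
        then show ?thesis by (simp add: moll2)
      qed (simp add: gR)
      then have "mconv n g x = 0" unfolding mconv_eq by (simp only: integral_zero)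
      then show ?thesis using x gR[of x] by simp
    qed
    have "LpN p (\<lambda>x. mconv n g x - g x) \<le> (\<integral>\<^sup>+x. ennreal \<eta> * indicator (cball (0 :: real ^ 2) (R' + 2)) x \<partial>lborel)"
      unfolding LpN_def
    proof (rule nn_integral_mono)
      fix x
      show "ennreal (\<bar>mconv n g x - g x\<bar> ^ p) \<le> ennreal \<eta> * indicator (cball 0 (R' + 2)) x"
      proof (cases "norm x > R' + 2")
        case True
        then show ?thesis using zero[of x] p by auto
      next
        case False
        then have d: "\<bar>mconv n g x - g x\<bar> \<le> \<eta>" using diff by auto
        have "\<bar>mconv n g x - g x\<bar> ^ p \<le> \<eta> ^ p" using d by (intro power_mono) auto
        also have "\<dots> \<le> \<eta>" using p \<eta> mult_left_mono[of \<eta> 1 \<eta>] by (auto simp: power2_eq_square)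
        finally show ?thesis using False by (auto simp: ennreal_leI)
      qed
    qed
    also have "\<dots> = ennreal (\<eta> * M)"
      using \<eta> M by (simp add: nn_integral_cmult_indicator ennreal_mult)
    also have "\<dots> \<le> ennreal e" using \<eta> by (intro ennreal_leI)
    finally show ?case .
  qed
qed

text \<open>Mollification does not increase \<open>LpN\<close>, so the claim passes from continuous
  functions of bounded support to all \<open>f\<close>. Three errors of at most e / 9 and the factor
  3 of \<open>LpN_add\<close> give \<open>e\<close>.\<close>

theorem mconv_tendsto:
  assumes f: "integrable lborel f" and p: "p = 1 \<or> p = 2" and fin: "LpN p f < \<infinity>"
  shows "(\<lambda>n. LpN p (\<lambda>x. mconv n f x - f x)) \<longlonglongrightarrow> 0"
proof (rule ennreal_tendsto_0I)
  fix e :: real assume e: "e > 0"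
  then have e9: "e / 9 > 0" by simp
  from LpN_dense[OF f p fin this] obtain g R where
    g: "continuous_on UNIV g" "\<And>x. norm x > R \<Longrightarrow> g x = 0" "LpN p (\<lambda>x. f x - g x) < ennreal (e / 9)"
    by metis
  have gi: "integrable lborel g" using g(1,2) by (rule integrable_compact_support)
  have [measurable]: "f \<in> borel_measurable borel" "g \<in> borel_measurable borel" using f gi by auto
  have "\<forall>\<^sub>F n in sequentially. LpN p (\<lambda>x. mconv n g x - g x) < ennreal (e / 9)"
    using e by (intro order_tendstoD(2)[OF LpN_mconv_continuous[OF g(1,2) p]]) auto
  then show "\<forall>\<^sub>F n in sequentially. LpN p (\<lambda>x. mconv n f x - f x) \<le> ennreal e"
  proof eventually_elim
    case (elim n)
    note [measurable] = borel_measurable_mconv[OF f] borel_measurable_mconv[OF gi]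
       borel_measurable_mconv[of "\<lambda>x. f x - g x"]
    have "mconv n f x - f x = mconv n (\<lambda>x. f x - g x) x + (mconv n g x - g x) + (g x - f x)" for x
      using conv_diff[OF f gi moll(1) moll(1), of n n x] by simp
    then have "LpN p (\<lambda>x. mconv n f x - f x) =
       LpN p (\<lambda>x. mconv n (\<lambda>x. f x - g x) x + (mconv n g x - g x) + (g x - f x))"
      by (simp only:)
    also have "\<dots> \<le> 3 * (LpN p (mconv n (\<lambda>x. f x - g x)) + LpN p (\<lambda>x. mconv n g x - g x) + LpN p (\<lambda>x. g x - f x))"
      using f gi by (intro LpN_add p borel_measurable_mconv borel_measurable_diff) auto
    also have "LpN p (\<lambda>x. g x - f x) = LpN p (\<lambda>x. f x - g x)"
      by (simp add: LpN_def abs_minus_commute)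
    also have "3 * (LpN p (mconv n (\<lambda>x. f x - g x)) + LpN p (\<lambda>x. mconv n g x - g x) + LpN p (\<lambda>x. f x - g x))
        \<le> 3 * (ennreal (e / 9) + ennreal (e / 9) + ennreal (e / 9))"
      using elim g(3) LpN_mconv[of "\<lambda>x. f x - g x" p n] f gi p
      by (intro mult_left_mono add_mono) auto
    also have "\<dots> = ennreal e"
      using e by (simp add: ennreal_plus[symmetric] ennreal_mult[symmetric] flip: ennreal_numeral del: ennreal_plus)
    finally show ?case .
  qed
qed

subsection \<open>Products and compositions of Sobolev functions\<close>

lemma has_grad_lipschitz:
  assumes "has_grad p p1 p2" "\<And>x. \<bar>p1 x\<bar> \<le> C" "\<And>x. \<bar>p2 x\<bar> \<le> C"
  shows "\<bar>p x - p y\<bar> \<le> 2 * C * norm (x - y)"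
proof -
  have "norm (p x - p y) \<le> 2 * C * norm (x - y)"
  proof (rule differentiable_bound[of UNIV])
    fix z :: "real ^ 2"
    show "(p has_derivative (\<lambda>k. p1 z * k $ 1 + p2 z * k $ 2)) (at z within UNIV)"
      using assms by (simp add: has_grad_def)
    have C: "C \<ge> 0" using assms(2)[of z] by linarith
    show "onorm (\<lambda>k :: real ^ 2. p1 z * k $ 1 + p2 z * k $ 2) \<le> 2 * C"
    proof (rule onorm_bound)
      show "0 \<le> 2 * C" using C by simp
      fix k :: "real ^ 2"
      have "\<bar>p1 z * k $ 1\<bar> \<le> C * norm k" "\<bar>p2 z * k $ 2\<bar> \<le> C * norm k"
        unfolding abs_mult using assms C component_le_norm_cart by (auto intro!: mult_mono)
      then show "norm (p1 z * k $ 1 + p2 z * k $ 2) \<le> 2 * C * norm k"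
        by (auto simp: abs_le_iff)
    qed
  qed auto
  then show ?thesis by simp
qed

lemma norm_le_abs_sum: "norm (x :: real ^ 2) \<le> \<bar>x $ 1\<bar> + \<bar>x $ 2\<bar>"
  using norm_le_l1_cart[of x] by (simp add: sum_2)

lemma LpN_2_integrable:
  assumes [measurable]: "f \<in> borel_measurable borel" and "LpN 2 f < \<infinity>"
  shows "integrable lborel (\<lambda>x. (f x)\<^sup>2)" "ennreal (\<integral>x. (f x)\<^sup>2 \<partial>lborel) = LpN 2 f"
proof -
  show i: "integrable lborel (\<lambda>x. (f x)\<^sup>2)"
    using assms by (intro integrableI_nonneg) (auto simp: LpN_def)
  show "ennreal (\<integral>x. (f x)\<^sup>2 \<partial>lborel) = LpN 2 f"
    using nn_integral_eq_integral[OF i] by (simp add: LpN_def)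
qed

lemma LpN_1_integrable:
  assumes "integrable lborel f"
  shows "ennreal (\<integral>x. \<bar>f x\<bar> \<partial>lborel) = LpN 1 f"
  using nn_integral_eq_integral[OF integrable_abs[OF assms]] by (simp add: LpN_def)

lemma LpN_1_finite: "integrable lborel f \<Longrightarrow> LpN 1 f < \<infinity>"
  by (subst LpN_1_integrable[symmetric]) auto

lemma integrable_L2_prod:
  fixes f h \<psi> :: "real ^ 2 \<Rightarrow> real"
  assumes [measurable]: "f \<in> borel_measurable borel" "h \<in> borel_measurable borel" "\<psi> \<in> borel_measurable borel"
    and "LpN 2 f < \<infinity>" "LpN 2 h < \<infinity>" "\<And>x. \<bar>\<psi> x\<bar> \<le> B"
  shows "integrable lborel (\<lambda>x. \<psi> x * (f x * h x))"
proof (rule Bochner_Integration.integrable_bound)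
  show "integrable lborel (\<lambda>x. B * ((f x)\<^sup>2 + (h x)\<^sup>2))"
    using LpN_2_integrable assms by auto
  have B: "B \<ge> 0" using assms(6)[of 0] by linarith
  show "AE x in lborel. norm (\<psi> x * (f x * h x)) \<le> norm (B * ((f x)\<^sup>2 + (h x)\<^sup>2))"
  proof (rule AE_I2)
    fix x
    have "0 \<le> (\<bar>f x\<bar> - \<bar>h x\<bar>)\<^sup>2" by simp
    then have "2 * \<bar>f x * h x\<bar> \<le> (f x)\<^sup>2 + (h x)\<^sup>2" by (simp add: power2_diff abs_mult)
    then have "\<bar>f x * h x\<bar> \<le> (f x)\<^sup>2 + (h x)\<^sup>2" by (smt (verit) abs_ge_zero)
    then have "\<bar>\<psi> x\<bar> * \<bar>f x * h x\<bar> \<le> B * ((f x)\<^sup>2 + (h x)\<^sup>2)"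
      using assms B by (intro mult_mono) auto
    then show "norm (\<psi> x * (f x * h x)) \<le> norm (B * ((f x)\<^sup>2 + (h x)\<^sup>2))"
      using B by (simp add: abs_mult)
  qed
qed measurable

text \<open>Young's inequality with a free parameter: the differences carry a large factor but tend
  to 0, while the fixed functions carry the small factor \<open>t\<close>. This yields convergence
  of products in L1 without square roots of integrals.\<close>

lemma prod_diff_bound:
  fixes f h f' h' t :: real
  assumes "t > 0"
  shows "\<bar>f' * h' - f * h\<bar> \<le> (1 + 1 / t) * ((f' - f)\<^sup>2 + (h' - h)\<^sup>2) + t * (f\<^sup>2 + h\<^sup>2)"
proof -
  have am: "\<bar>a * b\<bar> \<le> a\<^sup>2 / t + t * b\<^sup>2" for a b :: real
  proof -
    have "0 \<le> (\<bar>a\<bar> / sqrt t - sqrt t * \<bar>b\<bar>)\<^sup>2" by simp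
    also have "\<dots> = a\<^sup>2 / t + t * b\<^sup>2 - 2 * \<bar>a * b\<bar>"
      using assms by (simp add: power2_diff power_divide power_mult_distrib abs_mult)
    finally have "2 * \<bar>a * b\<bar> \<le> a\<^sup>2 / t + t * b\<^sup>2" by simp
    then show ?thesis by (smt (verit) abs_ge_zero)
  qed
  have am1: "\<bar>a * b\<bar> \<le> a\<^sup>2 + b\<^sup>2" for a b :: real
  proof -
    have "0 \<le> (\<bar>a\<bar> - \<bar>b\<bar>)\<^sup>2" by simp
    then have "2 * \<bar>a * b\<bar> \<le> a\<^sup>2 + b\<^sup>2" by (simp add: power2_diff abs_mult)
    then show ?thesis by (smt (verit) abs_ge_zero)
  qed
  have "f' * h' - f * h = (f' - f) * (h' - h) + (f' - f) * h + (h' - h) * f"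
    by (simp add: algebra_simps)
  also have "\<bar>\<dots>\<bar> \<le> \<bar>(f' - f) * (h' - h)\<bar> + \<bar>(f' - f) * h\<bar> + \<bar>(h' - h) * f\<bar>" by linarith
  also have "\<dots> \<le> ((f' - f)\<^sup>2 + (h' - h)\<^sup>2) + ((f' - f)\<^sup>2 / t + t * h\<^sup>2) + ((h' - h)\<^sup>2 / t + t * f\<^sup>2)"
    by (intro add_mono am am1)
  also have "\<dots> = (1 + 1 / t) * ((f' - f)\<^sup>2 + (h' - h)\<^sup>2) + t * (f\<^sup>2 + h\<^sup>2)"
    by (simp add: algebra_simps)
  finally show ?thesis .
qed

lemma LpN_2_triangle:
  assumes [measurable]: "f \<in> borel_measurable borel" "g \<in> borel_measurable borel"
    and "LpN 2 f < \<infinity>" "LpN 2 (\<lambda>x. g x - f x) < \<infinity>"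
  shows "LpN 2 g < \<infinity>"
proof -
  have "LpN 2 g = LpN 2 (\<lambda>x. f x + (g x - f x) + 0)" by simp
  also have "\<dots> \<le> 3 * (LpN 2 f + LpN 2 (\<lambda>x. g x - f x) + LpN 2 (\<lambda>x. 0))"
    by (intro LpN_add) auto
  also have "\<dots> < \<infinity>"
    using assms(3,4) by (auto simp: LpN_def ennreal_mult_less_top)
  finally show ?thesis .
qed

lemma tendsto_L2_prod:
  fixes f h \<psi> :: "real ^ 2 \<Rightarrow> real"
  assumes m: "f \<in> borel_measurable borel" "h \<in> borel_measurable borel" "\<psi> \<in> borel_measurable borel"
    "\<And>n. F n \<in> borel_measurable borel" "\<And>n. H n \<in> borel_measurable borel"
    and fin: "LpN 2 f < \<infinity>" "LpN 2 h < \<infinity>" and B: "\<And>x. \<bar>\<psi> x\<bar> \<le> B"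
    and lim: "(\<lambda>n. LpN 2 (\<lambda>x. F n x - f x)) \<longlonglongrightarrow> 0" "(\<lambda>n. LpN 2 (\<lambda>x. H n x - h x)) \<longlonglongrightarrow> 0"
  shows "(\<lambda>n. \<integral>x. \<psi> x * (F n x * H n x) \<partial>lborel) \<longlonglongrightarrow> (\<integral>x. \<psi> x * (f x * h x) \<partial>lborel)"
proof (rule tendstoI)
  fix e :: real assume e: "e > 0"
  note [measurable] = m
  have B0: "B \<ge> 0" using B[of 0] by linarith
  define S where "S = (\<integral>x. (f x)\<^sup>2 \<partial>lborel) + (\<integral>x. (h x)\<^sup>2 \<partial>lborel)"
  have S: "S \<ge> 0" by (simp add: S_def)
  \<comment> \<open>The order of choices matters: \<open>t\<close> makes the contribution of the
    fixed functions less than e / 2, and \<delta> below is chosen depending on \<open>t\<close> for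
    the contribution of the differences. The added 1s exclude division by 0.\<close>
  define t where "t = e / (4 * (B + 1) * (S + 1))"
  have t: "t > 0" using e B0 S by (simp add: t_def)
  have tS: "B * t * S < e / 2"
  proof -
    have "B * S * e \<le> (B + 1) * (S + 1) * e"
      using B0 S e by (intro mult_right_mono mult_mono) auto
    then have "B * t * S \<le> e / 4"
      using B0 S by (simp add: t_def divide_simps split: if_splits) (simp add: algebra_simps)
    then show ?thesis using e by linarith
  qed
  define \<delta> where "\<delta> = e / (4 * (B + 1) * (1 + 1 / t))"
  have \<delta>: "\<delta> > 0"
  proof -
    have "0 < B + 1" "0 < 1 + 1 / t" using B0 t by (auto intro: add_pos_pos)
    then show ?thesis using e by (simp add: \<delta>_def)
  qed
  have B\<delta>: "B * (1 + 1 / t) * (\<delta> + \<delta>) \<le> e / 2"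
  proof -
    define T where "T = 1 + 1 / t"
    have p: "T > 0" using t by (simp add: T_def add_pos_pos)
    have "B * T * (\<delta> + \<delta>) = (B / (B + 1)) * (e / 2)"
      using p B0 unfolding \<delta>_def T_def[symmetric] by (simp add: divide_simps)
    also have "\<dots> \<le> 1 * (e / 2)" using B0 e by (intro mult_right_mono) auto
    finally show ?thesis by (simp add: T_def)
  qed
  have "\<forall>\<^sub>F n in sequentially. LpN 2 (\<lambda>x. F n x - f x) < ennreal \<delta>"
    "\<forall>\<^sub>F n in sequentially. LpN 2 (\<lambda>x. H n x - h x) < ennreal \<delta>"
    using \<delta> by (auto intro!: order_tendstoD(2)[OF lim(1)] order_tendstoD(2)[OF lim(2)])
  then show "\<forall>\<^sub>F n in sequentially. dist (\<integral>x. \<psi> x * (F n x * H n x) \<partial>lborel) (\<integral>x. \<psi> x * (f x * h x) \<partial>lborel) < e"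
  proof eventually_elim
    case (elim n)
    then have fin': "LpN 2 (\<lambda>x. F n x - f x) < \<infinity>" "LpN 2 (\<lambda>x. H n x - h x) < \<infinity>"
      by (auto simp: less_top[symmetric])
    have FH: "LpN 2 (F n) < \<infinity>" "LpN 2 (H n) < \<infinity>"
      using LpN_2_triangle[of f "F n"] LpN_2_triangle[of h "H n"] fin fin' by auto
    note i = integrable_L2_prod[OF m(4)[of n] m(5)[of n] m(3) FH B] integrable_L2_prod[OF m(1,2,3) fin B]
    define a where "a = (\<integral>x. (F n x - f x)\<^sup>2 \<partial>lborel)"
    define b where "b = (\<integral>x. (H n x - h x)\<^sup>2 \<partial>lborel)"
    have sq: "integrable lborel (\<lambda>x. (F n x - f x)\<^sup>2)" "integrable lborel (\<lambda>x. (H n x - h x)\<^sup>2)"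
       "integrable lborel (\<lambda>x. (f x)\<^sup>2)" "integrable lborel (\<lambda>x. (h x)\<^sup>2)"
      using fin fin' by (auto intro!: LpN_2_integrable)
    have "ennreal a < ennreal \<delta>" "ennreal b < ennreal \<delta>"
      using elim LpN_2_integrable(2)[OF _ fin'(1)] LpN_2_integrable(2)[OF _ fin'(2)]
      by (auto simp: a_def b_def)
    then have ab: "a < \<delta>" "b < \<delta>" by (auto simp: ennreal_less_iff a_def b_def)
    have "dist (\<integral>x. \<psi> x * (F n x * H n x) \<partial>lborel) (\<integral>x. \<psi> x * (f x * h x) \<partial>lborel)
       = \<bar>\<integral>x. \<psi> x * (F n x * H n x) - \<psi> x * (f x * h x) \<partial>lborel\<bar>"
      using i by (simp add: dist_real_def)
    also have "\<dots> \<le> (\<integral>x. \<bar>\<psi> x * (F n x * H n x) - \<psi> x * (f x * h x)\<bar> \<partial>lborel)"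
      by (rule integral_abs_bound)
    also have "\<dots> \<le> (\<integral>x. B * ((1 + 1 / t) * ((F n x - f x)\<^sup>2 + (H n x - h x)\<^sup>2) + t * ((f x)\<^sup>2 + (h x)\<^sup>2)) \<partial>lborel)"
    proof (rule integral_mono)
      show "integrable lborel (\<lambda>x. \<bar>\<psi> x * (F n x * H n x) - \<psi> x * (f x * h x)\<bar>)"
        using i by simp
      show "integrable lborel (\<lambda>x. B * ((1 + 1 / t) * ((F n x - f x)\<^sup>2 + (H n x - h x)\<^sup>2) + t * ((f x)\<^sup>2 + (h x)\<^sup>2)))"
        using sq by (intro integrable_mult_right Bochner_Integration.integrable_add)
      fix x
      have "\<bar>\<psi> x * (F n x * H n x) - \<psi> x * (f x * h x)\<bar> = \<bar>\<psi> x\<bar> * \<bar>F n x * H n x - f x * h x\<bar>"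
        by (simp add: right_diff_distrib flip: abs_mult)
      also have "\<dots> \<le> B * ((1 + 1 / t) * ((F n x - f x)\<^sup>2 + (H n x - h x)\<^sup>2) + t * ((f x)\<^sup>2 + (h x)\<^sup>2))"
        using B B0 t by (intro mult_mono prod_diff_bound) auto
      finally show "\<bar>\<psi> x * (F n x * H n x) - \<psi> x * (f x * h x)\<bar> \<le>
        B * ((1 + 1 / t) * ((F n x - f x)\<^sup>2 + (H n x - h x)\<^sup>2) + t * ((f x)\<^sup>2 + (h x)\<^sup>2))" .
    qed
    also have "\<dots> = B * ((1 + 1 / t) * (a + b) + t * S)"
      using sq by (simp add: a_def b_def S_def)
    also have "\<dots> = B * (1 + 1 / t) * (a + b) + B * t * S"
      by (simp add: algebra_simps)
    also have "\<dots> \<le> B * (1 + 1 / t) * (\<delta> + \<delta>) + B * t * S"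
      using ab B0 t by (intro add_mono mult_left_mono) auto
    also have "\<dots> < e" using B\<delta> tS by linarith
    finally show ?case .
  qed
qed

text \<open>Products of functions of one variable suffice as test functions because the mollifiers are such
  products.\<close>

definition weak_grad :: "(real ^ 2 \<Rightarrow> real) \<Rightarrow> (real ^ 2 \<Rightarrow> real) \<Rightarrow> (real ^ 2 \<Rightarrow> real) \<Rightarrow> bool" where
  "weak_grad f f1 f2 \<longleftrightarrow> (\<forall>a b. tens a b \<in> test_functions (ball 0 1) \<longrightarrow> smooth a \<longrightarrow> smooth b \<longrightarrow>
     (\<integral>y. f y * tens (deriv a) b y \<partial>lborel) = - (\<integral>y. f1 y * tens a b y \<partial>lborel) \<and>
     (\<integral>y. f y * tens a (deriv b) y \<partial>lborel) = - (\<integral>y. f2 y * tens a b y \<partial>lborel))"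

text \<open>The kernel centred at \<open>x\<close>, as a function of the integration variable, lives
  on a square of side 1 / (n + 1) with corner \<open>x\<close>; the hypothesis keeps this square
  inside the disc.\<close>

lemma mconv_test_function:
  fixes x :: "real ^ 2"
  assumes "norm x + 2 / real (Suc n) < 1"
  shows "tens (\<lambda>t. moll n (- 1 * t + x $ 1)) (\<lambda>t. moll n (- 1 * t + x $ 2)) \<in> test_functions (ball 0 1)"
proof (rule tens_test_function)
  have sm: "smooth (moll n)" using moll(1) by (simp add: kern_def)
  show "smooth (\<lambda>t. moll n (- 1 * t + x $ 1))" "smooth (\<lambda>t. moll n (- 1 * t + x $ 2))"
    by (intro smooth_affine sm)+
  let ?d = "1 / real (Suc n)"
  show "moll n (- 1 * t + x $ 1) = 0" if "t \<notin> {x $ 1 - ?d .. x $ 1}" for t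
    using that by (intro moll(3)) auto
  show "moll n (- 1 * t + x $ 2) = 0" if "t \<notin> {x $ 2 - ?d .. x $ 2}" for t
    using that by (intro moll(3)) auto
  fix s t assume "s \<in> {x $ 1 - ?d .. x $ 1}" "t \<in> {x $ 2 - ?d .. x $ 2}"
  then have "\<bar>s - x $ 1\<bar> \<le> ?d" "\<bar>t - x $ 2\<bar> \<le> ?d" by auto
  then have "norm (vec2 s t - x) \<le> 2 / real (Suc n)"
    using norm_le_abs_sum[of "vec2 s t - x"] by simp
  then show "vec2 s t \<in> ball 0 1"
    using norm_triangle_sub[of "vec2 s t" x] assms by simp
qed

text \<open>Differentiating the kernel in the centre instead of the integration variable changes the
  sign, and this sign cancels the one in the definition of a weak derivative.\<close>

lemma mconv_weak_grad:
  assumes w: "weak_grad f f1 f2" and x: "norm x + 2 / real (Suc n) < 1"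
  shows "conv f (deriv (moll n)) (moll n) x = mconv n f1 x"
    "conv f (moll n) (deriv (moll n)) x = mconv n f2 x"
proof -
  have sm: "smooth (moll n)" using moll(1) by (simp add: kern_def)
  let ?a = "\<lambda>t. moll n (- 1 * t + x $ 1)" and ?b = "\<lambda>t. moll n (- 1 * t + x $ 2)"
  have d: "deriv (\<lambda>t. moll n (- 1 * t + c)) t = - deriv (moll n) (- 1 * t + c)" for c t
  proof (rule DERIV_imp_deriv)
    have "((\<lambda>t. - 1 * t + c) has_real_derivative - 1) (at t)"
      by (auto intro!: derivative_eq_intros)
    from DERIV_chain2[OF smooth_deriv(1)[OF sm] this]
    show "((\<lambda>t. moll n (- 1 * t + c)) has_real_derivative - deriv (moll n) (- 1 * t + c)) (at t)" by simp
  qed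
  have s: "smooth ?a" "smooth ?b" by (intro smooth_affine sm)+
  have t: "tens ?a ?b y = tens (moll n) (moll n) (x - y)"
    "tens (deriv ?a) ?b y = - tens (deriv (moll n)) (moll n) (x - y)"
    "tens ?a (deriv ?b) y = - tens (moll n) (deriv (moll n)) (x - y)" for y
    unfolding tens_def d by simp_all
  from w mconv_test_function[OF x] s
  have "(\<integral>y. f y * tens (deriv ?a) ?b y \<partial>lborel) = - (\<integral>y. f1 y * tens ?a ?b y \<partial>lborel)"
     "(\<integral>y. f y * tens ?a (deriv ?b) y \<partial>lborel) = - (\<integral>y. f2 y * tens ?a ?b y \<partial>lborel)"
    unfolding weak_grad_def by blast+
  then show "conv f (deriv (moll n)) (moll n) x = mconv n f1 x"
    "conv f (moll n) (deriv (moll n)) x = mconv n f2 x"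
    unfolding t conv_def by simp_all
qed

lemma borel_measurable_has_grad: "has_grad h h1 h2 \<Longrightarrow> h \<in> borel_measurable borel"
  by (intro borel_measurable_continuous_onI has_grad_continuous)

lemma bounded_compact_support:
  fixes f :: "'a::euclidean_space \<Rightarrow> real"
  assumes "continuous_on UNIV f" "\<And>x. norm x > r \<Longrightarrow> f x = 0"
  shows "\<exists>B. \<forall>x. \<bar>f x\<bar> \<le> B"
proof -
  have "compact (f ` cball 0 r)"
    using assms(1) by (intro compact_continuous_image continuous_on_subset[OF assms(1)]) auto
  then obtain B where B: "B > 0" "\<And>x. x \<in> cball 0 r \<Longrightarrow> \<bar>f x\<bar> \<le> B"
    by (auto simp: bounded_pos dest!: compact_imp_bounded)
  have "\<bar>f x\<bar> \<le> B" for x using B(1) B(2)[of x] assms(2)[of x] by (cases "norm x > r") auto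
  then show ?thesis by blast
qed

lemma integrable_test_lipschitz:
  fixes f :: "real ^ 2 \<Rightarrow> real ^ 2"
  assumes p: "has_grad p p1 p2" and C: "\<And>x. \<bar>p1 x\<bar> \<le> C" "\<And>x. \<bar>p2 x\<bar> \<le> C"
    and \<psi>: "continuous_on UNIV \<psi>" "\<And>x. norm x > r \<Longrightarrow> \<psi> x = 0"
    and [measurable]: "f \<in> borel_measurable borel"
    and f: "integrable lborel (\<lambda>x. f x $ 1)" "integrable lborel (\<lambda>x. f x $ 2)"
  shows "integrable lborel (\<lambda>x. \<psi> x * p (f x))"
proof -
  obtain B1 where B: "\<And>x. \<bar>\<psi> x\<bar> \<le> B1" using bounded_compact_support[OF \<psi>] by blast
  have B0: "B1 \<ge> 0" "C \<ge> 0" using B[of 0] C(1)[of 0] by linarith+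
  have [measurable]: "\<psi> \<in> borel_measurable borel" "p \<in> borel_measurable borel"
    using \<psi> borel_measurable_has_grad[OF p] by (auto intro: borel_measurable_continuous_onI)
  show ?thesis
  proof (rule Bochner_Integration.integrable_bound)
    show "integrable lborel (\<lambda>x. \<bar>\<psi> x\<bar> * \<bar>p 0\<bar> + B1 * (2 * C * (\<bar>f x $ 1\<bar> + \<bar>f x $ 2\<bar>)))"
      using f integrable_compact_support[OF \<psi>] by auto
    show "AE x in lborel. norm (\<psi> x * p (f x)) \<le>
      norm (\<bar>\<psi> x\<bar> * \<bar>p 0\<bar> + B1 * (2 * C * (\<bar>f x $ 1\<bar> + \<bar>f x $ 2\<bar>)))"
    proof (rule AE_I2)
      fix x
      have "\<bar>p (f x) - p 0\<bar> \<le> 2 * C * norm (f x - 0)"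
        using has_grad_lipschitz[OF p C] .
      also have "\<dots> \<le> 2 * C * (\<bar>f x $ 1\<bar> + \<bar>f x $ 2\<bar>)"
        using norm_le_abs_sum[of "f x"] B0 by (intro mult_left_mono) auto
      finally have 1: "\<bar>p (f x) - p 0\<bar> \<le> 2 * C * (\<bar>f x $ 1\<bar> + \<bar>f x $ 2\<bar>)" .
      have "\<psi> x * p (f x) = \<psi> x * p 0 + \<psi> x * (p (f x) - p 0)" by (simp add: algebra_simps)
      also have "\<bar>\<dots>\<bar> \<le> \<bar>\<psi> x\<bar> * \<bar>p 0\<bar> + \<bar>\<psi> x\<bar> * \<bar>p (f x) - p 0\<bar>"
        by (simp flip: abs_mult)
      also have "\<dots> \<le> \<bar>\<psi> x\<bar> * \<bar>p 0\<bar> + B1 * (2 * C * (\<bar>f x $ 1\<bar> + \<bar>f x $ 2\<bar>))"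
        using B B0 1 by (intro add_left_mono mult_mono) auto
      finally show "norm (\<psi> x * p (f x)) \<le> norm (\<bar>\<psi> x\<bar> * \<bar>p 0\<bar> + B1 * (2 * C * (\<bar>f x $ 1\<bar> + \<bar>f x $ 2\<bar>)))"
        by simp
    qed
  qed measurable
qed

text \<open>Integrability is required over the whole plane, so that convolutions are globally
  defined, but the weak derivatives are tested only inside the disc. Hence extension by zero is
  admissible although it creates jumps on the unit circle.\<close>

locale sobolev =
  fixes u1 u2 g11 g12 g21 g22 :: "real ^ 2 \<Rightarrow> real"
  assumes wg: "weak_grad u1 g11 g12" "weak_grad u2 g21 g22"
    and int: "integrable lborel u1" "integrable lborel u2" "integrable lborel g11"
      "integrable lborel g12" "integrable lborel g21" "integrable lborel g22"
    and L2: "LpN 2 u1 < \<infinity>" "LpN 2 u2 < \<infinity>" "LpN 2 g11 < \<infinity>" "LpN 2 g12 < \<infinity>"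
      "LpN 2 g21 < \<infinity>" "LpN 2 g22 < \<infinity>"
begin

lemma meas [measurable]:
  "u1 \<in> borel_measurable borel" "u2 \<in> borel_measurable borel" "g11 \<in> borel_measurable borel"
  "g12 \<in> borel_measurable borel" "g21 \<in> borel_measurable borel" "g22 \<in> borel_measurable borel"
  using int by auto

definition u :: "real ^ 2 \<Rightarrow> real ^ 2" where "u x = vec2 (u1 x) (u2 x)"

end

section \<open>The null Lagrangian identity and the chain rule\<close>

lemma grad_mconv_near:
  assumes "r < 1"
  shows "\<forall>\<^sub>F n in sequentially. \<forall>x :: real ^ 2. norm x \<le> r \<longrightarrow> norm x + 2 / real (Suc n) < 1"
proof -
  have "(\<lambda>n. 2 * (1 / real (Suc n))) \<longlonglongrightarrow> 2 * 0"
    using LIMSEQ_inverse_real_of_nat unfolding inverse_eq_divide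
    by (intro tendsto_mult tendsto_const)
  then have "\<forall>\<^sub>F n in sequentially. 2 * (1 / real (Suc n)) < 1 - r"
    using assms by (intro order_tendstoD(2)) auto
  then show ?thesis by eventually_elim auto
qed

context sobolev begin

text \<open>The determinant is the divergence of (u1 \<partial>2 u2, - u1 \<partial>1 u2). This uses
  a second derivative of \<open>u2\<close>, so it is proved for mollified fields, where the mixed
  derivatives cancel; both sides involve only products of two square-integrable functions and pass
  to the limit.\<close>

lemma det_identity:
  assumes sm: "smooth a" "smooth b" and r: "r < 1" and z: "\<And>x. norm x > r \<Longrightarrow> tens a b x = 0"
  shows "(\<integral>x. tens a b x * (g11 x * g22 x) - tens a b x * (g12 x * g21 x) \<partial>lborel) =
    (\<integral>x. tens a (deriv b) x * (u1 x * g21 x) - tens (deriv a) b x * (u1 x * g22 x) \<partial>lborel)"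
proof -
  let ?\<phi> = "tens a b" and ?\<phi>1 = "tens (deriv a) b" and ?\<phi>2 = "tens a (deriv b)"
  note g\<phi> = tens_has_grad[OF sm]
  note sd = smooth_deriv(2)[OF sm(1)] smooth_deriv(2)[OF sm(2)]
  have z': "?\<phi>1 x = 0" "?\<phi>2 x = 0" if "norm x > r" for x
    using has_grad_zero[OF g\<phi> z that] by auto
  have c: "continuous_on UNIV ?\<phi>" "continuous_on UNIV ?\<phi>1" "continuous_on UNIV ?\<phi>2"
    using sm sd by (auto intro!: tens_continuous)
  from bounded_compact_support[OF c(1) z] bounded_compact_support[OF c(2) z'(1)]
    bounded_compact_support[OF c(3) z'(2)] obtain B0 B1 B2 where
    B: "\<And>x. \<bar>?\<phi> x\<bar> \<le> B0" "\<And>x. \<bar>?\<phi>1 x\<bar> \<le> B1" "\<And>x. \<bar>?\<phi>2 x\<bar> \<le> B2" by blast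
  have m: "?\<phi> \<in> borel_measurable borel" "?\<phi>1 \<in> borel_measurable borel" "?\<phi>2 \<in> borel_measurable borel"
    using c by (auto intro: borel_measurable_continuous_onI)
  have mm: "mconv n f \<in> borel_measurable borel" if "integrable lborel f" for n f
    using that by (rule borel_measurable_mconv)
  have lim: "(\<lambda>n. LpN 2 (\<lambda>x. mconv n f x - f x)) \<longlonglongrightarrow> 0" if "integrable lborel f" "LpN 2 f < \<infinity>" for f
    using that by (intro mconv_tendsto) auto
  define I where "I n = (\<integral>x. ?\<phi> x * (mconv n g11 x * mconv n g22 x) \<partial>lborel)
      - (\<integral>x. ?\<phi> x * (mconv n g12 x * mconv n g21 x) \<partial>lborel)
      - ((\<integral>x. ?\<phi>2 x * (mconv n u1 x * mconv n g21 x) \<partial>lborel)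
       - (\<integral>x. ?\<phi>1 x * (mconv n u1 x * mconv n g22 x) \<partial>lborel))" for n
  have "I \<longlonglongrightarrow> (\<integral>x. ?\<phi> x * (g11 x * g22 x) \<partial>lborel) - (\<integral>x. ?\<phi> x * (g12 x * g21 x) \<partial>lborel)
      - ((\<integral>x. ?\<phi>2 x * (u1 x * g21 x) \<partial>lborel) - (\<integral>x. ?\<phi>1 x * (u1 x * g22 x) \<partial>lborel))"
    unfolding I_def using B
    by (intro tendsto_diff tendsto_L2_prod[where B = B0] tendsto_L2_prod[where B = B1]
         tendsto_L2_prod[where B = B2] m mm lim int L2 meas) auto
  moreover have "\<forall>\<^sub>F n in sequentially. I n = 0"
    using grad_mconv_near[OF r]
  proof eventually_elim
    case (elim n)
    let ?v1 = "mconv n u1" and ?v2 = "mconv n u2" and ?m = "moll n"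
    have k: "kern ?m" "kern (deriv ?m)" "kern (deriv (deriv ?m))"
      using moll(1) kern_deriv by auto
    note gv = conv_has_grad[OF int(1) k(1,1)] conv_has_grad[OF int(2) k(1,1)]
    note gd = conv_has_grad[OF int(2) k(2,1)] conv_has_grad[OF int(2) k(1,2)]
    \<comment> \<open>With v the mollified field, \<open>h1\<close> and \<open>h2\<close> are the
      gradients of \<phi> v1 \<partial>2 v2 and \<phi> v1 \<partial>1 v2. The first is integrated in
      direction 1, the second in direction 2, and both contain \<phi> v1 times the same mixed
      derivative of v2.\<close>
    note h1 = has_grad_mult[OF g\<phi> has_grad_mult[OF gv(1) gd(2)]]
    note h2 = has_grad_mult[OF g\<phi> has_grad_mult[OF gv(1) gd(1)]]
    have cc: "continuous_on UNIV (conv f a' b')" if "integrable lborel f" "kern a'" "kern b'" for f a' b'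
      using that by (rule conv_continuous)
    have Z1: "(\<integral>x. ?\<phi>1 x * (?v1 x * conv u2 ?m (deriv ?m) x) + ?\<phi> x *
        (conv u1 (deriv ?m) ?m x * conv u2 ?m (deriv ?m) x + ?v1 x * conv u2 (deriv ?m) (deriv ?m) x) \<partial>lborel) = 0"
      "integrable lborel (\<lambda>x. ?\<phi>1 x * (?v1 x * conv u2 ?m (deriv ?m) x) + ?\<phi> x *
        (conv u1 (deriv ?m) ?m x * conv u2 ?m (deriv ?m) x + ?v1 x * conv u2 (deriv ?m) (deriv ?m) x))"
      by (rule integral_grad_zero(1)[OF h1, of r], simp add: z, (intro continuous_intros c cc int k)+)
        (rule integral_grad_zero(3)[OF h1, of r], simp add: z, (intro continuous_intros c cc int k)+)
    have Z2: "(\<integral>x. ?\<phi>2 x * (?v1 x * conv u2 (deriv ?m) ?m x) + ?\<phi> x *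
        (conv u1 ?m (deriv ?m) x * conv u2 (deriv ?m) ?m x + ?v1 x * conv u2 (deriv ?m) (deriv ?m) x) \<partial>lborel) = 0"
      "integrable lborel (\<lambda>x. ?\<phi>2 x * (?v1 x * conv u2 (deriv ?m) ?m x) + ?\<phi> x *
        (conv u1 ?m (deriv ?m) x * conv u2 (deriv ?m) ?m x + ?v1 x * conv u2 (deriv ?m) (deriv ?m) x))"
      by (rule integral_grad_zero(2)[OF h2, of r], simp add: z, (intro continuous_intros c cc int k)+)
        (rule integral_grad_zero(4)[OF h2, of r], simp add: z, (intro continuous_intros c cc int k)+)
    have ci: "integrable lborel (\<lambda>x. f x * (mconv n h x * mconv n h' x))"
      if "continuous_on UNIV f" "\<And>x. norm x > r \<Longrightarrow> f x = 0" "integrable lborel h" "integrable lborel h'" for f h h'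
      using that by (intro integrable_compact_support[where R = r]) (auto intro!: continuous_intros cc k)
    have "I n = (\<integral>x. ?\<phi> x * (mconv n g11 x * mconv n g22 x) - ?\<phi> x * (mconv n g12 x * mconv n g21 x)
       - (?\<phi>2 x * (mconv n u1 x * mconv n g21 x) - ?\<phi>1 x * (mconv n u1 x * mconv n g22 x)) \<partial>lborel)"
      unfolding I_def using ci[OF c(1) z] ci[OF c(2) z'(1)] ci[OF c(3) z'(2)] int by simp
    also have "\<dots> = (\<integral>x. (?\<phi>1 x * (?v1 x * conv u2 ?m (deriv ?m) x) + ?\<phi> x *
        (conv u1 (deriv ?m) ?m x * conv u2 ?m (deriv ?m) x + ?v1 x * conv u2 (deriv ?m) (deriv ?m) x)) -
       (?\<phi>2 x * (?v1 x * conv u2 (deriv ?m) ?m x) + ?\<phi> x *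
        (conv u1 ?m (deriv ?m) x * conv u2 (deriv ?m) ?m x + ?v1 x * conv u2 (deriv ?m) (deriv ?m) x)) \<partial>lborel)"
    proof (intro Bochner_Integration.integral_cong refl)
      fix x
      show "?\<phi> x * (mconv n g11 x * mconv n g22 x) - ?\<phi> x * (mconv n g12 x * mconv n g21 x)
       - (?\<phi>2 x * (mconv n u1 x * mconv n g21 x) - ?\<phi>1 x * (mconv n u1 x * mconv n g22 x)) =
       (?\<phi>1 x * (?v1 x * conv u2 ?m (deriv ?m) x) + ?\<phi> x *
        (conv u1 (deriv ?m) ?m x * conv u2 ?m (deriv ?m) x + ?v1 x * conv u2 (deriv ?m) (deriv ?m) x)) -
       (?\<phi>2 x * (?v1 x * conv u2 (deriv ?m) ?m x) + ?\<phi> x *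
        (conv u1 ?m (deriv ?m) x * conv u2 (deriv ?m) ?m x + ?v1 x * conv u2 (deriv ?m) (deriv ?m) x))"
      proof (cases "norm x > r")
        case True
        then show ?thesis using z z' by simp
      next
        case False
        then have x: "norm x + 2 / real (Suc n) < 1" using elim by auto
        show ?thesis
          unfolding mconv_weak_grad[OF wg(1) x] mconv_weak_grad[OF wg(2) x]
          by (simp add: algebra_simps)
      qed
    qed
    also have "\<dots> = 0" using Z1 Z2 by simp
    finally show ?case .
  qed
  ultimately have "(\<integral>x. ?\<phi> x * (g11 x * g22 x) \<partial>lborel) - (\<integral>x. ?\<phi> x * (g12 x * g21 x) \<partial>lborel)
      - ((\<integral>x. ?\<phi>2 x * (u1 x * g21 x) \<partial>lborel) - (\<integral>x. ?\<phi>1 x * (u1 x * g22 x) \<partial>lborel)) = 0"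
    using LIMSEQ_unique tendsto_eventually by blast
  then show ?thesis
    using integrable_L2_prod[OF _ _ m(1) _ _ B(1)] integrable_L2_prod[OF _ _ m(2) _ _ B(2)]
      integrable_L2_prod[OF _ _ m(3) _ _ B(3)] L2 meas
    by simp
qed

text \<open>The coefficients \<open>p1\<close> and \<open>p2\<close> are only bounded and
  continuous, so their convergence along the mollified fields needs convergence almost everywhere,
  which L1 convergence provides for a subsequence.\<close>

lemma chain_limit:
  fixes h1 h2 \<phi> \<psi> p p1 p2 :: "real ^ 2 \<Rightarrow> real"
  assumes h: "integrable lborel h1" "integrable lborel h2"
    and c: "continuous_on UNIV \<phi>" "continuous_on UNIV \<psi>"
    and z: "\<And>x. norm x > r \<Longrightarrow> \<phi> x = 0" "\<And>x. norm x > r \<Longrightarrow> \<psi> x = 0"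
    and p: "has_grad p p1 p2" "continuous_on UNIV p1" "continuous_on UNIV p2"
    and C: "\<And>x. \<bar>p1 x\<bar> \<le> C" "\<And>x. \<bar>p2 x\<bar> \<le> C"
  defines "V n x \<equiv> vec2 (mconv n u1 x) (mconv n u2 x)"
  shows "\<exists>s. strict_mono s \<and> (\<lambda>n. \<integral>x. \<psi> x * p (V (s n) x) +
     \<phi> x * (p1 (V (s n) x) * mconv (s n) h1 x + p2 (V (s n) x) * mconv (s n) h2 x) \<partial>lborel)
     \<longlonglongrightarrow> (\<integral>x. \<psi> x * p (u x) \<partial>lborel) + (\<integral>x. \<phi> x * (p1 (u x) * h1 x + p2 (u x) * h2 x) \<partial>lborel)"
proof -
  from bounded_compact_support[OF c(1) z(1)] bounded_compact_support[OF c(2) z(2)] obtain B0 B1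
    where B: "\<And>x. \<bar>\<phi> x\<bar> \<le> B0" "\<And>x. \<bar>\<psi> x\<bar> \<le> B1" by blast
  have B0: "B0 \<ge> 0" "B1 \<ge> 0" "C \<ge> 0" using B(1)[of 0] B(2)[of 0] C(1)[of 0] by linarith+
  have contp: "continuous_on UNIV p" using has_grad_continuous[OF p(1)] .
  have [measurable]: "\<phi> \<in> borel_measurable borel" "\<psi> \<in> borel_measurable borel" "p \<in> borel_measurable borel"
    "p1 \<in> borel_measurable borel" "p2 \<in> borel_measurable borel" "h1 \<in> borel_measurable borel"
    "h2 \<in> borel_measurable borel"
    using c p contp h by (auto intro: borel_measurable_continuous_onI)
  have mm [measurable]: "mconv n u1 \<in> borel_measurable borel" "mconv n u2 \<in> borel_measurable borel"
     "mconv n h1 \<in> borel_measurable borel" "mconv n h2 \<in> borel_measurable borel" for n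
    using int h by (auto intro: borel_measurable_mconv)
  have [measurable]: "u \<in> borel_measurable borel" "V n \<in> borel_measurable borel" for n
    unfolding u_def[abs_def] V_def[abs_def] by measurable
  have mi: "integrable lborel (mconv n f)" if "integrable lborel f" for f n
  proof -
    have "LpN 1 (mconv n f) \<le> LpN 1 f" using that by (intro LpN_mconv) auto
    also have "\<dots> < \<infinity>" by (rule LpN_1_finite[OF that])
    finally show ?thesis using borel_measurable_mconv[OF that, of n]
      by (simp add: integrable_iff_bounded LpN_def)
  qed
  have L1: "(\<lambda>n. \<integral>x. \<bar>mconv n f x - f x\<bar> \<partial>lborel) \<longlonglongrightarrow> 0" if "integrable lborel f" for f
  proof -
    from mconv_tendsto[OF that _ LpN_1_finite[OF that]]
    have "(\<lambda>n. ennreal (\<integral>x. \<bar>mconv n f x - f x\<bar> \<partial>lborel)) \<longlonglongrightarrow> ennreal 0"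
      using LpN_1_integrable[of "\<lambda>x. mconv n f x - f x" for n] that mi by simp
    then show ?thesis by (subst (asm) tendsto_ennreal_iff) auto
  qed
  have "\<exists>s. strict_mono s \<and> (AE x in lborel. (\<lambda>n. mconv (s n) u1 x - u1 x) \<longlonglongrightarrow> 0)"
    by (rule tendsto_L1_AE_subseq) (use int mi L1 in auto)
  then obtain s1 where s1: "strict_mono s1" "AE x in lborel. (\<lambda>n. mconv (s1 n) u1 x - u1 x) \<longlonglongrightarrow> 0" by blast
  have "\<exists>s. strict_mono s \<and> (AE x in lborel. (\<lambda>n. mconv (s1 (s n)) u2 x - u2 x) \<longlonglongrightarrow> 0)"
    by (rule tendsto_L1_AE_subseq)
       (use int mi LIMSEQ_subseq_LIMSEQ[OF L1[OF int(2)] s1(1)] in \<open>auto simp: o_def\<close>)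
  then obtain s2 where s2: "strict_mono s2" "AE x in lborel. (\<lambda>n. mconv (s1 (s2 n)) u2 x - u2 x) \<longlonglongrightarrow> 0" by blast
  define s where "s = s1 \<circ> s2"
  have s: "strict_mono s" using s1(1) s2(1) by (simp add: s_def strict_mono_o)
  have "AE x in lborel. (\<lambda>n. V (s n) x) \<longlonglongrightarrow> u x"
    using s1(2) s2(2)
  proof eventually_elim
    case (elim x)
    have "(\<lambda>n. mconv (s n) u1 x - u1 x) \<longlonglongrightarrow> 0"
      using LIMSEQ_subseq_LIMSEQ[OF elim(1) s2(1)] by (simp add: s_def o_def)
    moreover have "(\<lambda>n. mconv (s n) u2 x - u2 x) \<longlonglongrightarrow> 0"
      using elim(2) by (simp add: s_def o_def)
    ultimately have "(\<lambda>n. mconv (s n) u1 x) \<longlonglongrightarrow> u1 x" "(\<lambda>n. mconv (s n) u2 x) \<longlonglongrightarrow> u2 x"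
      by (auto simp: LIM_zero_iff)
    moreover have eq: "vec2 a b = a *\<^sub>R axis 1 1 + b *\<^sub>R axis 2 1" for a b
      by (simp add: vec_eq_iff forall_2 axis_def)
    ultimately show ?case unfolding V_def u_def eq by (intro tendsto_intros)
  qed
  then have AEp: "AE x in lborel. (\<lambda>n. \<phi> x * (p1 (V (s n) x) * h1 x + p2 (V (s n) x) * h2 x))
      \<longlonglongrightarrow> \<phi> x * (p1 (u x) * h1 x + p2 (u x) * h2 x)"
  proof eventually_elim
    case (elim x)
    have "isCont p1 (u x)" "isCont p2 (u x)"
      using p by (auto simp: continuous_on_eq_continuous_at)
    then show ?case by (intro tendsto_intros isCont_tendsto_compose[OF _ elim])
  qed
  \<comment> \<open>Intermediate integral with mollified arguments in the coefficients but
    unmollified \<open>h1\<close>, \<open>h2\<close>: only the bounded coefficients vary, and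
    dominated convergence applies.\<close>
  define J where "J n = (\<integral>x. \<phi> x * (p1 (V n x) * h1 x + p2 (V n x) * h2 x) \<partial>lborel)" for n
  define w where "w x = B0 * (C * \<bar>h1 x\<bar> + C * \<bar>h2 x\<bar>)" for x
  have wi: "integrable lborel w" unfolding w_def using h by auto
  have wb: "\<bar>\<phi> x * (p1 y * k1 + p2 y * k2)\<bar> \<le> B0 * (C * \<bar>k1\<bar> + C * \<bar>k2\<bar>)" for x y k1 k2
  proof -
    have "\<bar>p1 y * k1 + p2 y * k2\<bar> \<le> \<bar>p1 y\<bar> * \<bar>k1\<bar> + \<bar>p2 y\<bar> * \<bar>k2\<bar>"
      by (simp flip: abs_mult)
    also have "\<dots> \<le> C * \<bar>k1\<bar> + C * \<bar>k2\<bar>" using C by (intro add_mono mult_right_mono) auto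
    finally show ?thesis unfolding abs_mult[of "\<phi> x"] using B B0 by (intro mult_mono) auto
  qed
  have lJ: "(\<lambda>n. J (s n)) \<longlonglongrightarrow> (\<integral>x. \<phi> x * (p1 (u x) * h1 x + p2 (u x) * h2 x) \<partial>lborel)"
    unfolding J_def
    by (rule integral_dominated_convergence[OF _ _ wi AEp])
       (use wb in \<open>auto simp: w_def intro!: AE_I2\<close>)
  have iJ: "integrable lborel (\<lambda>x. \<phi> x * (p1 (V n x) * f1 x + p2 (V n x) * f2 x))"
    if "integrable lborel f1" "integrable lborel f2" for n f1 f2
  proof (rule Bochner_Integration.integrable_bound)
    show "integrable lborel (\<lambda>x. B0 * (C * \<bar>f1 x\<bar> + C * \<bar>f2 x\<bar>))" using that by auto
    have [measurable]: "f1 \<in> borel_measurable borel" "f2 \<in> borel_measurable borel" using that by auto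
    show "(\<lambda>x. \<phi> x * (p1 (V n x) * f1 x + p2 (V n x) * f2 x)) \<in> borel_measurable lborel" by measurable
    show "AE x in lborel. norm (\<phi> x * (p1 (V n x) * f1 x + p2 (V n x) * f2 x)) \<le>
       norm (B0 * (C * \<bar>f1 x\<bar> + C * \<bar>f2 x\<bar>))"
      unfolding real_norm_def by (rule AE_I2, rule order_trans[OF wb abs_ge_self])
  qed
  have iP1: "integrable lborel (\<lambda>x. \<psi> x * p (V n x))" "integrable lborel (\<lambda>x. \<psi> x * p (u x))" for n
    using int mi by (auto intro!: integrable_test_lipschitz[OF p(1) C c(2) z(2)] simp: V_def u_def)
  define K where "K n = (\<integral>x. \<psi> x * p (V n x) + \<phi> x * (p1 (V n x) * mconv n h1 x + p2 (V n x) * mconv n h2 x) \<partial>lborel)" for n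
  \<comment> \<open>The remaining replacements cost only L1 distances: for the zeroth-order term by
    the Lipschitz bound 2 C of \<open>p\<close>, for the derivatives by boundedness of the
    coefficients.\<close>
  define D where "D n = B1 * (2 * C * ((\<integral>x. \<bar>mconv n u1 x - u1 x\<bar> \<partial>lborel) + (\<integral>x. \<bar>mconv n u2 x - u2 x\<bar> \<partial>lborel)))
      + B0 * (C * (\<integral>x. \<bar>mconv n h1 x - h1 x\<bar> \<partial>lborel) + C * (\<integral>x. \<bar>mconv n h2 x - h2 x\<bar> \<partial>lborel))" for n
  have "D \<longlonglongrightarrow> B1 * (2 * C * (0 + 0)) + B0 * (C * 0 + C * 0)"
    unfolding D_def by (intro tendsto_intros L1 int h)
  then have D0: "D \<longlonglongrightarrow> 0" by simp
  have KD: "\<bar>K n - ((\<integral>x. \<psi> x * p (u x) \<partial>lborel) + J n)\<bar> \<le> D n" for n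
  proof -
    have ii: "integrable lborel (\<lambda>x. \<bar>mconv n u1 x - u1 x\<bar>)" "integrable lborel (\<lambda>x. \<bar>mconv n u2 x - u2 x\<bar>)"
      "integrable lborel (\<lambda>x. \<bar>mconv n h1 x - h1 x\<bar>)" "integrable lborel (\<lambda>x. \<bar>mconv n h2 x - h2 x\<bar>)"
      using mi int h by auto
    note i1 = iP1(1)[of n] iP1(2) iJ[OF mi[OF h(1), of n] mi[OF h(2), of n], of n] iJ[OF h, of n]
    let ?f = "\<lambda>x. \<psi> x * p (V n x) + \<phi> x * (p1 (V n x) * mconv n h1 x + p2 (V n x) * mconv n h2 x)"
    let ?g = "\<lambda>x. \<psi> x * p (u x) + \<phi> x * (p1 (V n x) * h1 x + p2 (V n x) * h2 x)"
    have if': "integrable lborel ?f" "integrable lborel ?g" using i1 by (auto intro!: Bochner_Integration.integrable_add)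
    have "K n - ((\<integral>x. \<psi> x * p (u x) \<partial>lborel) + J n) = (\<integral>x. ?f x \<partial>lborel) - (\<integral>x. ?g x \<partial>lborel)"
      unfolding K_def J_def using i1 by (subst (3) Bochner_Integration.integral_add) auto
    also have "\<dots> = (\<integral>x. ?f x - ?g x \<partial>lborel)" using if' by (rule Bochner_Integration.integral_diff[symmetric])
    finally have "\<bar>K n - ((\<integral>x. \<psi> x * p (u x) \<partial>lborel) + J n)\<bar> = \<bar>\<integral>x. ?f x - ?g x \<partial>lborel\<bar>" by (simp only:)
    also have "\<dots> \<le> (\<integral>x. \<bar>?f x - ?g x\<bar> \<partial>lborel)" by (rule integral_abs_bound)
    also have "\<dots> \<le> (\<integral>x. B1 * (2 * C * (\<bar>mconv n u1 x - u1 x\<bar> + \<bar>mconv n u2 x - u2 x\<bar>))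
      + B0 * (C * \<bar>mconv n h1 x - h1 x\<bar> + C * \<bar>mconv n h2 x - h2 x\<bar>) \<partial>lborel)"
    proof (rule integral_mono)
      show "integrable lborel (\<lambda>x. \<bar>?f x - ?g x\<bar>)"
        using if' by (intro integrable_abs Bochner_Integration.integrable_diff)
      show "integrable lborel (\<lambda>x. B1 * (2 * C * (\<bar>mconv n u1 x - u1 x\<bar> + \<bar>mconv n u2 x - u2 x\<bar>))
      + B0 * (C * \<bar>mconv n h1 x - h1 x\<bar> + C * \<bar>mconv n h2 x - h2 x\<bar>))"
        using ii by (intro Bochner_Integration.integrable_add integrable_mult_right)
      fix x
      have "\<bar>p (V n x) - p (u x)\<bar> \<le> 2 * C * norm (V n x - u x)"
        using has_grad_lipschitz[OF p(1) C] .
      also have "\<dots> \<le> 2 * C * (\<bar>mconv n u1 x - u1 x\<bar> + \<bar>mconv n u2 x - u2 x\<bar>)"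
        using norm_le_abs_sum[of "V n x - u x"] B0 by (intro mult_left_mono) (auto simp: V_def u_def)
      finally have 1: "\<bar>\<psi> x * (p (V n x) - p (u x))\<bar> \<le> B1 * (2 * C * (\<bar>mconv n u1 x - u1 x\<bar> + \<bar>mconv n u2 x - u2 x\<bar>))"
        unfolding abs_mult using B B0 by (intro mult_mono) auto
      have "?f x - ?g x = \<psi> x * (p (V n x) - p (u x)) +
          \<phi> x * (p1 (V n x) * (mconv n h1 x - h1 x) + p2 (V n x) * (mconv n h2 x - h2 x))"
        by (simp add: algebra_simps)
      then have "\<bar>?f x - ?g x\<bar> \<le> \<bar>\<psi> x * (p (V n x) - p (u x))\<bar> +
          \<bar>\<phi> x * (p1 (V n x) * (mconv n h1 x - h1 x) + p2 (V n x) * (mconv n h2 x - h2 x))\<bar>"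
        by (simp only: abs_triangle_ineq)
      also have "\<dots> \<le> B1 * (2 * C * (\<bar>mconv n u1 x - u1 x\<bar> + \<bar>mconv n u2 x - u2 x\<bar>))
      + B0 * (C * \<bar>mconv n h1 x - h1 x\<bar> + C * \<bar>mconv n h2 x - h2 x\<bar>)"
        by (intro add_mono 1 wb)
      finally show "\<bar>?f x - ?g x\<bar> \<le> B1 * (2 * C * (\<bar>mconv n u1 x - u1 x\<bar> + \<bar>mconv n u2 x - u2 x\<bar>))
      + B0 * (C * \<bar>mconv n h1 x - h1 x\<bar> + C * \<bar>mconv n h2 x - h2 x\<bar>)" .
    qed
    also have "\<dots> = D n"
      unfolding D_def using ii by simp
    finally show ?thesis .
  qed
  have "(\<lambda>n. K (s n) - ((\<integral>x. \<psi> x * p (u x) \<partial>lborel) + J (s n))) \<longlonglongrightarrow> 0"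
    by (rule Lim_null_comparison[OF _ LIMSEQ_subseq_LIMSEQ[OF D0 s]]) (use KD in auto)
  from tendsto_add[OF this tendsto_add[OF tendsto_const[of "\<integral>x. \<psi> x * p (u x) \<partial>lborel"] lJ]]
  have "(\<lambda>n. K (s n)) \<longlonglongrightarrow> (\<integral>x. \<psi> x * p (u x) \<partial>lborel) + (\<integral>x. \<phi> x * (p1 (u x) * h1 x + p2 (u x) * h2 x) \<partial>lborel)"
    by simp
  with s show ?thesis unfolding K_def by blast
qed

text \<open>For a mollified field the integrand of \<open>chain_limit\<close> is, for large indices,
  a partial derivative of the cutoff times \<open>p\<close> of the field, so its integral vanishes;
  the limit along the subsequence is the claim.\<close>

lemma chain_rule:
  assumes sm: "smooth a" "smooth b" and r: "r < 1" and z: "\<And>x. norm x > r \<Longrightarrow> tens a b x = 0"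
    and p: "has_grad p p1 p2" "continuous_on UNIV p1" "continuous_on UNIV p2"
    and C: "\<And>x. \<bar>p1 x\<bar> \<le> C" "\<And>x. \<bar>p2 x\<bar> \<le> C"
  shows "(\<integral>x. tens (deriv a) b x * p (u x) \<partial>lborel) =
       - (\<integral>x. tens a b x * (p1 (u x) * g11 x + p2 (u x) * g21 x) \<partial>lborel)"
    and "(\<integral>x. tens a (deriv b) x * p (u x) \<partial>lborel) =
       - (\<integral>x. tens a b x * (p1 (u x) * g12 x + p2 (u x) * g22 x) \<partial>lborel)"
proof -
  let ?\<phi> = "tens a b" and ?\<phi>1 = "tens (deriv a) b" and ?\<phi>2 = "tens a (deriv b)"
  note g\<phi> = tens_has_grad[OF sm]
  note sd = smooth_deriv(2)[OF sm(1)] smooth_deriv(2)[OF sm(2)]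
  have z': "?\<phi>1 x = 0" "?\<phi>2 x = 0" if "norm x > r" for x
    using has_grad_zero[OF g\<phi> z that] by auto
  have c: "continuous_on UNIV ?\<phi>" "continuous_on UNIV ?\<phi>1" "continuous_on UNIV ?\<phi>2"
    using sm sd by (auto intro!: tens_continuous)
  define V where "V n x = vec2 (mconv n u1 x) (mconv n u2 x)" for n x
  have ev: "\<forall>\<^sub>F n in sequentially.
      (\<integral>x. ?\<phi>1 x * p (V n x) + ?\<phi> x * (p1 (V n x) * mconv n g11 x + p2 (V n x) * mconv n g21 x) \<partial>lborel) = 0 \<and>
      (\<integral>x. ?\<phi>2 x * p (V n x) + ?\<phi> x * (p1 (V n x) * mconv n g12 x + p2 (V n x) * mconv n g22 x) \<partial>lborel) = 0"
    using grad_mconv_near[OF r]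
  proof eventually_elim
    case (elim n)
    let ?m = "moll n"
    have k: "kern ?m" "kern (deriv ?m)" using moll(1) kern_deriv by auto
    note gv = conv_has_grad[OF int(1) k(1,1)] conv_has_grad[OF int(2) k(1,1)]
    note h = has_grad_mult[OF g\<phi> has_grad_compose[OF p(1) gv]]
    have cc: "continuous_on UNIV (conv f a' b')" if "integrable lborel f" "kern a'" "kern b'" for f a' b'
      using that by (rule conv_continuous)
    have cp: "continuous_on UNIV (\<lambda>x. p (vec2 (mconv n u1 x) (mconv n u2 x)))"
      "continuous_on UNIV (\<lambda>x. p1 (vec2 (mconv n u1 x) (mconv n u2 x)))"
      "continuous_on UNIV (\<lambda>x. p2 (vec2 (mconv n u1 x) (mconv n u2 x)))"
      by (auto intro!: continuous_on_compose2[OF has_grad_continuous[OF p(1)]] continuous_on_compose2[OF p(2)]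
           continuous_on_compose2[OF p(3)] continuous_intros cc int k)
    have e: "?\<phi> x * (p1 (V n x) * mconv n g11 x + p2 (V n x) * mconv n g21 x) =
        ?\<phi> x * (p1 (V n x) * conv u1 (deriv ?m) ?m x + p2 (V n x) * conv u2 (deriv ?m) ?m x)"
      "?\<phi> x * (p1 (V n x) * mconv n g12 x + p2 (V n x) * mconv n g22 x) =
        ?\<phi> x * (p1 (V n x) * conv u1 ?m (deriv ?m) x + p2 (V n x) * conv u2 ?m (deriv ?m) x)" for x
    proof -
      have x: "norm x + 2 / real (Suc n) < 1" if "?\<phi> x \<noteq> 0" using elim z[of x] that by force
      show "?\<phi> x * (p1 (V n x) * mconv n g11 x + p2 (V n x) * mconv n g21 x) =
        ?\<phi> x * (p1 (V n x) * conv u1 (deriv ?m) ?m x + p2 (V n x) * conv u2 (deriv ?m) ?m x)"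
        "?\<phi> x * (p1 (V n x) * mconv n g12 x + p2 (V n x) * mconv n g22 x) =
        ?\<phi> x * (p1 (V n x) * conv u1 ?m (deriv ?m) x + p2 (V n x) * conv u2 ?m (deriv ?m) x)"
        using mconv_weak_grad[OF wg(1) x] mconv_weak_grad[OF wg(2) x] by (cases "?\<phi> x = 0"; simp)+
    qed
    show ?case
      unfolding e unfolding V_def
      by (rule conjI)
         (rule integral_grad_zero(1)[OF h, of r] integral_grad_zero(2)[OF h, of r],
          simp add: z, (intro continuous_intros c cc cp int k)+)+
  qed
  obtain s where s: "strict_mono s" "(\<lambda>n. \<integral>x. ?\<phi>1 x * p (V (s n) x) +
     ?\<phi> x * (p1 (V (s n) x) * mconv (s n) g11 x + p2 (V (s n) x) * mconv (s n) g21 x) \<partial>lborel)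
     \<longlonglongrightarrow> (\<integral>x. ?\<phi>1 x * p (u x) \<partial>lborel) + (\<integral>x. ?\<phi> x * (p1 (u x) * g11 x + p2 (u x) * g21 x) \<partial>lborel)"
    using chain_limit[OF int(3,5) c(1,2) z z'(1) p C] unfolding V_def by blast
  have "(\<integral>x. ?\<phi>1 x * p (u x) \<partial>lborel) + (\<integral>x. ?\<phi> x * (p1 (u x) * g11 x + p2 (u x) * g21 x) \<partial>lborel) = 0"
    by (rule LIMSEQ_unique[OF s(2) tendsto_eventually])
       (use eventually_subseq[OF s(1) ev] in \<open>auto elim: eventually_mono\<close>)
  then show "(\<integral>x. ?\<phi>1 x * p (u x) \<partial>lborel) = - (\<integral>x. ?\<phi> x * (p1 (u x) * g11 x + p2 (u x) * g21 x) \<partial>lborel)"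
    by linarith
  obtain s where s: "strict_mono s" "(\<lambda>n. \<integral>x. ?\<phi>2 x * p (V (s n) x) +
     ?\<phi> x * (p1 (V (s n) x) * mconv (s n) g12 x + p2 (V (s n) x) * mconv (s n) g22 x) \<partial>lborel)
     \<longlonglongrightarrow> (\<integral>x. ?\<phi>2 x * p (u x) \<partial>lborel) + (\<integral>x. ?\<phi> x * (p1 (u x) * g12 x + p2 (u x) * g22 x) \<partial>lborel)"
    using chain_limit[OF int(4,6) c(1,3) z z'(2) p C] unfolding V_def by blast
  have "(\<integral>x. ?\<phi>2 x * p (u x) \<partial>lborel) + (\<integral>x. ?\<phi> x * (p1 (u x) * g12 x + p2 (u x) * g22 x) \<partial>lborel) = 0"
    by (rule LIMSEQ_unique[OF s(2) tendsto_eventually])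
       (use eventually_subseq[OF s(1) ev] in \<open>auto elim: eventually_mono\<close>)
  then show "(\<integral>x. ?\<phi>2 x * p (u x) \<partial>lborel) = - (\<integral>x. ?\<phi> x * (p1 (u x) * g12 x + p2 (u x) * g22 x) \<partial>lborel)"
    by linarith
qed

end

subsection \<open>Borel representatives\<close>

abbreviation disc :: "(real ^ 2) set" where "disc \<equiv> ball 0 1"

lemma borel_measurable_vec_nth:
  fixes f :: "'a \<Rightarrow> ('b::euclidean_space) ^ 'n"
  shows "f \<in> borel_measurable M \<Longrightarrow> (\<lambda>x. f x $ i) \<in> borel_measurable M"
  by (rule borel_measurable_continuous_on) (auto intro: continuous_on_component continuous_intros)

text \<open>The definitions speak of the completed measure on the disc, whereas Fubini's theorem and
  mollification are used for Borel functions on the plane. Modification on a null set and extension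
  by zero connect the two.\<close>

lemma borel_representative:
  fixes f :: "real ^ 2 \<Rightarrow> real"
  assumes f: "f \<in> borel_measurable (lebesgue_on disc)"
  obtains g where "g \<in> borel_measurable borel" "\<And>x. x \<notin> disc \<Longrightarrow> g x = 0"
    "AE x in lebesgue_on disc. f x = g x"
proof -
  have "(\<lambda>x. indicator disc x *\<^sub>R f x) \<in> borel_measurable lebesgue"
    using f by (subst (asm) borel_measurable_restrict_space_iff) auto
  then obtain g where g: "g \<in> borel_measurable lborel" "AE x in lborel. indicator disc x *\<^sub>R f x = g x"
    using completion_ex_borel_measurable_real by blast
  have "AE x in lebesgue. x \<in> disc \<longrightarrow> f x = indicator disc x * g x"
    using AE_completion[OF g(2)] by eventually_elim auto
  then have "AE x in lebesgue_on disc. f x = indicator disc x * g x"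
    by (subst AE_restrict_space_iff) auto
  moreover have "(\<lambda>x. indicator disc x * g x) \<in> borel_measurable borel"
    using g(1) by (intro borel_measurable_times borel_measurable_indicator) auto
  ultimately show ?thesis using that[of "\<lambda>x. indicator disc x * g x"] by auto
qed

lemma nn_integral_disc:
  assumes "g \<in> borel_measurable borel"
  shows "(\<integral>\<^sup>+x. g x \<partial>lebesgue_on disc) = (\<integral>\<^sup>+x. g x * indicator disc x \<partial>lborel)"
  using assms by (subst nn_integral_restrict_space) (auto simp: nn_integral_completion)

lemma integral_disc:
  fixes g :: "real ^ 2 \<Rightarrow> real"
  assumes "g \<in> borel_measurable borel" "\<And>x. x \<notin> disc \<Longrightarrow> g x = 0"
  shows "(\<integral>x. g x \<partial>lebesgue_on disc) = (\<integral>x. g x \<partial>lborel)"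
proof -
  have "(\<integral>x. g x \<partial>lebesgue_on disc) = (\<integral>x. indicator disc x *\<^sub>R g x \<partial>lebesgue)"
    by (subst integral_restrict_space) auto
  also have "(\<lambda>x. indicator disc x *\<^sub>R g x) = g"
    using assms(2) by (auto simp: indicator_def fun_eq_iff)
  finally show ?thesis using assms(1) by (simp add: integral_completion)
qed

text \<open>Local integrability speaks only of compact subsets. Exhausting the disc by closed balls
  of radius 1 - 1 / (n + 1) makes the function a pointwise limit of measurable ones.\<close>

lemma borel_measurable_locally_integrable:
  fixes G :: "real ^ 2 \<Rightarrow> 'a::euclidean_space"
  assumes "G locally_integrable_on disc"
  shows "G \<in> borel_measurable (lebesgue_on disc)"
proof -
  define K where "K n = cball (0 :: real ^ 2) (1 - 1 / real (Suc n))" for n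
  have "K n \<subseteq> disc" for n
  proof
    fix x assume "x \<in> K n"
    moreover have "1 / real (Suc n) > 0" by simp
    ultimately show "x \<in> disc" unfolding K_def mem_cball mem_ball dist_0_norm by linarith
  qed
  then have "G absolutely_integrable_on K n" for n
    using assms by (auto simp: locally_integrable_on_def K_def)
  then have m: "(\<lambda>x. indicator (K n) x *\<^sub>R G x) \<in> borel_measurable lebesgue" for n
    by (auto simp: set_integrable_def)
  have "(\<lambda>x. indicator disc x *\<^sub>R G x) \<in> borel_measurable lebesgue"
  proof (rule borel_measurable_LIMSEQ_metric[OF m])
    fix x :: "real ^ 2"
    show "(\<lambda>n. indicator (K n) x *\<^sub>R G x) \<longlonglongrightarrow> indicator disc x *\<^sub>R G x"
    proof (cases "x \<in> disc")
      case True
      have "(\<lambda>n. 1 / real (Suc n)) \<longlonglongrightarrow> 0"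
        using LIMSEQ_inverse_real_of_nat unfolding inverse_eq_divide .
      then have "\<forall>\<^sub>F n in sequentially. 1 / real (Suc n) < 1 - norm x"
        using True by (intro order_tendstoD(2)) auto
      then have "\<forall>\<^sub>F n in sequentially. indicator (K n) x *\<^sub>R G x = indicator disc x *\<^sub>R G x"
        by eventually_elim (use True in \<open>auto simp: K_def indicator_def\<close>)
      then show ?thesis by (rule tendsto_eventually)
    next
      case False
      then have "indicator (K n) x *\<^sub>R G x = indicator disc x *\<^sub>R G x" for n
        using \<open>K n \<subseteq> disc\<close> by (auto simp: indicator_def)
      then show ?thesis by (simp only: tendsto_const)
    qed
  qed
  then show ?thesis by (subst borel_measurable_restrict_space_iff) auto
qed

lemma integrable_disc_L2:
  assumes [measurable]: "g \<in> borel_measurable borel" and z: "\<And>x. x \<notin> disc \<Longrightarrow> g x = 0" and "LpN 2 g < \<infinity>"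
  shows "integrable lborel g"
proof (rule Bochner_Integration.integrable_bound)
  have "integrable lborel (\<lambda>x :: real ^ 2. indicator disc x :: real)"
    using emeasure_lborel_ball_finite[of "0 :: real ^ 2" 1] by simp
  then show "integrable lborel (\<lambda>x. indicator disc x + (g x)\<^sup>2)"
    using LpN_2_integrable(1)[OF assms(1,3)] by simp
  show "AE x in lborel. norm (g x) \<le> norm (indicator disc x + (g x)\<^sup>2)"
  proof (rule AE_I2)
    fix x
    have "0 \<le> (\<bar>g x\<bar> - 1)\<^sup>2" by simp
    then have "2 * \<bar>g x\<bar> \<le> 1 + (g x)\<^sup>2" by (simp add: power2_diff)
    then have "\<bar>g x\<bar> \<le> 1 + (g x)\<^sup>2" by (smt (verit) abs_ge_zero)
    then show "norm (g x) \<le> norm (indicator disc x + (g x)\<^sup>2)"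
      using z[of x] by (cases "x \<in> disc") auto
  qed
qed measurable

lemma LpN_2_disc:
  fixes g :: "real ^ 2 \<Rightarrow> real" and f :: "real ^ 2 \<Rightarrow> 'a::real_normed_vector"
  assumes [measurable]: "g \<in> borel_measurable borel" and z: "\<And>x. x \<notin> disc \<Longrightarrow> g x = 0"
    and ae: "AE x in lebesgue_on disc. \<bar>g x\<bar> \<le> norm (f x)"
    and fin: "(\<integral>\<^sup>+x. ennreal ((norm (f x))\<^sup>2) \<partial>lebesgue_on disc) < \<infinity>"
  shows "LpN 2 g < \<infinity>"
proof -
  have "LpN 2 g = (\<integral>\<^sup>+x. ennreal ((g x)\<^sup>2) * indicator disc x \<partial>lborel)"
    unfolding LpN_def using z by (intro nn_integral_cong) (auto simp: indicator_def)
  also have "\<dots> = (\<integral>\<^sup>+x. ennreal ((g x)\<^sup>2) \<partial>lebesgue_on disc)"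
    by (subst nn_integral_disc) auto
  also have "\<dots> \<le> (\<integral>\<^sup>+x. ennreal ((norm (f x))\<^sup>2) \<partial>lebesgue_on disc)"
    using ae by (intro nn_integral_mono_AE) (auto elim!: eventually_mono intro!: ennreal_leI simp: abs_le_square_iff[symmetric])
  finally show ?thesis using fin by auto
qed

lemma weak_grad_representative:
  fixes v :: "real ^ 2 \<Rightarrow> real ^ 2" and i :: 2
  assumes wd: "has_weak_deriv v G disc"
    and m: "f \<in> borel_measurable borel" "f1 \<in> borel_measurable borel" "f2 \<in> borel_measurable borel"
    and z: "\<And>x. x \<notin> disc \<Longrightarrow> f x = 0" "\<And>x. x \<notin> disc \<Longrightarrow> f1 x = 0" "\<And>x. x \<notin> disc \<Longrightarrow> f2 x = 0"
    and ae: "AE x in lebesgue_on disc. v x $ i = f x" "AE x in lebesgue_on disc. G x $ i $ 1 = f1 x"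
      "AE x in lebesgue_on disc. G x $ i $ 2 = f2 x"
  shows "weak_grad f f1 f2"
  unfolding weak_grad_def
proof (intro allI impI)
  fix a b assume t: "tens a b \<in> test_functions disc" and sm: "smooth a" "smooth b"
  note fd = has_grad_frechet(2,3)[OF tens_has_grad[OF sm]]
  have c: "tens a b \<in> borel_measurable borel" "tens (deriv a) b \<in> borel_measurable borel"
    "tens a (deriv b) \<in> borel_measurable borel"
    using sm smooth_deriv(2) by (auto intro!: borel_measurable_continuous_onI tens_continuous)
  have vG: "(\<lambda>x. v x $ i) \<in> borel_measurable (lebesgue_on disc)"
     "(\<lambda>x. G x $ i $ j) \<in> borel_measurable (lebesgue_on disc)" for j
    using wd unfolding has_weak_deriv_def
    by (intro borel_measurable_vec_nth borel_measurable_locally_integrable; blast)+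
  have key: "(\<integral>x. h x * k x \<partial>lebesgue_on disc) = (\<integral>x. g x * k x \<partial>lborel)"
    if "AE x in lebesgue_on disc. h x = g x" "h \<in> borel_measurable (lebesgue_on disc)" "g \<in> borel_measurable borel" "\<And>x. x \<notin> disc \<Longrightarrow> g x = 0"
      "k \<in> borel_measurable borel" for h g k :: "real ^ 2 \<Rightarrow> real"
  proof -
    have mg: "g \<in> borel_measurable (lebesgue_on disc)" "k \<in> borel_measurable (lebesgue_on disc)"
      using that by (auto intro!: measurable_restrict_space1 measurable_completion)
    have "(\<lambda>x. h x * k x) \<in> borel_measurable (lebesgue_on disc)" using mg that by simp
    then have "(\<integral>x. h x * k x \<partial>lebesgue_on disc) = (\<integral>x. g x * k x \<partial>lebesgue_on disc)"
      using that(1) mg by (intro integral_cong_AE) (auto elim!: eventually_mono)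
    also have "\<dots> = (\<integral>x. g x * k x \<partial>lborel)"
      using that by (intro integral_disc) auto
    finally show ?thesis .
  qed
  from wd t have "(\<integral>x. v x $ i * frechet_derivative (tens a b) (at x) (axis j 1) \<partial>lebesgue_on disc) =
        - (\<integral>x. G x $ i $ j * tens a b x \<partial>lebesgue_on disc)" for j
    unfolding has_weak_deriv_def by blast
  note eqs = this[of 1, unfolded fd] this[of 2, unfolded fd]
  have "(\<integral>x. v x $ i * tens (deriv a) b x \<partial>lebesgue_on disc) = (\<integral>x. f x * tens (deriv a) b x \<partial>lborel)"
    "(\<integral>x. v x $ i * tens a (deriv b) x \<partial>lebesgue_on disc) = (\<integral>x. f x * tens a (deriv b) x \<partial>lborel)"
    "(\<integral>x. G x $ i $ 1 * tens a b x \<partial>lebesgue_on disc) = (\<integral>x. f1 x * tens a b x \<partial>lborel)"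
    "(\<integral>x. G x $ i $ 2 * tens a b x \<partial>lebesgue_on disc) = (\<integral>x. f2 x * tens a b x \<partial>lborel)"
    by (rule key[OF ae(1) vG(1) m(1) z(1) c(2)] key[OF ae(1) vG(1) m(1) z(1) c(3)]
        key[OF ae(2) vG(2) m(2) z(2) c(1)] key[OF ae(3) vG(2) m(3) z(3) c(1)]; assumption)+
  with eqs show "(\<integral>y. f y * tens (deriv a) b y \<partial>lborel) = - (\<integral>y. f1 y * tens a b y \<partial>lborel) \<and>
        (\<integral>y. f y * tens a (deriv b) y \<partial>lborel) = - (\<integral>y. f2 y * tens a b y \<partial>lborel)"
    by simp
qed

lemma sobolev_representative:
  fixes v :: "real ^ 2 \<Rightarrow> real ^ 2"
  assumes wd: "has_weak_deriv v G disc"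
    and fin: "(\<integral>\<^sup>+x. ennreal ((norm (v x))\<^sup>2) \<partial>lebesgue_on disc) < \<infinity>"
      "(\<integral>\<^sup>+x. ennreal ((norm (G x))\<^sup>2) \<partial>lebesgue_on disc) < \<infinity>"
  obtains u1 u2 g11 g12 g21 g22 where "sobolev u1 u2 g11 g12 g21 g22"
    "\<And>x. x \<notin> disc \<Longrightarrow> u1 x = 0 \<and> u2 x = 0 \<and> g11 x = 0 \<and> g12 x = 0 \<and> g21 x = 0 \<and> g22 x = 0"
    "AE x in lebesgue_on disc. v x = vec2 (u1 x) (u2 x) \<and> G x $ 1 = vec2 (g11 x) (g12 x) \<and>
        G x $ 2 = vec2 (g21 x) (g22 x)"
proof -
  have mv: "(\<lambda>x. v x $ i) \<in> borel_measurable (lebesgue_on disc)" for i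
    using wd by (intro borel_measurable_vec_nth borel_measurable_locally_integrable)
      (auto simp: has_weak_deriv_def)
  have mG: "(\<lambda>x. G x $ i $ j) \<in> borel_measurable (lebesgue_on disc)" for i j
    using wd by (intro borel_measurable_vec_nth borel_measurable_locally_integrable)
      (auto simp: has_weak_deriv_def)
  have "\<exists>f. \<forall>i. f i \<in> borel_measurable borel \<and> (\<forall>x. x \<notin> disc \<longrightarrow> f i x = 0) \<and>
     (AE x in lebesgue_on disc. v x $ i = f i x)"
  proof (intro choice allI)
    fix i
    obtain h where "h \<in> borel_measurable borel" "\<And>x. x \<notin> disc \<Longrightarrow> h x = 0"
      "AE x in lebesgue_on disc. v x $ i = h x"
      using borel_representative[OF mv[of i]] by blast
    then show "\<exists>h. h \<in> borel_measurable borel \<and> (\<forall>x. x \<notin> disc \<longrightarrow> h x = 0) \<and>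
       (AE x in lebesgue_on disc. v x $ i = h x)" by blast
  qed
  then obtain f where f: "\<And>i. f i \<in> borel_measurable borel" "\<And>i x. x \<notin> disc \<Longrightarrow> f i x = 0"
    "\<And>i. AE x in lebesgue_on disc. v x $ i = f i x" by blast
  have "\<exists>g. \<forall>i. \<forall>j. g i j \<in> borel_measurable borel \<and> (\<forall>x. x \<notin> disc \<longrightarrow> g i j x = 0) \<and>
     (AE x in lebesgue_on disc. G x $ i $ j = g i j x)"
  proof (intro choice allI)
    fix i j
    obtain h where "h \<in> borel_measurable borel" "\<And>x. x \<notin> disc \<Longrightarrow> h x = 0"
      "AE x in lebesgue_on disc. G x $ i $ j = h x"
      using borel_representative[OF mG[of i j]] by blast
    then show "\<exists>h. h \<in> borel_measurable borel \<and> (\<forall>x. x \<notin> disc \<longrightarrow> h x = 0) \<and>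
       (AE x in lebesgue_on disc. G x $ i $ j = h x)" by blast
  qed
  then obtain g where g: "\<And>i j. g i j \<in> borel_measurable borel" "\<And>i j x. x \<notin> disc \<Longrightarrow> g i j x = 0"
    "\<And>i j. AE x in lebesgue_on disc. G x $ i $ j = g i j x" by blast
  have Lf: "LpN 2 (f i) < \<infinity>" for i
  proof (intro LpN_2_disc[OF f(1,2) _ fin(1)])
    show "AE x in lebesgue_on disc. \<bar>f i x\<bar> \<le> norm (v x)"
      using f(3)[of i] by eventually_elim (metis component_le_norm_cart)
  qed
  have Lg: "LpN 2 (g i j) < \<infinity>" for i j
  proof (intro LpN_2_disc[OF g(1,2) _ fin(2)])
    have le: "\<bar>G x $ i $ j\<bar> \<le> norm (G x)" for x
      using component_le_norm_cart[of "G x $ i" j] Finite_Cartesian_Product.norm_nth_le[of "G x" i] by linarith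
    show "AE x in lebesgue_on disc. \<bar>g i j x\<bar> \<le> norm (G x)"
      using g(3)[of i j] by eventually_elim (metis le)
  qed
  have "sobolev (f 1) (f 2) (g 1 1) (g 1 2) (g 2 1) (g 2 2)"
  proof
    have "weak_grad (f i) (g i 1) (g i 2)" for i
      by (rule weak_grad_representative[OF wd f(1) g(1) g(1) f(2) g(2) g(2) f(3) g(3) g(3)])
    then show "weak_grad (f 1) (g 1 1) (g 1 2)" "weak_grad (f 2) (g 2 1) (g 2 2)" by blast+
  qed (auto intro!: integrable_disc_L2 f g Lf Lg simp del: infinity_ennreal_def)
  moreover have "AE x in lebesgue_on disc. v x = vec2 (f 1 x) (f 2 x) \<and> G x $ 1 = vec2 (g 1 1 x) (g 1 2 x) \<and>
        G x $ 2 = vec2 (g 2 1 x) (g 2 2 x)"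
    using f(3)[of 1] f(3)[of 2] g(3)[of 1 1] g(3)[of 1 2] g(3)[of 2 1] g(3)[of 2 2]
    by eventually_elim (auto simp: vec_eq_iff forall_2)
  ultimately show ?thesis using that f(2) g(2) by blast
qed

subsection \<open>Calibrations\<close>

text \<open>The left-hand side of \<open>ineq\<close> is the divergence of \<open>(p \<circ> u, q \<circ> u)\<close> at a point where \<open>Du = A\<close>; on the
  right is the energy density up to a multiple of the divergence of \<open>u\<close> and of its determinant.\<close>

locale calibration =
  fixes p p1 p2 q q1 q2 W :: "real ^ 2 \<Rightarrow> real" and Y :: "(real ^ 2) set" and \<kappa> C :: real
  assumes grad: "has_grad p p1 p2" "has_grad q q1 q2"
    and cont: "continuous_on UNIV p1" "continuous_on UNIV p2" "continuous_on UNIV q1" "continuous_on UNIV q2"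
    and bound: "\<bar>p1 y\<bar> \<le> C" "\<bar>p2 y\<bar> \<le> C" "\<bar>q1 y\<bar> \<le> C" "\<bar>q2 y\<bar> \<le> C"
    and kappa: "0 \<le> \<kappa>" "\<kappa> \<le> 1"
    and measW: "W \<in> borel_measurable borel"
    and W_nonneg: "y \<in> Y \<Longrightarrow> 0 \<le> W y"
    and W_growth: "y \<in> Y \<Longrightarrow> (y $ 1)\<^sup>2 \<le> C * (1 + W y)"
    and ineq: "y \<in> Y \<Longrightarrow> \<epsilon> > 0 \<Longrightarrow>
      p1 y * A11 + p2 y * A21 + q1 y * A12 + q2 y * A22 \<le> (p1 y + q2 y) / 2 * (A11 + A22) +
        (\<epsilon> * (A11\<^sup>2 + A12\<^sup>2 + A21\<^sup>2 + A22\<^sup>2 - 2 * \<kappa> * (A11 * A22 - A12 * A21)) + W y / \<epsilon>) / 2"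

definition area :: real where "area = measure lborel disc"

lemma integrable_disc: "integrable lborel (indicator disc :: real ^ 2 \<Rightarrow> real)"
  "(\<integral>x. indicator disc x \<partial>lborel) = area"
  using emeasure_lborel_ball_finite[of "0 :: real ^ 2" 1] by (auto simp: area_def)

lemma area_nonneg: "area \<ge> 0" by (simp add: area_def)

locale calibrated_sobolev = sobolev u1 u2 g11 g12 g21 g22 + calibration p p1 p2 q q1 q2 W Y \<kappa> C
  for u1 u2 g11 g12 g21 g22 p p1 p2 q q1 q2 W Y \<kappa> C +
  fixes \<epsilon> :: real
  assumes eps: "\<epsilon> > 0"
    and zero: "x \<notin> disc \<Longrightarrow> u1 x = 0 \<and> u2 x = 0 \<and> g11 x = 0 \<and> g12 x = 0 \<and> g21 x = 0 \<and> g22 x = 0"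
    and range: "AE x in lborel. x \<in> disc \<longrightarrow> vec2 (u1 x) (u2 x) \<in> Y"
begin

text \<open>The indicator matters: \<open>u\<close> is zero off the disc, but \<open>W 0\<close> may
  be positive.\<close>

definition dens :: "real ^ 2 \<Rightarrow> real" where
  "dens x = indicator disc x * (\<epsilon> * ((g11 x)\<^sup>2 + (g12 x)\<^sup>2 + (g21 x)\<^sup>2 + (g22 x)\<^sup>2) + W (u x) / \<epsilon>)"

lemma u_meas [measurable]: "u \<in> borel_measurable borel"
  unfolding u_def[abs_def] by measurable

lemma range_u: "AE x in lborel. x \<in> disc \<longrightarrow> u x \<in> Y"
  using range by (simp add: u_def)

text \<open>After the integration by parts only one derivative of \<open>u\<close> is left, so that the prefactor \<open>\<epsilon>\<close> gains
  \<open>sqrt \<epsilon>\<close> over the energy by Young's inequality.\<close>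

lemma null_lagrangian_bound:
  assumes sm: "smooth a" "smooth b" and r: "r < 1" and z: "\<And>x. norm x > r \<Longrightarrow> tens a b x = 0"
    and B: "\<And>x. \<bar>tens (deriv a) b x\<bar> \<le> B" "\<And>x. \<bar>tens a (deriv b) x\<bar> \<le> B"
    and idens: "integrable lborel dens"
  defines "E \<equiv> (\<integral>x. dens x \<partial>lborel) / 2"
  shows "\<epsilon> * \<bar>\<integral>x. tens a b x * (g11 x * g22 x) - tens a b x * (g12 x * g21 x) \<partial>lborel\<bar> \<le>
    sqrt \<epsilon> * B * (C * (area + 2 * E * \<epsilon>) + 2 * E)"
proof -
  note [measurable] = measW
  have B0: "B \<ge> 0" using B(1)[of 0] by linarith
  have C0: "C \<ge> 0" using bound(1)[of 0] by linarith
  have "\<epsilon> * \<bar>\<integral>x. tens a b x * (g11 x * g22 x) - tens a b x * (g12 x * g21 x) \<partial>lborel\<bar> =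
    \<epsilon> * \<bar>\<integral>x. tens a (deriv b) x * (u1 x * g21 x) - tens (deriv a) b x * (u1 x * g22 x) \<partial>lborel\<bar>"
    using det_identity[OF sm r z] by simp
  also have "\<dots> = \<bar>\<integral>x. \<epsilon> * (tens a (deriv b) x * (u1 x * g21 x) - tens (deriv a) b x * (u1 x * g22 x)) \<partial>lborel\<bar>"
    using eps by (simp add: abs_mult)
  also have "\<dots> \<le> (\<integral>x. sqrt \<epsilon> * B * (C * (indicator disc x + \<epsilon> * dens x) + dens x) \<partial>lborel)"
  proof (rule order_trans[OF integral_abs_bound], rule integral_mono_AE)
    have m: "tens (deriv a) b \<in> borel_measurable borel" "tens a (deriv b) \<in> borel_measurable borel"
      using sm smooth_deriv(2) by (auto intro!: borel_measurable_continuous_onI tens_continuous)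
    show "integrable lborel (\<lambda>x. \<bar>\<epsilon> * (tens a (deriv b) x * (u1 x * g21 x) - tens (deriv a) b x * (u1 x * g22 x))\<bar>)"
      using integrable_L2_prod[OF meas(1,5) m(2) L2(1,5) B(2)] integrable_L2_prod[OF meas(1,6) m(1) L2(1,6) B(1)]
      by (intro integrable_abs integrable_mult_right Bochner_Integration.integrable_diff)
    show "integrable lborel (\<lambda>x. sqrt \<epsilon> * B * (C * (indicator disc x + \<epsilon> * dens x) + dens x))"
      using idens integrable_disc(1) by (intro integrable_mult_right Bochner_Integration.integrable_add)
    show "AE x in lborel. \<bar>\<epsilon> * (tens a (deriv b) x * (u1 x * g21 x) - tens (deriv a) b x * (u1 x * g22 x))\<bar> \<le>
       sqrt \<epsilon> * B * (C * (indicator disc x + \<epsilon> * dens x) + dens x)"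
      using range_u
    proof eventually_elim
      case (elim x)
      show ?case
      proof (cases "x \<in> disc")
        case True
        with elim have Y: "u x \<in> Y" by auto
        \<comment> \<open>\<open>W_growth\<close> controls the undifferentiated factor
          \<open>u1\<close> left by the integration by parts, for which no bound uniform in
          \<epsilon> is assumed: its square is bounded through the potential energy.\<close>
        have W: "0 \<le> W (u x)" "(u1 x)\<^sup>2 \<le> C * (1 + W (u x))"
          using W_nonneg[OF Y] W_growth[OF Y] by (auto simp: u_def)
        define D where "D = \<epsilon> * ((g21 x)\<^sup>2 + (g22 x)\<^sup>2)"
        have d: "dens x = \<epsilon> * ((g11 x)\<^sup>2 + (g12 x)\<^sup>2) + D + W (u x) / \<epsilon>"
          using True by (simp add: dens_def D_def algebra_simps)
        have "D \<le> dens x" "W (u x) \<le> \<epsilon> * dens x"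
        proof -
          show "D \<le> dens x" using eps W by (auto simp: d)
          have "W (u x) / \<epsilon> \<le> dens x" using eps by (auto simp: d D_def)
          then show "W (u x) \<le> \<epsilon> * dens x" using eps by (simp add: divide_le_eq mult.commute)
        qed
        have am: "2 * (sqrt \<epsilon> * \<bar>c * g\<bar>) \<le> c\<^sup>2 + \<epsilon> * g\<^sup>2" for c g :: real
        proof -
          have "0 \<le> (\<bar>c\<bar> - sqrt \<epsilon> * \<bar>g\<bar>)\<^sup>2" by simp
          also have "\<dots> = c\<^sup>2 + \<epsilon> * g\<^sup>2 - 2 * (sqrt \<epsilon> * \<bar>c * g\<bar>)"
            using eps by (simp add: power2_diff power_mult_distrib abs_mult)
          finally show ?thesis by simp
        qed
        have "\<bar>\<epsilon> * (tens a (deriv b) x * (u1 x * g21 x) - tens (deriv a) b x * (u1 x * g22 x))\<bar>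
          \<le> \<epsilon> * (B * \<bar>u1 x * g21 x\<bar> + B * \<bar>u1 x * g22 x\<bar>)"
        proof -
          have "\<bar>tens a (deriv b) x * (u1 x * g21 x) - tens (deriv a) b x * (u1 x * g22 x)\<bar>
             \<le> \<bar>tens a (deriv b) x\<bar> * \<bar>u1 x * g21 x\<bar> + \<bar>tens (deriv a) b x\<bar> * \<bar>u1 x * g22 x\<bar>"
            unfolding abs_mult[symmetric, of "tens _ _ x"] by (rule abs_triangle_ineq4)
          also have "\<dots> \<le> B * \<bar>u1 x * g21 x\<bar> + B * \<bar>u1 x * g22 x\<bar>"
            using B by (intro add_mono mult_right_mono) auto
          finally show ?thesis using eps unfolding abs_mult[of \<epsilon>] by simp
        qed
        also have "\<dots> = sqrt \<epsilon> * B * (sqrt \<epsilon> * \<bar>u1 x * g21 x\<bar> + sqrt \<epsilon> * \<bar>u1 x * g22 x\<bar>)"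
        proof -
          have "\<epsilon> = sqrt \<epsilon> * sqrt \<epsilon>" using eps by simp
          then show ?thesis by (metis (no_types, opaque_lifting) distrib_left mult.assoc mult.left_commute)
        qed
        also have "\<dots> \<le> sqrt \<epsilon> * B * ((u1 x)\<^sup>2 + D)"
        proof (intro mult_left_mono)
          have "0 \<le> D" using eps by (simp add: D_def)
          then show "sqrt \<epsilon> * \<bar>u1 x * g21 x\<bar> + sqrt \<epsilon> * \<bar>u1 x * g22 x\<bar> \<le> (u1 x)\<^sup>2 + D"
            using am[of "u1 x" "g21 x"] am[of "u1 x" "g22 x"] unfolding D_def distrib_left by linarith
        qed (use B0 eps in auto)
        also have "\<dots> \<le> sqrt \<epsilon> * B * (C * (indicator disc x + \<epsilon> * dens x) + dens x)"
        proof (intro mult_left_mono add_mono)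
          show "(u1 x)\<^sup>2 \<le> C * (indicator disc x + \<epsilon> * dens x)"
            using True W(2) mult_left_mono[OF \<open>W (u x) \<le> \<epsilon> * dens x\<close> C0] by (simp add: distrib_left)
        qed (use B0 eps \<open>D \<le> dens x\<close> in auto)
        finally show ?thesis .
      qed (use zero[of x] in \<open>simp add: dens_def\<close>)
    qed
  qed
  also have "\<dots> = sqrt \<epsilon> * B * (C * (area + 2 * E * \<epsilon>) + 2 * E)"
    using idens integrable_disc by (simp add: E_def)
  finally show ?thesis .
qed

text \<open>The chain rule turns the left-hand side into the integral of the cutoff times the
  divergence of (p \<circ> u, q \<circ> u), and \<open>ineq\<close> is integrated against the
  cutoff. Where the density is nonnegative the cutoff may be replaced by 1; in the signed
  determinant term it must stay, as it makes the integration by parts possible.\<close>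

lemma energy_bound:
  assumes sm: "smooth a" "smooth b" and r: "r < 1" and z: "\<And>x. norm x > r \<Longrightarrow> tens a b x = 0"
    and \<phi>: "\<And>x. 0 \<le> tens a b x" "\<And>x. tens a b x \<le> 1"
    and B: "\<And>x. \<bar>tens (deriv a) b x\<bar> \<le> B" "\<And>x. \<bar>tens a (deriv b) x\<bar> \<le> B"
    and idens: "integrable lborel dens"
  defines "E \<equiv> (\<integral>x. dens x \<partial>lborel) / 2"
  shows "- (\<integral>x. tens (deriv a) b x * p (u x) \<partial>lborel) - (\<integral>x. tens a (deriv b) x * q (u x) \<partial>lborel) \<le>
    E + C * (\<integral>x. \<bar>g11 x + g22 x\<bar> \<partial>lborel) + sqrt \<epsilon> * B * (C * (area + 2 * E * \<epsilon>) + 2 * E)"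
proof -
  let ?\<phi> = "tens a b"
  note [measurable] = measW
  have C0: "C \<ge> 0" using bound(1)[of 0] by linarith
  have m [measurable]: "?\<phi> \<in> borel_measurable borel"
    using sm by (auto intro!: borel_measurable_continuous_onI tens_continuous)
  have mc [measurable]: "p1 \<in> borel_measurable borel" "p2 \<in> borel_measurable borel"
     "q1 \<in> borel_measurable borel" "q2 \<in> borel_measurable borel"
    using cont by (auto intro!: borel_measurable_continuous_onI)
  have \<phi>a: "\<bar>?\<phi> x\<bar> \<le> 1" for x using \<phi>[of x] by simp
  have bi: "integrable lborel (\<lambda>x. ?\<phi> x * (f (u x) * h x))"
    if [measurable]: "f \<in> borel_measurable borel" and "\<And>y. \<bar>f y\<bar> \<le> C" "integrable lborel h" for f h
  proof (rule Bochner_Integration.integrable_bound)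
    show "integrable lborel (\<lambda>x. C * \<bar>h x\<bar>)" using that by auto
    have [measurable]: "h \<in> borel_measurable borel" using that by auto
    show "(\<lambda>x. ?\<phi> x * (f (u x) * h x)) \<in> borel_measurable lborel" by measurable
    show "AE x in lborel. norm (?\<phi> x * (f (u x) * h x)) \<le> norm (C * \<bar>h x\<bar>)"
    proof (rule AE_I2)
      fix x
      have "\<bar>?\<phi> x\<bar> * (\<bar>f (u x)\<bar> * \<bar>h x\<bar>) \<le> 1 * (C * \<bar>h x\<bar>)"
        using \<phi>a that(2) C0 by (intro mult_mono) auto
      then show "norm (?\<phi> x * (f (u x) * h x)) \<le> norm (C * \<bar>h x\<bar>)" using C0 by (simp add: abs_mult)
    qed
  qed
  note i = bi[OF mc(1) bound(1) int(3)] bi[OF mc(2) bound(2) int(5)]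
    bi[OF mc(3) bound(3) int(4)] bi[OF mc(4) bound(4) int(6)]
  have det: "integrable lborel (\<lambda>x. ?\<phi> x * (g11 x * g22 x) - ?\<phi> x * (g12 x * g21 x))"
    using integrable_L2_prod[OF meas(3,6) m L2(3,6) \<phi>a] integrable_L2_prod[OF meas(4,5) m L2(4,5) \<phi>a] by simp
  have "- (\<integral>x. tens (deriv a) b x * p (u x) \<partial>lborel) - (\<integral>x. tens a (deriv b) x * q (u x) \<partial>lborel) =
    (\<integral>x. ?\<phi> x * (p1 (u x) * g11 x + p2 (u x) * g21 x) \<partial>lborel) +
    (\<integral>x. ?\<phi> x * (q1 (u x) * g12 x + q2 (u x) * g22 x) \<partial>lborel)"
    using chain_rule(1)[OF sm r z grad(1) cont(1,2) bound(1,2)]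
      chain_rule(2)[OF sm r z grad(2) cont(3,4) bound(3,4)] by simp
  also have "\<dots> = (\<integral>x. ?\<phi> x * (p1 (u x) * g11 x) + ?\<phi> x * (p2 (u x) * g21 x) +
     (?\<phi> x * (q1 (u x) * g12 x) + ?\<phi> x * (q2 (u x) * g22 x)) \<partial>lborel)"
    using i by (simp add: distrib_left)
  also have "\<dots> \<le> (\<integral>x. C * \<bar>g11 x + g22 x\<bar> + dens x / 2 -
      \<epsilon> * \<kappa> * (?\<phi> x * (g11 x * g22 x) - ?\<phi> x * (g12 x * g21 x)) \<partial>lborel)"
  proof (rule integral_mono_AE)
    show "integrable lborel (\<lambda>x. ?\<phi> x * (p1 (u x) * g11 x) + ?\<phi> x * (p2 (u x) * g21 x) +
     (?\<phi> x * (q1 (u x) * g12 x) + ?\<phi> x * (q2 (u x) * g22 x)))"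
      using i by (intro Bochner_Integration.integrable_add)
    show "integrable lborel (\<lambda>x. C * \<bar>g11 x + g22 x\<bar> + dens x / 2 -
      \<epsilon> * \<kappa> * (?\<phi> x * (g11 x * g22 x) - ?\<phi> x * (g12 x * g21 x)))"
      by (rule Bochner_Integration.integrable_diff;
        intro det idens int Bochner_Integration.integrable_add integrable_mult_right integrable_divide integrable_abs)
    show "AE x in lborel. ?\<phi> x * (p1 (u x) * g11 x) + ?\<phi> x * (p2 (u x) * g21 x) +
      (?\<phi> x * (q1 (u x) * g12 x) + ?\<phi> x * (q2 (u x) * g22 x)) \<le>
      C * \<bar>g11 x + g22 x\<bar> + dens x / 2 - \<epsilon> * \<kappa> * (?\<phi> x * (g11 x * g22 x) - ?\<phi> x * (g12 x * g21 x))"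
      using range_u
    proof eventually_elim
      case (elim x)
      show ?case
      proof (cases "x \<in> disc")
        case True
        with elim have Y: "u x \<in> Y" by auto
        define G where "G = (g11 x)\<^sup>2 + (g12 x)\<^sup>2 + (g21 x)\<^sup>2 + (g22 x)\<^sup>2"
        define d where "d = g11 x * g22 x - g12 x * g21 x"
        have W: "0 \<le> W (u x)" using W_nonneg[OF Y] .
        have dn: "dens x = \<epsilon> * G + W (u x) / \<epsilon>" using True by (simp add: dens_def G_def)
        have G0: "0 \<le> \<epsilon> * G + W (u x) / \<epsilon>" using eps W by (simp add: G_def)
        have "?\<phi> x * (p1 (u x) * g11 x + p2 (u x) * g21 x + q1 (u x) * g12 x + q2 (u x) * g22 x) \<le>
          ?\<phi> x * ((p1 (u x) + q2 (u x)) / 2 * (g11 x + g22 x) + (\<epsilon> * (G - 2 * \<kappa> * d) + W (u x) / \<epsilon>) / 2)"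
          unfolding G_def d_def by (intro mult_left_mono ineq[OF Y eps] \<phi>)
        also have "\<dots> = ?\<phi> x * ((p1 (u x) + q2 (u x)) / 2 * (g11 x + g22 x)) + ?\<phi> x * ((\<epsilon> * G + W (u x) / \<epsilon>) / 2)
           - \<epsilon> * \<kappa> * (?\<phi> x * d)"
          by (simp add: field_simps)
        also have "\<dots> \<le> C * \<bar>g11 x + g22 x\<bar> + dens x / 2 - \<epsilon> * \<kappa> * (?\<phi> x * d)"
        proof (intro diff_right_mono add_mono)
          have "\<bar>(p1 (u x) + q2 (u x)) / 2\<bar> \<le> C" using bound(1)[of "u x"] bound(4)[of "u x"]
            unfolding abs_le_iff by (auto simp: field_simps)
          then have "\<bar>?\<phi> x\<bar> * (\<bar>(p1 (u x) + q2 (u x)) / 2\<bar> * \<bar>g11 x + g22 x\<bar>) \<le> 1 * (C * \<bar>g11 x + g22 x\<bar>)"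
            using \<phi>a C0 by (intro mult_mono) auto
          then show "?\<phi> x * ((p1 (u x) + q2 (u x)) / 2 * (g11 x + g22 x)) \<le> C * \<bar>g11 x + g22 x\<bar>"
            unfolding abs_mult[symmetric] by linarith
          show "?\<phi> x * ((\<epsilon> * G + W (u x) / \<epsilon>) / 2) \<le> dens x / 2"
            using mult_right_mono[OF \<phi>(2)[of x], of "(\<epsilon> * G + W (u x) / \<epsilon>) / 2"] G0 by (simp add: dn)
        qed
        finally show ?thesis by (simp add: d_def algebra_simps)
      qed (use zero[of x] in \<open>simp add: dens_def\<close>)
    qed
  qed
  also have "\<dots> = C * (\<integral>x. \<bar>g11 x + g22 x\<bar> \<partial>lborel) + E - \<epsilon> * \<kappa> * (\<integral>x. ?\<phi> x * (g11 x * g22 x) - ?\<phi> x * (g12 x * g21 x) \<partial>lborel)"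
  proof -
    have "has_bochner_integral lborel (\<lambda>x. C * \<bar>g11 x + g22 x\<bar> + dens x / 2 -
        \<epsilon> * \<kappa> * (?\<phi> x * (g11 x * g22 x) - ?\<phi> x * (g12 x * g21 x)))
      (C * (\<integral>x. \<bar>g11 x + g22 x\<bar> \<partial>lborel) + E -
        \<epsilon> * \<kappa> * (\<integral>x. ?\<phi> x * (g11 x * g22 x) - ?\<phi> x * (g12 x * g21 x) \<partial>lborel))"
      unfolding E_def
      by (intro has_bochner_integral_diff has_bochner_integral_add has_bochner_integral_mult_right
          has_bochner_integral_divide has_bochner_integral_integrable det idens integrable_abs
          Bochner_Integration.integrable_add int)
    then show ?thesis by (rule has_bochner_integral_integral_eq)
  qed
  also have "\<dots> \<le> C * (\<integral>x. \<bar>g11 x + g22 x\<bar> \<partial>lborel) + E + \<epsilon> * \<bar>\<integral>x. ?\<phi> x * (g11 x * g22 x) - ?\<phi> x * (g12 x * g21 x) \<partial>lborel\<bar>"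
  proof -
    have "\<bar>\<kappa> * D\<bar> \<le> 1 * \<bar>D\<bar>" for D unfolding abs_mult using kappa by (intro mult_right_mono) auto
    then have "- (\<kappa> * D) \<le> \<bar>D\<bar>" for D by (smt (verit))
    then have "- (\<epsilon> * (\<kappa> * D)) \<le> \<epsilon> * \<bar>D\<bar>" for D
      using eps mult_left_mono[of "- (\<kappa> * D)" "\<bar>D\<bar>" \<epsilon>] by simp
    then show ?thesis by (simp add: mult.assoc)
  qed
  also have "\<dots> \<le> C * (\<integral>x. \<bar>g11 x + g22 x\<bar> \<partial>lborel) + E + sqrt \<epsilon> * B * (C * (area + 2 * E * \<epsilon>) + 2 * E)"
    unfolding E_def by (intro add_left_mono null_lagrangian_bound[OF sm r z B idens])
  finally show ?thesis by simp
qed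

end

section \<open>The limit field and its interface\<close>

lemma jump_measurable: "(\<lambda>x. f (jump am ap x)) \<in> borel_measurable borel" for f :: "real ^ 2 \<Rightarrow> 'b::topological_space"
proof -
  have [measurable]: "(\<lambda>x :: real ^ 2. x $ 1) \<in> borel_measurable borel"
    by (intro borel_measurable_continuous_onI continuous_intros)
  have "(\<lambda>x. f (jump am ap x)) = (\<lambda>x. if x $ 1 > 0 then f ap else if x $ 1 < 0 then f am else f 0)"
    by (auto simp: jump_def fun_eq_iff)
  then show ?thesis by simp
qed

lemma jump_integrable:
  assumes "continuous_on UNIV \<psi>" "\<And>x. norm x > R \<Longrightarrow> \<psi> x = 0"
  shows "integrable lborel (\<lambda>x. \<psi> x * (f (jump am ap x) :: real))"
proof (rule Bochner_Integration.integrable_bound)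
  note [measurable] = jump_measurable[of f am ap]
  have [measurable]: "\<psi> \<in> borel_measurable borel" using assms(1) by (rule borel_measurable_continuous_onI)
  show "integrable lborel (\<lambda>x. \<bar>\<psi> x\<bar> * (\<bar>f ap\<bar> + \<bar>f am\<bar> + \<bar>f 0\<bar>))"
    using integrable_compact_support[OF assms] by auto
  show "AE x in lborel. norm (\<psi> x * f (jump am ap x)) \<le> norm (\<bar>\<psi> x\<bar> * (\<bar>f ap\<bar> + \<bar>f am\<bar> + \<bar>f 0\<bar>))"
    by (auto simp: jump_def abs_mult intro!: mult_left_mono)
  show "(\<lambda>x. \<psi> x * f (jump am ap x)) \<in> borel_measurable lborel" by measurable
qed

lemma tens_support:
  assumes "\<And>t. \<bar>t\<bar> > R \<Longrightarrow> a t = 0" "\<And>t. \<bar>t\<bar> > R \<Longrightarrow> b t = 0" "norm x > 2 * R"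
  shows "tens a b x = 0"
proof -
  have "\<bar>x $ 1\<bar> > R \<or> \<bar>x $ 2\<bar> > R" using norm_le_abs_sum[of x] assms(3) by linarith
  then show ?thesis using assms by (auto simp: tens_def)
qed

text \<open>Across the interface, \<open>deriv a\<close> integrates to 1 on the left half-line and
  to -1 on the right one, because \<open>a 0 = 1\<close>. The term with \<open>q\<close> vanishes:
  the jump does not depend on the second coordinate and \<open>deriv b\<close> has integral
  0.\<close>

lemma jump_integral:
  assumes sm: "smooth a" "smooth b" and z: "\<And>t. \<bar>t\<bar> > R \<Longrightarrow> a t = 0" "\<And>t. \<bar>t\<bar> > R \<Longrightarrow> b t = 0" and a0: "a 0 = 1"
  shows "- (\<integral>x. tens (deriv a) b x * p (jump am ap x) \<partial>lborel) - (\<integral>x. tens a (deriv b) x * q (jump am ap x) \<partial>lborel)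
    = (p ap - p am) * (\<integral>t. b t \<partial>lborel)"
proof -
  have R0: "R \<ge> 0" using z(1)[of 0] a0 by (cases "R \<ge> 0") auto
  have z': "deriv a t = 0" "deriv b t = 0" if "\<bar>t\<bar> > R" for t
    using that z sm by (auto intro!: kern_deriv_support[where l = "-R" and u = R])
  note sd = smooth_deriv(2)[OF sm(1)] smooth_deriv(2)[OF sm(2)]
  have int1: "integrable lborel (\<lambda>x. tens (deriv a) b x * p (jump am ap x))"
    by (rule jump_integrable[where R = "2 * R"]) (auto intro!: tens_continuous sm sd tens_support[of R] z z')
  have int2: "integrable lborel (\<lambda>x. tens a (deriv b) x * q (jump am ap x))"
    by (rule jump_integrable[where R = "2 * R"]) (auto intro!: tens_continuous sm sd tens_support[of R] z z')
  define P where "P s = (if s > 0 then p ap else if s < 0 then p am else p 0)" for s :: real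
  define Q where "Q s = (if s > 0 then q ap else if s < 0 then q am else q 0)" for s :: real
  have PQ: "p (jump am ap (vec2 s t)) = P s" "q (jump am ap (vec2 s t)) = Q s" for s t
    by (auto simp: jump_def P_def Q_def)
  have c: "continuous_on UNIV (deriv a)" "continuous_on UNIV (deriv b)" "continuous_on UNIV a"
    using sd sm by (auto intro: smooth_continuous)
  then have [measurable]: "deriv a \<in> borel_measurable borel" "a \<in> borel_measurable borel"
    by (auto intro: borel_measurable_continuous_onI)
  have half: "(\<integral>s. deriv a s * indicator {0..R} s \<partial>lborel) = - 1"
    "(\<integral>s. deriv a s * indicator {-R..0} s \<partial>lborel) = 1"
    "integrable lborel (\<lambda>s. deriv a s * indicator {0..R} s)"
    "integrable lborel (\<lambda>s. deriv a s * indicator {-R..0} s)"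
  proof -
    have d: "(a has_real_derivative deriv a s) (at s)" "isCont (deriv a) s" for s
      using smooth_deriv(1)[OF sm(1)] c by (auto simp: continuous_on_eq_continuous_at)
    \<comment> \<open>The hypothesis gives zeros only strictly beyond \<open>R\<close>; the end
      points follow by continuity.\<close>
    have aR: "a R = 0" "a (-R) = 0"
    proof -
      have "isCont a R" "isCont a (-R)" using c(3) by (auto simp: continuous_on_eq_continuous_at)
      then have l: "(a \<longlongrightarrow> a R) (at_right R)" "(a \<longlongrightarrow> a (-R)) (at_left (-R))"
        by (auto intro: filterlim_mono[OF _ order_refl at_le] simp: isCont_def)
      have "\<forall>\<^sub>F t in at_right R. a t = 0" "\<forall>\<^sub>F t in at_left (-R). a t = 0"
        using R0 z(1) by (auto simp: eventually_at_filter)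
      then have "(a \<longlongrightarrow> 0) (at_right R)" "(a \<longlongrightarrow> 0) (at_left (-R))"
        by (auto intro: tendsto_eventually)
      with l show "a R = 0" "a (-R) = 0"
        using tendsto_unique[OF trivial_limit_at_right_real] tendsto_unique[OF trivial_limit_at_left_real] by metis+
    qed
    show "(\<integral>s. deriv a s * indicator {0..R} s \<partial>lborel) = - 1"
      "(\<integral>s. deriv a s * indicator {-R..0} s \<partial>lborel) = 1"
      using integral_FTC_Icc_real[of 0 R a "deriv a"] integral_FTC_Icc_real[of "-R" 0 a "deriv a"] d R0 a0 aR
      by simp_all
    show "integrable lborel (\<lambda>s. deriv a s * indicator {0..R} s)"
      "integrable lborel (\<lambda>s. deriv a s * indicator {-R..0} s)"
      using borel_integrable_compact[of "{0..R}" "deriv a"] borel_integrable_compact[of "{-R..0}" "deriv a"] c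
      by (auto simp: mult.commute intro: continuous_on_subset)
  qed
  have "(\<integral>s. deriv a s * P s \<partial>lborel) = (\<integral>s. p ap * (deriv a s * indicator {0..R} s) + p am * (deriv a s * indicator {-R..0} s) \<partial>lborel)"
  proof (rule integral_cong_AE)
    show "(\<lambda>s. deriv a s * P s) \<in> borel_measurable lborel" unfolding P_def by measurable
    have "AE s in lborel. s \<noteq> (0::real)" by (rule AE_lborel_singleton)
    then show "AE s in lborel. deriv a s * P s = p ap * (deriv a s * indicator {0..R} s) + p am * (deriv a s * indicator {-R..0} s)"
    proof eventually_elim
      case (elim s)
      then show ?case using z'(1)[of s] by (cases "\<bar>s\<bar> > R") (auto simp: P_def indicator_def)
    qed
  qed measurable
  also have "\<dots> = p am - p ap" using half by simp
  finally have A: "(\<integral>s. deriv a s * P s \<partial>lborel) = p am - p ap" .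
  have "(\<integral>x. tens (deriv a) b x * p (jump am ap x) \<partial>lborel) = (\<integral>s. \<integral>t. deriv a s * P s * b t \<partial>lborel \<partial>lborel)"
    by (subst integral_vec2(1)[OF int1]) (simp add: tens_def PQ mult_ac)
  also have "\<dots> = (p am - p ap) * (\<integral>t. b t \<partial>lborel)" by (simp add: A)
  finally have 1: "(\<integral>x. tens (deriv a) b x * p (jump am ap x) \<partial>lborel) = (p am - p ap) * (\<integral>t. b t \<partial>lborel)" .
  have "(\<integral>t. deriv b t \<partial>lborel) = 0"
    by (rule integral_deriv_compact_support[OF smooth_deriv(1)[OF sm(2)] c(2), of R]) (auto intro: z z')
  moreover have "(\<integral>x. tens a (deriv b) x * q (jump am ap x) \<partial>lborel) = (\<integral>s. \<integral>t. a s * Q s * deriv b t \<partial>lborel \<partial>lborel)"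
    by (subst integral_vec2(1)[OF int2]) (simp add: tens_def PQ mult_ac)
  ultimately have 2: "(\<integral>x. tens a (deriv b) x * q (jump am ap x) \<partial>lborel) = 0" by simp
  show ?thesis unfolding 1 2 by (simp add: algebra_simps)
qed

section \<open>The lower bound for families of fields\<close>

lemma norm_mat2_sq: "(norm (A :: real ^ 2 ^ 2))\<^sup>2 = (A $ 1 $ 1)\<^sup>2 + (A $ 1 $ 2)\<^sup>2 + (A $ 2 $ 1)\<^sup>2 + (A $ 2 $ 2)\<^sup>2"
proof -
  have "(norm A)\<^sup>2 = (norm (A $ 1))\<^sup>2 + (norm (A $ 2))\<^sup>2"
    by (simp add: norm_vec_def[of A] L2_set_def sum_2)
  then show ?thesis by (simp add: norm_vec2_sq)
qed

lemma Lp_norm_finite_iff: "Lp_norm s \<Omega> f < \<infinity> \<longleftrightarrow> (\<integral>\<^sup>+x. ennreal (norm (f x) powr s) \<partial>lebesgue_on \<Omega>) < \<infinity>"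
  by (simp add: Lp_norm_def Let_def less_top)

lemma Lp_norm_1: "Lp_norm 1 \<Omega> f = (\<integral>\<^sup>+x. ennreal (norm (f x)) \<partial>lebesgue_on \<Omega>)"
  by (simp add: Lp_norm_def Let_def less_top[symmetric])

lemma powr_2: "norm x powr 2 = (norm x)\<^sup>2"
  by (cases "norm x = 0") auto

lemma W12_weak_deriv:
  assumes "v \<in> W12 \<Omega>"
  shows "has_weak_deriv v (weak_deriv \<Omega> v) \<Omega>"
proof -
  from assms obtain G where "has_weak_deriv v G \<Omega>" by (auto simp: W12_def)
  then show ?thesis unfolding weak_deriv_def by (rule someI[of "\<lambda>G. has_weak_deriv v G \<Omega>"])
qed

lemma AE_disc: "(AE x in lebesgue_on disc. P x) \<longleftrightarrow> (AE x in lborel. x \<in> disc \<longrightarrow> P x)"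
  by (subst AE_restrict_space_iff) (auto simp: AE_completion_iff)

lemma emeasure_disc: "emeasure lborel disc = ennreal area"
  unfolding area_def
  using emeasure_lborel_ball_finite[of "0 :: real ^ 2" 1] by (intro emeasure_eq_ennreal_measure) auto

lemma L1_le_Lp:
  fixes f :: "real ^ 2 \<Rightarrow> real"
  assumes f: "f \<in> borel_measurable (lebesgue_on disc)" and s: "s > 1" and \<eta>: "\<eta> > 0"
    and le: "Lp_norm s disc f \<le> ennreal \<eta>"
  shows "(\<integral>\<^sup>+x. ennreal \<bar>f x\<bar> \<partial>lebesgue_on disc) \<le> ennreal (\<eta> * (area + 1))"
proof -
  define I where "I = (\<integral>\<^sup>+x. ennreal (\<bar>f x\<bar> powr s) \<partial>lebesgue_on disc)"
  have "Lp_norm s disc f < \<infinity>" using le by (auto intro: le_less_trans)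
  then have "I < \<infinity>" unfolding Lp_norm_finite_iff by (simp add: I_def)
  then obtain i where i: "I = ennreal i" "i \<ge> 0" by (cases I) auto
  have "i powr (1 / s) \<le> \<eta>"
    using le i \<open>I < \<infinity>\<close> \<eta> unfolding Lp_norm_def by (simp add: I_def[symmetric] ennreal_le_iff)
  then have "(i powr (1 / s)) powr s \<le> \<eta> powr s" using s by (intro powr_mono2) auto
  then have i\<eta>: "i \<le> \<eta> powr s" using s i by (simp add: powr_powr)
  have pw: "\<bar>t\<bar> \<le> \<eta> + \<eta> powr (1 - s) * \<bar>t\<bar> powr s" for t
  proof (cases "\<bar>t\<bar> \<le> \<eta>")
    case True
    then show ?thesis by (simp add: add_increasing2)
  next
    case False
    then have t: "\<bar>t\<bar> > 0" using \<eta> by linarith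
    have "\<eta> powr (s - 1) \<le> \<bar>t\<bar> powr (s - 1)" using False s \<eta> by (intro powr_mono2) auto
    then have "1 \<le> \<eta> powr (1 - s) * \<bar>t\<bar> powr (s - 1)"
      using \<eta> mult_left_mono[of "\<eta> powr (s - 1)" "\<bar>t\<bar> powr (s - 1)" "\<eta> powr (1 - s)"]
      by (simp add: powr_add[symmetric])
    then have "\<bar>t\<bar> * 1 \<le> \<bar>t\<bar> * (\<eta> powr (1 - s) * \<bar>t\<bar> powr (s - 1))" by (rule mult_left_mono) simp
    also have "\<dots> = \<eta> powr (1 - s) * \<bar>t\<bar> powr s"
      using t powr_add[of "\<bar>t\<bar>" 1 "s - 1"] by simp
    finally show ?thesis using \<eta> by simp
  qed
  have "(\<integral>\<^sup>+x. ennreal \<bar>f x\<bar> \<partial>lebesgue_on disc) \<le>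
     (\<integral>\<^sup>+x. ennreal \<eta> + ennreal (\<eta> powr (1 - s)) * ennreal (\<bar>f x\<bar> powr s) \<partial>lebesgue_on disc)"
  proof (rule nn_integral_mono)
    fix x
    have "ennreal \<bar>f x\<bar> \<le> ennreal (\<eta> + \<eta> powr (1 - s) * \<bar>f x\<bar> powr s)" by (intro ennreal_leI pw)
    then show "ennreal \<bar>f x\<bar> \<le> ennreal \<eta> + ennreal (\<eta> powr (1 - s)) * ennreal (\<bar>f x\<bar> powr s)"
      using \<eta> by (simp add: ennreal_mult)
  qed
  also have "\<dots> = (\<integral>\<^sup>+x. ennreal \<eta> \<partial>lebesgue_on disc) + ennreal (\<eta> powr (1 - s)) * I"
    unfolding I_def using f by (subst nn_integral_add) (auto simp: nn_integral_cmult)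
  also have "(\<integral>\<^sup>+x. ennreal \<eta> \<partial>lebesgue_on disc) = ennreal (\<eta> * area)"
    using \<eta> area_nonneg
    by (subst nn_integral_disc) (auto simp: nn_integral_cmult_indicator emeasure_disc ennreal_mult)
  also have "ennreal (\<eta> powr (1 - s)) * I \<le> ennreal (\<eta> powr (1 - s)) * ennreal (\<eta> powr s)"
    unfolding i by (intro mult_left_mono ennreal_leI i\<eta>) auto
  also have "ennreal (\<eta> powr (1 - s)) * ennreal (\<eta> powr s) = ennreal \<eta>"
    using \<eta> by (simp add: ennreal_mult[symmetric] powr_add[symmetric])
  also have "ennreal (\<eta> * area) + ennreal \<eta> = ennreal (\<eta> * (area + 1))"
    using \<eta> area_nonneg by (simp add: ennreal_plus[symmetric] distrib_left del: ennreal_plus)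
  finally show ?thesis by simp
qed

lemma weak_div_measurable:
  assumes "v \<in> W12 disc"
  shows "weak_div disc v \<in> borel_measurable (lebesgue_on disc)"
proof -
  have "weak_deriv disc v \<in> borel_measurable (lebesgue_on disc)"
    using W12_weak_deriv[OF assms]
    by (intro borel_measurable_locally_integrable) (simp add: has_weak_deriv_def)
  then show ?thesis
    unfolding weak_div_def[abs_def] trace_def sum_2
    by (intro borel_measurable_add borel_measurable_vec_nth)
qed

text \<open>For \<epsilon> < 1 the weight with exponent -\<tau> is at least 1, so the L^s norm
  itself becomes small, and on the bounded disc so does the L1 norm.\<close>

lemma families_div_tendsto:
  assumes "v \<in> families am ap" and e: "e > 0"
  shows "\<forall>\<^sub>F \<epsilon> in at_right 0. (\<integral>\<^sup>+x. ennreal \<bar>weak_div disc (v \<epsilon>) x\<bar> \<partial>lebesgue_on disc) \<le> ennreal e"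
proof -
  from assms obtain \<tau> s where s: "\<tau> > 0" "s > 2" and W: "\<And>\<epsilon>. \<epsilon> > 0 \<Longrightarrow> v \<epsilon> \<in> W12 disc"
    and lim: "((\<lambda>\<epsilon>. ennreal (\<epsilon> powr (- \<tau>)) * Lp_norm s disc (weak_div disc (v \<epsilon>))) \<longlongrightarrow> 0) (at_right 0)"
    by (auto simp: families_def)
  define \<eta> where "\<eta> = e / (area + 1)"
  have \<eta>: "\<eta> > 0" "\<eta> * (area + 1) = e" using e area_nonneg by (auto simp: \<eta>_def)
  have "\<forall>\<^sub>F \<epsilon> in at_right 0. ennreal (\<epsilon> powr (- \<tau>)) * Lp_norm s disc (weak_div disc (v \<epsilon>)) < ennreal \<eta>"
    using \<eta> by (intro order_tendstoD(2)[OF lim]) auto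
  moreover have "\<forall>\<^sub>F \<epsilon> in at_right 0. \<epsilon> \<in> {0<..<1::real}"
    by (intro eventually_at_right_real) simp
  ultimately show ?thesis
  proof eventually_elim
    case (elim \<epsilon>)
    have "1 \<le> \<epsilon> powr (- \<tau>)" using elim s powr_mono'[of "- \<tau>" 0 \<epsilon>] by simp
    then have "1 * Lp_norm s disc (weak_div disc (v \<epsilon>)) \<le> ennreal (\<epsilon> powr (- \<tau>)) * Lp_norm s disc (weak_div disc (v \<epsilon>))"
      by (intro mult_right_mono) (auto simp: ennreal_leI simp flip: ennreal_1)
    then have "Lp_norm s disc (weak_div disc (v \<epsilon>)) \<le> ennreal \<eta>" using elim(1) by simp
    from L1_le_Lp[OF weak_div_measurable[OF W] _ \<eta>(1) this] elim(2) s \<eta> show ?case by simp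
  qed
qed

context calibration
begin

text \<open>The estimate for a single field, with explicit errors: \<open>D\<close> for the
  divergence, the \<open>sqrt \<epsilon>\<close> term for the determinant, \<open>J\<close> for the
  distance to the jump. The factor 4 collects the Lipschitz constants 2 C of \<open>p\<close> and
  \<open>q\<close>.\<close>

lemma field_bound:
  assumes v: "v \<in> W12 disc" and eps: "\<epsilon> > 0" and Y: "AE x in lebesgue_on disc. v x \<in> Y"
    and M: "energy W \<epsilon> v disc \<le> ennreal M" "M \<ge> 0"
    and D: "(\<integral>\<^sup>+x. ennreal \<bar>weak_div disc v x\<bar> \<partial>lebesgue_on disc) \<le> ennreal D" "D \<ge> 0"
    and J: "Lp_norm 1 disc (\<lambda>x. v x - jump am ap x) \<le> ennreal J" "J \<ge> 0"
    and sm: "smooth a" "smooth b" and z: "\<And>t. \<bar>t\<bar> > R \<Longrightarrow> a t = 0" "\<And>t. \<bar>t\<bar> > R \<Longrightarrow> b t = 0" and a0: "a 0 = 1"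
    and r: "r < 1" and zr: "\<And>x. norm x > r \<Longrightarrow> tens a b x = 0"
    and \<phi>: "\<And>x. 0 \<le> tens a b x" "\<And>x. tens a b x \<le> 1"
    and B: "\<And>x. \<bar>tens (deriv a) b x\<bar> \<le> B" "\<And>x. \<bar>tens a (deriv b) x\<bar> \<le> B"
  shows "(p ap - p am) * (\<integral>t. b t \<partial>lborel) \<le>
     M + C * D + sqrt \<epsilon> * B * (C * (area + 2 * M * \<epsilon>) + 2 * M) + 4 * B * C * J"
proof -
  define G where "G = weak_deriv disc v"
  have wd: "has_weak_deriv v G disc" unfolding G_def by (rule W12_weak_deriv[OF v])
  have B0: "B \<ge> 0" using B(1)[of 0] by linarith
  have C0: "C \<ge> 0" using bound(1)[of 0] by linarith
  define I where "I = (\<integral>\<^sup>+x. ennreal (\<epsilon> * (norm (G x))\<^sup>2 + W (v x) / \<epsilon>) \<partial>lebesgue_on disc)"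
  have I: "I \<le> ennreal (2 * M)"
  proof -
    have "I / 2 \<le> ennreal M" using M(1) by (simp add: energy_def I_def G_def)
    then have "I / 2 * 2 \<le> ennreal M * 2" by (rule mult_right_mono) simp
    moreover have "I / 2 * 2 = I" by (simp add: ennreal_divide_times ennreal_times_divide)
    moreover have "ennreal M * 2 = ennreal (2 * M)" using M(2) by (simp add: ennreal_mult mult.commute)
    ultimately show ?thesis by simp
  qed
  have fin: "(\<integral>\<^sup>+x. ennreal ((norm (v x))\<^sup>2) \<partial>lebesgue_on disc) < \<infinity>"
    using v Lp_norm_finite_iff[of 2 disc v] by (auto simp: W12_def Lp_def powr_2)
  have "(\<integral>\<^sup>+x. ennreal ((norm (G x))\<^sup>2) \<partial>lebesgue_on disc) \<le>
     (\<integral>\<^sup>+x. ennreal (1 / \<epsilon>) * ennreal (\<epsilon> * (norm (G x))\<^sup>2 + W (v x) / \<epsilon>) \<partial>lebesgue_on disc)"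
  \<comment> \<open>Membership in \<open>W12\<close> gives some square-integrable weak derivative,
    whereas \<open>weak_deriv\<close> is an arbitrary choice. Its square integrability is therefore
    read off from the energy bound, using that \<open>W\<close> is nonnegative on
    \<open>Y\<close>.\<close>
  proof (rule nn_integral_mono_AE)
    show "AE x in lebesgue_on disc. ennreal ((norm (G x))\<^sup>2) \<le>
       ennreal (1 / \<epsilon>) * ennreal (\<epsilon> * (norm (G x))\<^sup>2 + W (v x) / \<epsilon>)"
      using Y
    proof eventually_elim
      case (elim x)
      then have "W (v x) \<ge> 0" by (rule W_nonneg)
      then show ?case using eps
        by (subst ennreal_mult[symmetric]) (auto intro!: ennreal_leI simp: field_simps)
    qed
  qed
  also have "\<dots> \<le> ennreal (1 / \<epsilon>) * I"
  proof -
    have "v \<in> borel_measurable (lebesgue_on disc)" "G \<in> borel_measurable (lebesgue_on disc)"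
      using wd unfolding has_weak_deriv_def by (auto intro!: borel_measurable_locally_integrable)
    moreover from this have "(\<lambda>x. W (v x)) \<in> borel_measurable (lebesgue_on disc)"
      using measurable_compose[OF _ measW] by blast
    ultimately show ?thesis unfolding I_def by (subst nn_integral_cmult) auto
  qed
  also have "\<dots> < \<infinity>" using I by (auto simp: ennreal_mult_less_top intro: le_less_trans)
  finally obtain u1 u2 g11 g12 g21 g22 where so: "sobolev u1 u2 g11 g12 g21 g22"
    and zero: "\<And>x. x \<notin> disc \<Longrightarrow> u1 x = 0 \<and> u2 x = 0 \<and> g11 x = 0 \<and> g12 x = 0 \<and> g21 x = 0 \<and> g22 x = 0"
    and ae: "AE x in lebesgue_on disc. v x = vec2 (u1 x) (u2 x) \<and> G x $ 1 = vec2 (g11 x) (g12 x) \<and>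
        G x $ 2 = vec2 (g21 x) (g22 x)"
    using sobolev_representative[OF wd fin] by blast
  interpret so: sobolev u1 u2 g11 g12 g21 g22 by (rule so)
  have "AE x in lebesgue_on disc. vec2 (u1 x) (u2 x) \<in> Y"
    using Y ae by eventually_elim auto
  then interpret cs: calibrated_sobolev u1 u2 g11 g12 g21 g22 p p1 p2 q q1 q2 W Y \<kappa> C \<epsilon>
    by unfold_locales (use eps zero in \<open>auto simp: AE_disc\<close>)
  note [measurable] = measW
  have dm [measurable]: "cs.dens \<in> borel_measurable borel"
    unfolding cs.dens_def[abs_def]
    by (rule borel_measurable_times, rule borel_measurable_indicator, simp, measurable)
  have dens_nn: "AE x in lborel. 0 \<le> cs.dens x"
    using cs.range_u
  proof eventually_elim
    case (elim x)
    then show ?case using W_nonneg[of "so.u x"] eps by (cases "x \<in> disc") (auto simp: cs.dens_def)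
  qed
  have densI: "(\<integral>\<^sup>+x. ennreal (cs.dens x) \<partial>lborel) = I"
  proof -
    have "I = (\<integral>\<^sup>+x. ennreal (cs.dens x) \<partial>lebesgue_on disc)"
      unfolding I_def
    proof (rule nn_integral_cong_AE)
      have "AE x in lebesgue_on disc. x \<in> disc" by (simp add: AE_disc)
      with ae show "AE x in lebesgue_on disc. ennreal (\<epsilon> * (norm (G x))\<^sup>2 + W (v x) / \<epsilon>) = ennreal (cs.dens x)"
        by eventually_elim (simp add: cs.dens_def norm_mat2_sq so.u_def)
    qed
    also have "\<dots> = (\<integral>\<^sup>+x. ennreal (cs.dens x) * indicator disc x \<partial>lborel)"
      by (rule nn_integral_disc) measurable
    also have "\<dots> = (\<integral>\<^sup>+x. ennreal (cs.dens x) \<partial>lborel)"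
      by (intro nn_integral_cong) (auto simp: indicator_def cs.dens_def)
    finally show ?thesis by simp
  qed
  have idens: "integrable lborel cs.dens"
    using dens_nn I densI by (intro integrableI_nonneg) (auto intro: le_less_trans)
  define E where "E = (\<integral>x. cs.dens x \<partial>lborel) / 2"
  have E: "0 \<le> E" "E \<le> M"
  proof -
    have "ennreal (\<integral>x. cs.dens x \<partial>lborel) \<le> ennreal (2 * M)"
      using nn_integral_eq_integral[OF idens dens_nn] I densI by simp
    then show "E \<le> M" using M(2) by (simp add: E_def ennreal_le_iff)
    show "0 \<le> E" using integral_nonneg_AE[OF dens_nn] by (simp add: E_def)
  qed
  have divD: "(\<integral>x. \<bar>g11 x + g22 x\<bar> \<partial>lborel) \<le> D"
  proof -
    have "ennreal (\<integral>x. \<bar>g11 x + g22 x\<bar> \<partial>lborel) = (\<integral>\<^sup>+x. ennreal \<bar>g11 x + g22 x\<bar> \<partial>lborel)"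
      using so.int by (intro nn_integral_eq_integral[symmetric]) auto
    also have "\<dots> = (\<integral>\<^sup>+x. ennreal \<bar>g11 x + g22 x\<bar> * indicator disc x \<partial>lborel)"
      using zero by (intro nn_integral_cong) (auto simp: indicator_def)
    also have "\<dots> = (\<integral>\<^sup>+x. ennreal \<bar>g11 x + g22 x\<bar> \<partial>lebesgue_on disc)"
      by (rule nn_integral_disc[symmetric]) measurable
    also have "\<dots> = (\<integral>\<^sup>+x. ennreal \<bar>weak_div disc v x\<bar> \<partial>lebesgue_on disc)"
    proof (rule nn_integral_cong_AE)
      show "AE x in lebesgue_on disc. ennreal \<bar>g11 x + g22 x\<bar> = ennreal \<bar>weak_div disc v x\<bar>"
        using ae by eventually_elim (simp add: weak_div_def trace_def sum_2 G_def)
    qed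
    finally have "ennreal (\<integral>x. \<bar>g11 x + g22 x\<bar> \<partial>lborel) \<le> ennreal D" using D(1) by simp
    then show ?thesis using D(2) by (simp add: ennreal_le_iff)
  qed
  have jumpJ: "\<bar>(\<integral>x. \<psi> x * f (so.u x) \<partial>lborel) - (\<integral>x. \<psi> x * f (jump am ap x) \<partial>lborel)\<bar> \<le> B * (2 * C * J)"
    if f: "has_grad f f1 f2" "\<And>y. \<bar>f1 y\<bar> \<le> C" "\<And>y. \<bar>f2 y\<bar> \<le> C"
      and \<psi>: "continuous_on UNIV \<psi>" "\<And>x. norm x > r \<Longrightarrow> \<psi> x = 0" "\<And>x. \<bar>\<psi> x\<bar> \<le> B" for f f1 f2 \<psi>
  proof -
    have [measurable]: "(\<lambda>x. jump am ap x) \<in> borel_measurable borel" using jump_measurable[of "\<lambda>x. x"] by simp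
    have i: "integrable lborel (\<lambda>x. \<psi> x * f (so.u x))"
      using so.int by (intro integrable_test_lipschitz[OF f \<psi>(1,2)]) (auto simp: so.u_def)
    have j: "integrable lborel (\<lambda>x. \<psi> x * f (jump am ap x))"
      using \<psi>(1,2) by (rule jump_integrable)
    have "\<bar>(\<integral>x. \<psi> x * f (so.u x) \<partial>lborel) - (\<integral>x. \<psi> x * f (jump am ap x) \<partial>lborel)\<bar> =
       \<bar>\<integral>x. \<psi> x * f (so.u x) - \<psi> x * f (jump am ap x) \<partial>lborel\<bar>"
      using i j by simp
    also have "\<dots> \<le> (\<integral>x. \<bar>\<psi> x * f (so.u x) - \<psi> x * f (jump am ap x)\<bar> \<partial>lborel)" by (rule integral_abs_bound)
    finally have 1: "\<bar>(\<integral>x. \<psi> x * f (so.u x) \<partial>lborel) - (\<integral>x. \<psi> x * f (jump am ap x) \<partial>lborel)\<bar>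
       \<le> (\<integral>x. \<bar>\<psi> x * f (so.u x) - \<psi> x * f (jump am ap x)\<bar> \<partial>lborel)" .
    have "ennreal (\<integral>x. \<bar>\<psi> x * f (so.u x) - \<psi> x * f (jump am ap x)\<bar> \<partial>lborel) =
      (\<integral>\<^sup>+x. ennreal \<bar>\<psi> x * f (so.u x) - \<psi> x * f (jump am ap x)\<bar> \<partial>lborel)"
      using i j by (intro nn_integral_eq_integral[symmetric]) auto
    also have "\<dots> \<le> (\<integral>\<^sup>+x. ennreal (B * (2 * C)) * (ennreal (norm (so.u x - jump am ap x)) * indicator disc x) \<partial>lborel)"
    proof (rule nn_integral_mono)
      fix x
      show "ennreal \<bar>\<psi> x * f (so.u x) - \<psi> x * f (jump am ap x)\<bar> \<le>
        ennreal (B * (2 * C)) * (ennreal (norm (so.u x - jump am ap x)) * indicator disc x)"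
      proof (cases "norm x > r")
        case False
        then have x: "x \<in> disc" using r by simp
        have "\<bar>\<psi> x * (f (so.u x) - f (jump am ap x))\<bar> \<le> B * (2 * C * norm (so.u x - jump am ap x))"
          unfolding abs_mult using \<psi>(3) B0 has_grad_lipschitz[OF f] by (intro mult_mono) auto
        then have "\<bar>\<psi> x * f (so.u x) - \<psi> x * f (jump am ap x)\<bar> \<le> B * (2 * C) * norm (so.u x - jump am ap x)"
          by (simp only: right_diff_distrib mult.assoc)
        then show ?thesis using x B0 C0 by (simp add: ennreal_mult[symmetric] ennreal_leI)
      qed (simp add: \<psi>(2))
    qed
    also have "\<dots> = ennreal (B * (2 * C)) * (\<integral>\<^sup>+x. ennreal (norm (so.u x - jump am ap x)) * indicator disc x \<partial>lborel)"
    proof (rule nn_integral_cmult)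
      have [measurable]: "Measurable.pred borel (\<lambda>x :: real ^ 2. x \<in> disc)" by (simp add: pred_def)
      show "(\<lambda>x. ennreal (norm (so.u x - jump am ap x)) * indicator disc x) \<in> borel_measurable lborel"
        by measurable
    qed
    also have "(\<integral>\<^sup>+x. ennreal (norm (so.u x - jump am ap x)) * indicator disc x \<partial>lborel) =
       (\<integral>\<^sup>+x. ennreal (norm (so.u x - jump am ap x)) \<partial>lebesgue_on disc)"
      by (rule nn_integral_disc[symmetric]) measurable
    also have "\<dots> = Lp_norm 1 disc (\<lambda>x. v x - jump am ap x)"
      unfolding Lp_norm_1
    proof (rule nn_integral_cong_AE)
      show "AE x in lebesgue_on disc. ennreal (norm (so.u x - jump am ap x)) = ennreal (norm (v x - jump am ap x))"
        using ae by eventually_elim (simp add: so.u_def)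
    qed
    also have "ennreal (B * (2 * C)) * \<dots> \<le> ennreal (B * (2 * C)) * ennreal J"
      using J by (intro mult_left_mono) auto
    also have "\<dots> = ennreal (B * (2 * C * J))" using B0 C0 J by (simp add: ennreal_mult mult.assoc)
    finally have "(\<integral>x. \<bar>\<psi> x * f (so.u x) - \<psi> x * f (jump am ap x)\<bar> \<partial>lborel) \<le> B * (2 * C * J)"
      using B0 C0 J by (simp add: ennreal_le_iff)
    with 1 show ?thesis by linarith
  qed
  have sd: "continuous_on UNIV (tens (deriv a) b)" "continuous_on UNIV (tens a (deriv b))"
    using sm smooth_deriv(2) by (auto intro!: tens_continuous)
  have zr': "tens (deriv a) b x = 0" "tens a (deriv b) x = 0" if "norm x > r" for x
    using has_grad_zero[OF tens_has_grad[OF sm] zr that] by auto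
  have "(p ap - p am) * (\<integral>t. b t \<partial>lborel) =
    - (\<integral>x. tens (deriv a) b x * p (jump am ap x) \<partial>lborel) - (\<integral>x. tens a (deriv b) x * q (jump am ap x) \<partial>lborel)"
    by (rule jump_integral[OF sm z a0, symmetric])
  also have "\<dots> \<le> (- (\<integral>x. tens (deriv a) b x * p (so.u x) \<partial>lborel) - (\<integral>x. tens a (deriv b) x * q (so.u x) \<partial>lborel))
     + 4 * B * C * J"
    using jumpJ[OF grad(1) bound(1,2) sd(1) zr'(1) B(1)] jumpJ[OF grad(2) bound(3,4) sd(2) zr'(2) B(2)] by linarith
  also have "\<dots> \<le> (E + C * (\<integral>x. \<bar>g11 x + g22 x\<bar> \<partial>lborel) + sqrt \<epsilon> * B * (C * (area + 2 * E * \<epsilon>) + 2 * E)) + 4 * B * C * J"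
    unfolding E_def by (intro add_right_mono cs.energy_bound[OF sm r zr \<phi> B idens])
  also have "\<dots> \<le> (M + C * D + sqrt \<epsilon> * B * (C * (area + 2 * M * \<epsilon>) + 2 * M)) + 4 * B * C * J"
    using E C0 B0 eps divD by (intro add_mono mult_left_mono mult_right_mono order_refl) auto
  finally show ?thesis by simp
qed

text \<open>If the energy were at most some M < 2 c for a small \<epsilon>, with c = p ap - p am,
  then \<open>field_bound\<close> with a cutoff seeing almost the whole interface, of length 2,
  would give c (2 - 4 \<delta>) \<le> M up to a small error.\<close>

theorem liminf_lower:
  assumes v: "v \<in> families am ap" and Y: "\<And>\<epsilon>. \<epsilon> > 0 \<Longrightarrow> AE x in lebesgue_on disc. v \<epsilon> x \<in> Y"
  shows "ennreal (2 * (p ap - p am)) \<le> Liminf (at_right 0) (\<lambda>\<epsilon>. energy W \<epsilon> (v \<epsilon>) disc)"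
proof (cases "p ap - p am \<le> 0")
  case True
  then have "ennreal (2 * (p ap - p am)) = 0" by (intro ennreal_neg) simp
  then show ?thesis by simp
next
  case False
  define c where "c = p ap - p am"
  have c: "c > 0" using False by (simp add: c_def)
  have C0: "C \<ge> 0" using bound(1)[of 0] by linarith
  show ?thesis unfolding le_Liminf_iff
  proof (intro allI impI)
    fix y assume y: "y < ennreal (2 * (p ap - p am))"
    then have "y < \<infinity>" by (auto intro: less_le_trans)
    then obtain y' where y': "y = ennreal y'" "y' \<ge> 0" by (cases y) auto
    with y have yc: "y' < 2 * c" by (simp add: c_def ennreal_less_iff)
    define M where "M = (y' + 2 * c) / 2"
    have M: "y' < M" "M < 2 * c" "0 \<le> M" using yc y'(2) by (auto simp: M_def)
    \<comment> \<open>Chosen so that shortening the interface by 4 \<delta> costs at most half of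
      the gap 2 c - M.\<close>
    define \<delta> where "\<delta> = min (1 / 4) ((2 * c - M) / (8 * c))"
    have \<delta>: "0 < \<delta>" "\<delta> \<le> 1 / 4" using c M by (auto simp: \<delta>_def)
    have c\<delta>: "M < c * (2 - 4 * \<delta>)"
    proof -
      have "c * (4 * \<delta>) \<le> c * (4 * ((2 * c - M) / (8 * c)))"
        using c by (intro mult_left_mono) (auto simp: \<delta>_def)
      also have "\<dots> = (2 * c - M) / 2" using c by simp
      finally show ?thesis using M by (simp add: algebra_simps)
    qed
    \<comment> \<open>The product of \<open>a\<close> and \<open>b\<close> lives on the rectangle of
      half-sides \<delta> and 1 - \<delta>, which lies in the open disc because \<delta>^2 + (1 -
      \<delta>)^2 < 1. On the interface it is 1 up to distance 1 - 2 \<delta> from the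
      centre.\<close>
    define a where "a = cutoff (\<delta> / 2) \<delta>"
    define b where "b = cutoff (1 - 2 * \<delta>) (1 - \<delta>)"
    have ca: "smooth a" "0 \<le> a t" "a t \<le> 1" "\<bar>t\<bar> \<ge> \<delta> \<Longrightarrow> a t = 0" "a 0 = 1" for t
      using cutoff[of "\<delta> / 2" \<delta>] \<delta> by (auto simp: a_def)
    have cb: "smooth b" "0 \<le> b t" "b t \<le> 1" "\<bar>t\<bar> \<ge> 1 - \<delta> \<Longrightarrow> b t = 0" "\<bar>t\<bar> \<le> 1 - 2 * \<delta> \<Longrightarrow> b t = 1" for t
      using cutoff[of "1 - 2 * \<delta>" "1 - \<delta>"] \<delta> by (auto simp: b_def)
    define r where "r = sqrt (\<delta>\<^sup>2 + (1 - \<delta>)\<^sup>2)"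
    have r: "r < 1"
    proof -
      have "\<delta> * \<delta> < \<delta> * 1" using \<delta> by (intro mult_strict_left_mono) auto
      then have "\<delta>\<^sup>2 + (1 - \<delta>)\<^sup>2 < 1\<^sup>2" by (simp add: power2_eq_square algebra_simps)
      then show ?thesis unfolding r_def by (intro real_less_lsqrt) auto
    qed
    have zr: "tens a b x = 0" if "norm x > r" for x
    proof (rule ccontr)
      assume "tens a b x \<noteq> 0"
      then have "\<bar>x $ 1\<bar> \<le> \<delta>" "\<bar>x $ 2\<bar> \<le> 1 - \<delta>"
        using ca(4)[of "x $ 1"] cb(4)[of "x $ 2"]
        by (cases "\<delta> \<le> \<bar>x $ 1\<bar>"; cases "1 - \<delta> \<le> \<bar>x $ 2\<bar>"; simp add: tens_def)+
      then have "(x $ 1)\<^sup>2 \<le> \<delta>\<^sup>2" "(x $ 2)\<^sup>2 \<le> (1 - \<delta>)\<^sup>2"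
        using \<delta> by (auto simp: abs_le_square_iff[symmetric])
      then have "(norm x)\<^sup>2 \<le> \<delta>\<^sup>2 + (1 - \<delta>)\<^sup>2" by (simp add: norm_vec2_sq)
      then have "norm x \<le> r" unfolding r_def by (rule real_le_rsqrt)
      then show False using that by simp
    qed
    have \<phi>: "0 \<le> tens a b x" "tens a b x \<le> 1" for x
      using ca cb by (auto simp: tens_def intro!: mult_le_one)
    have sd: "continuous_on UNIV (tens (deriv a) b)" "continuous_on UNIV (tens a (deriv b))"
      using ca(1) cb(1) smooth_deriv(2) by (auto intro!: tens_continuous)
    have zr': "tens (deriv a) b x = 0" "tens a (deriv b) x = 0" if "norm x > r" for x
      using has_grad_zero[OF tens_has_grad[OF ca(1) cb(1)] zr that] by auto
    obtain B1 B2 where "\<And>x. \<bar>tens (deriv a) b x\<bar> \<le> B1" "\<And>x. \<bar>tens a (deriv b) x\<bar> \<le> B2"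
      using bounded_compact_support[OF sd(1) zr'(1)] bounded_compact_support[OF sd(2) zr'(2)] by blast
    then have B: "\<bar>tens (deriv a) b x\<bar> \<le> max B1 B2" "\<bar>tens a (deriv b) x\<bar> \<le> max B1 B2" for x
      by (auto simp: le_max_iff_disj)
    define B where "B = max B1 B2"
    have B0: "B \<ge> 0" using B(1)[of 0] by (simp add: B_def)
    have ib: "2 - 4 * \<delta> \<le> (\<integral>t. b t \<partial>lborel)"
    proof -
      have "(\<integral>t. indicator {-(1 - 2 * \<delta>)..1 - 2 * \<delta>} t \<partial>lborel) \<le> (\<integral>t. b t \<partial>lborel)"
      proof (rule integral_mono)
        show "integrable lborel b"
          using cb \<delta> by (intro integrable_compact_support[of _ 1] smooth_continuous) auto
        show "integrable lborel (indicat_real {-(1 - 2 * \<delta>)..1 - 2 * \<delta>})"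
          by (intro integrable_real_indicator) (auto simp: emeasure_lborel_Icc_eq)
        show "indicat_real {-(1 - 2 * \<delta>)..1 - 2 * \<delta>} t \<le> b t" for t
          using cb(2)[of t] cb(5)[of t] by (auto simp: indicator_def abs_le_iff)
      qed
      then show ?thesis using \<delta> by simp
    qed
    define g where "g = c * (\<integral>t. b t \<partial>lborel) - M"
    have "c * (2 - 4 * \<delta>) \<le> c * (\<integral>t. b t \<partial>lborel)" using c by (intro mult_left_mono ib) auto
    with c\<delta> have g: "g > 0" unfolding g_def by linarith
    \<comment> \<open>Half of the remaining gap \<open>g\<close> is reserved for the errors of
      divergence and jump, the other half for the \<open>sqrt \<epsilon>\<close> term.\<close>
    define \<theta> where "\<theta> = g / (2 * (C + 4 * B * C + 1))"
    have pos: "C + 4 * B * C + 1 > 0" using C0 B0 by (intro add_nonneg_pos add_nonneg_nonneg) auto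
    then have \<theta>: "\<theta> > 0" using g by (simp add: \<theta>_def)
    have "C * \<theta> + 4 * B * C * \<theta> = (C + 4 * B * C) * \<theta>" by (simp add: algebra_simps)
    also have "\<dots> \<le> (C + 4 * B * C + 1) * \<theta>" using \<theta> by (intro mult_right_mono) auto
    also have "K * (g / (2 * K)) = g / 2" if "K > 0" for K using that by simp
    from this[OF pos] have "(C + 4 * B * C + 1) * \<theta> = g / 2" unfolding \<theta>_def .
    finally have \<theta>g: "C * \<theta> + 4 * B * C * \<theta> \<le> g / 2" .
    have "((\<lambda>\<epsilon>. sqrt \<epsilon> * B * (C * (area + 2 * M * \<epsilon>) + 2 * M)) \<longlongrightarrow> sqrt 0 * B * (C * (area + 2 * M * 0) + 2 * M)) (at_right 0)"
      by (intro tendsto_intros)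
    then have "\<forall>\<^sub>F \<epsilon> in at_right 0. sqrt \<epsilon> * B * (C * (area + 2 * M * \<epsilon>) + 2 * M) < g / 2"
      using g by (intro order_tendstoD(2)) auto
    moreover have "\<forall>\<^sub>F \<epsilon> in at_right 0. Lp_norm 1 disc (\<lambda>x. v \<epsilon> x - jump am ap x) < ennreal \<theta>"
      using v \<theta> by (intro order_tendstoD(2)) (auto simp: families_def)
    moreover have "\<forall>\<^sub>F \<epsilon> in at_right 0. \<epsilon> \<in> {0<..<1::real}"
      by (intro eventually_at_right_real) simp
    ultimately show "\<forall>\<^sub>F \<epsilon> in at_right 0. y < energy W \<epsilon> (v \<epsilon>) disc"
      using families_div_tendsto[OF v \<theta>]
    proof eventually_elim
      case (elim \<epsilon>)
      then have \<epsilon>: "\<epsilon> > 0" by simp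
      have vW: "v \<epsilon> \<in> W12 disc" using v \<epsilon> by (auto simp: families_def)
      have "ennreal M < energy W \<epsilon> (v \<epsilon>) disc"
      proof (rule ccontr)
        assume "\<not> ?thesis"
        then have E: "energy W \<epsilon> (v \<epsilon>) disc \<le> ennreal M" by simp
        have "c * (\<integral>t. b t \<partial>lborel) \<le> M + C * \<theta> + sqrt \<epsilon> * B * (C * (area + 2 * M * \<epsilon>) + 2 * M) + 4 * B * C * \<theta>"
          unfolding c_def B_def
        proof (rule field_bound[OF vW \<epsilon> Y[OF \<epsilon>] E M(3) elim(4) _ less_imp_le[OF elim(2)] _ ca(1) cb(1) _ _ ca(5) r zr \<phi> B])
          show "a t = 0" if "1 < \<bar>t\<bar>" for t using that \<delta> by (intro ca(4)) auto
          show "b t = 0" if "1 < \<bar>t\<bar>" for t using that \<delta> by (intro cb(4)) auto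
        qed (use \<theta> in auto)
        then show False using \<theta>g elim(1) by (simp add: g_def)
      qed
      moreover have "y < ennreal M" using y' M by (simp add: ennreal_less_iff)
      ultimately show ?case by (rule less_trans[rotated])
    qed
  qed
qed

end

lemma has_grad_cong:
  "has_grad h a b \<Longrightarrow> (\<And>x. a x = a' x) \<Longrightarrow> (\<And>x. b x = b' x) \<Longrightarrow> has_grad h a' b'"
  by (simp add: has_grad_def)

subsection \<open>The potential with an exponent in the unit interval\<close>

text \<open>The odd extension of the power. It is needed because the rotated coordinates y1 + y2 and
  y2 - y1 exceed 1 in parts of the unit disc, where one of the two arguments of the power is
  negative.\<close>

definition spow :: "real \<Rightarrow> real \<Rightarrow> real" where
  "spow \<beta> x = max x 0 powr \<beta> - max (- x) 0 powr \<beta>"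

lemma spow_nonneg: "0 \<le> x \<Longrightarrow> spow \<beta> x = x powr \<beta>"
  by (cases "x = 0") (auto simp: spow_def max_def)

text \<open>The graph of the concave power lies below its tangent at 1; concavity is obtained from
  convexity of \<open>exp\<close> between 0 and \<open>ln a\<close>.\<close>

lemma powr_le_tangent:
  assumes "0 < \<beta>" "\<beta> < 1" "0 \<le> (a :: real)"
  shows "a powr \<beta> \<le> \<beta> * a + (1 - \<beta>)"
proof (cases "a = 0")
  case False
  then have a: "a > 0" using assms by simp
  have "exp ((1 - \<beta>) *\<^sub>R 0 + \<beta> *\<^sub>R ln a) \<le> (1 - \<beta>) * exp 0 + \<beta> * exp (ln a)"
    using assms by (intro convex_onD[OF exp_convex]) auto
  then show ?thesis using a by (simp add: powr_def)
qed (use assms in auto)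

text \<open>Dividing by the mean \<open>m\<close> moves the midpoint to 1, where the two tangent
  bounds add up to 2.\<close>

lemma powr_midpoint:
  assumes \<beta>: "0 < \<beta>" "\<beta> < 1" and x: "0 \<le> (x :: real)" "0 \<le> y"
  shows "x powr \<beta> + y powr \<beta> \<le> 2 * ((x + y) / 2) powr \<beta>"
proof (cases "x + y = 0")
  case False
  define m where "m = (x + y) / 2"
  have m: "m > 0" using False x by (simp add: m_def)
  have "(x / m) powr \<beta> + (y / m) powr \<beta> \<le> (\<beta> * (x / m) + (1 - \<beta>)) + (\<beta> * (y / m) + (1 - \<beta>))"
    using assms m by (intro add_mono powr_le_tangent) auto
  also have "\<dots> = \<beta> * ((x + y) / m) + 2 * (1 - \<beta>)" by (simp add: add_divide_distrib distrib_left)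
  also have "x + y = 2 * m" by (simp add: m_def)
  also have "\<beta> * (2 * m / m) + 2 * (1 - \<beta>) = 2" using m by simp
  finally have "(x powr \<beta> + y powr \<beta>) / m powr \<beta> \<le> 2"
    using x m by (simp add: powr_divide add_divide_distrib)
  then show ?thesis using m by (simp add: divide_le_eq m_def[symmetric])
next
  case True
  then have "x = 0" "y = 0" using x by linarith+
  then show ?thesis by simp
qed

lemma powr_subadd:
  assumes \<beta>: "0 < \<beta>" "\<beta> < 1" and x: "0 \<le> (x :: real)" "0 \<le> y"
  shows "(x + y) powr \<beta> \<le> x powr \<beta> + y powr \<beta>"
proof (cases "x + y = 0")
  case False
  define m where "m = x + y"
  have m: "m > 0" using False x by (simp add: m_def)
  have ge: "t \<le> t powr \<beta>" if "0 \<le> t" "t \<le> 1" for t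
    using that \<beta> powr_mono'[of \<beta> 1 t] by simp
  have "1 = x / m + y / m" using m by (simp add: m_def add_divide_distrib[symmetric])
  also have "\<dots> \<le> (x / m) powr \<beta> + (y / m) powr \<beta>"
    using x m by (intro add_mono ge) (auto simp: m_def)
  also have "\<dots> = (x powr \<beta> + y powr \<beta>) / m powr \<beta>" using x m by (simp add: powr_divide add_divide_distrib)
  finally show ?thesis using m by (simp add: le_divide_eq m_def[symmetric])
qed (use x in auto)

text \<open>For arguments of equal sign this is concavity. For opposite signs the left side is a
  difference of powers, which subadditivity bounds by the power of the sum, and d^\<beta> \<le> 2 (d
  / 2)^\<beta> because \<beta> \<le> 1.\<close>

lemma spow_sum:
  assumes \<beta>: "0 < \<beta>" "\<beta> < 1" and s: "x + y \<ge> 0"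
  shows "\<bar>spow \<beta> x + spow \<beta> y\<bar> \<le> 2 * ((x + y) / 2) powr \<beta>"
proof -
  have neg: "\<bar>spow \<beta> x + spow \<beta> y\<bar> \<le> 2 * ((x + y) / 2) powr \<beta>" if "y < 0" "x + y \<ge> 0" for x y
  proof -
    define z d where "z = - y" and "d = x + y"
    have zd: "z > 0" "d \<ge> 0" "x = z + d" using that by (auto simp: z_def d_def)
    have "spow \<beta> x + spow \<beta> y = (z + d) powr \<beta> - z powr \<beta>"
      using zd that by (simp add: spow_def max_def z_def)
    moreover have "z powr \<beta> \<le> (z + d) powr \<beta>" using zd \<beta> by (intro powr_mono2) auto
    moreover have "(z + d) powr \<beta> \<le> z powr \<beta> + d powr \<beta>" using zd \<beta> by (intro powr_subadd) auto
    moreover have "d powr \<beta> \<le> 2 * (d / 2) powr \<beta>"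
    proof -
      have "(2 :: real) powr \<beta> \<le> 2 powr 1" using \<beta> by (intro powr_mono) auto
      then have "d powr \<beta> * 2 powr \<beta> \<le> d powr \<beta> * 2" by (intro mult_left_mono) auto
      then show ?thesis using zd by (simp add: powr_divide le_divide_eq mult.commute)
    qed
    ultimately show ?thesis by (simp add: d_def)
  qed
  consider "x \<ge> 0 \<and> y \<ge> 0" | "y < 0" | "x < 0" by linarith
  then show ?thesis
  proof cases
    case 1
    then show ?thesis using powr_midpoint[OF \<beta>, of x y] by (simp add: spow_nonneg)
  next
    case 2
    then show ?thesis using neg s by auto
  next
    case 3
    then show ?thesis using neg[of x y] neg[of y x] s by (simp add: add.commute)
  qed
qed

lemma continuous_spow: "0 < \<beta> \<Longrightarrow> continuous_on UNIV (spow \<beta>)"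
  unfolding spow_def[abs_def] by (intro continuous_intros continuous_on_powr') auto

lemma antiderivative_exists:
  fixes k :: "real \<Rightarrow> real"
  assumes "continuous_on UNIV k"
  obtains F where "\<And>x. (F has_real_derivative k x) (at x)"
proof
  fix x :: real
  have "((\<lambda>u. LBINT y=ereal 0..ereal u. k y) has_vector_derivative k x) (at x within {-\<bar>x\<bar>-1..\<bar>x\<bar>+1})"
    by (rule interval_integral_FTC2) (auto intro: continuous_on_subset[OF assms])
  then have "((\<lambda>u. LBINT y=ereal 0..ereal u. k y) has_vector_derivative k x) (at x)"
    by (subst (asm) at_within_interior) auto
  then show "((\<lambda>u. LBINT y=ereal 0..ereal u. k y) has_real_derivative k x) (at x)"
    unfolding has_real_derivative_iff_has_vector_derivative .
qed

text \<open>A sum of functions of y1 + y2 and of y2 - y1 solves the wave equation, so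
  \<open>p\<close> has a companion \<open>q\<close> with \<partial>1 q = \<partial>2 p and
  \<partial>2 q = \<partial>1 p. The differential then has equal diagonal entries \<alpha> and equal
  off-diagonal entries \<open>w\<close>, which suits \<kappa> = 1. On the axis y1 = 0 both rotated
  coordinates equal y2 and \<open>w\<close> is exactly the root of the potential.\<close>

theorem liminf_small_exponent:
  fixes am ap :: "real ^ 2"
  assumes am: "am = vector [0, -1]" and ap: "ap = vector [0, 1]" and \<beta>: "0 < \<beta>" "\<beta> < 1"
    and W: "\<And>y. y \<in> cball 0 1 \<Longrightarrow> W y = (1 - (norm y)\<^sup>2) powr (2 * \<beta>)"
    and u: "u \<in> families am ap" and range: "\<And>\<epsilon>. \<epsilon> > 0 \<Longrightarrow> AE x in lebesgue_on disc. norm (u \<epsilon> x) \<le> 1"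
  shows "ennreal (4 * integral {0..1} (\<lambda>t. (1 - t\<^sup>2) powr \<beta>)) \<le> Liminf (at_right 0) (\<lambda>\<epsilon>. energy W \<epsilon> (u \<epsilon>) disc)"
proof -
  \<comment> \<open>Truncation at -1 makes \<open>k\<close> bounded on the whole line, as a
    calibration requires. It is inactive on the unit disc, where both rotated coordinates have
    squares at most 2.\<close>
  define k where "k t = spow \<beta> (max (1 - t\<^sup>2) (-1))" for t :: real
  have ck: "continuous_on UNIV k"
    unfolding k_def by (intro continuous_on_compose2[OF continuous_spow[OF \<beta>(1)]] continuous_intros) auto
  have k1: "\<bar>k t\<bar> \<le> 1" for t
  proof -
    define x where "x = max (1 - t\<^sup>2) (-1)"
    have x: "-1 \<le> x" "x \<le> 1" by (auto simp: x_def)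
    have "z powr \<beta> \<le> 1" if "0 \<le> z" "z \<le> 1" for z using that \<beta> powr_mono2[of \<beta> z 1] by simp
    from this[of "max x 0"] this[of "max (- x) 0"] x
    have "0 \<le> max x 0 powr \<beta>" "max x 0 powr \<beta> \<le> 1" "0 \<le> max (- x) 0 powr \<beta>" "max (- x) 0 powr \<beta> \<le> 1"
      by auto
    then show ?thesis unfolding k_def x_def[symmetric] spow_def abs_le_iff by linarith
  qed
  obtain F where F: "\<And>x. (F has_real_derivative k x) (at x)" using antiderivative_exists[OF ck] by blast
  define P Q where "P = (\<lambda>y :: real ^ 2. y $ 1 + y $ 2)" and "Q = (\<lambda>y :: real ^ 2. y $ 2 - y $ 1)"
  have gP: "has_grad P (\<lambda>_. 1) (\<lambda>_. 1)" "has_grad Q (\<lambda>_. - 1) (\<lambda>_. 1)"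
    unfolding P_def Q_def has_grad_def
    by (auto intro!: derivative_eq_intros bounded_linear.has_derivative[OF bounded_linear_vec_nth])
  define p where "p y = 1 / 2 * (F (P y) + F (Q y))" for y
  define q where "q y = 1 / 2 * (F (P y) + (-1) * F (Q y))" for y
  define \<alpha> where "\<alpha> y = (k (P y) - k (Q y)) / 2" for y
  define w where "w y = (k (P y) + k (Q y)) / 2" for y
  note gF = has_grad_chain[OF F gP(1)] has_grad_chain[OF F gP(2)]
  have gp: "has_grad p \<alpha> w"
    unfolding p_def by (rule has_grad_cong[OF has_grad_mult[OF has_grad_const has_grad_add[OF gF]]])
      (auto simp: \<alpha>_def w_def)
  have gq: "has_grad q w \<alpha>"
    unfolding q_def by (rule has_grad_cong[OF has_grad_mult[OF has_grad_const has_grad_add[OF gF(1) has_grad_mult[OF has_grad_const gF(2)]]]])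
      (auto simp: \<alpha>_def w_def)
  have cP: "continuous_on UNIV (\<lambda>y. k (P y))" "continuous_on UNIV (\<lambda>y. k (Q y))"
    unfolding P_def Q_def by (intro continuous_on_compose2[OF ck] continuous_intros; simp)+
  have c\<alpha>: "continuous_on UNIV \<alpha>" "continuous_on UNIV w"
    unfolding \<alpha>_def w_def using cP by (intro continuous_intros; simp)+
  have b\<alpha>: "\<bar>\<alpha> y\<bar> \<le> 1" "\<bar>w y\<bar> \<le> 1" for y
    using k1[of "P y"] k1[of "Q y"] by (auto simp: \<alpha>_def w_def abs_le_iff field_simps)
  \<comment> \<open>A measurable potential on the whole plane that agrees with \<open>W\<close> on
    the closed unit disc, so the energies of the given fields coincide.\<close>
  define V where "V y = max 0 (1 - (norm y)\<^sup>2) powr (2 * \<beta>)" for y :: "real ^ 2"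
  have Vw: "(w y)\<^sup>2 \<le> V y" if y: "y \<in> cball 0 1" for y
  proof -
    have PQ: "(P y)\<^sup>2 + (Q y)\<^sup>2 = 2 * (norm y)\<^sup>2"
      unfolding norm_vec2_sq P_def Q_def by (simp add: power2_eq_square algebra_simps)
    have ny: "(norm y)\<^sup>2 \<le> 1" using y power_mono[of "norm y" 1 2] by simp
    have "(P y)\<^sup>2 \<le> 2" "(Q y)\<^sup>2 \<le> 2"
      using PQ ny zero_le_power2[of "P y"] zero_le_power2[of "Q y"] by linarith+
    then have kk: "k (P y) = spow \<beta> (1 - (P y)\<^sup>2)" "k (Q y) = spow \<beta> (1 - (Q y)\<^sup>2)"
      by (auto simp: k_def max_def)
    have sum: "((1 - (P y)\<^sup>2) + (1 - (Q y)\<^sup>2)) / 2 = 1 - (norm y)\<^sup>2" using PQ by simp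
    have nn: "(1 - (P y)\<^sup>2) + (1 - (Q y)\<^sup>2) \<ge> 0" using PQ ny by simp
    \<comment> \<open>Concavity enters here: the mean of the two arguments of \<open>spow\<close> is
      1 - |y|^2, because the rotation doubles the squared norm.\<close>
    have "\<bar>k (P y) + k (Q y)\<bar> \<le> 2 * (1 - (norm y)\<^sup>2) powr \<beta>"
      using spow_sum[OF \<beta> nn] unfolding kk sum .
    then have "\<bar>w y\<bar> \<le> (1 - (norm y)\<^sup>2) powr \<beta>" by (simp add: w_def)
    then have "(w y)\<^sup>2 \<le> ((1 - (norm y)\<^sup>2) powr \<beta>)\<^sup>2" by (simp add: abs_le_square_iff[symmetric])
    also have "\<dots> = V y" using ny by (simp add: V_def power2_eq_square powr_add[symmetric])
    finally show ?thesis .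
  qed
  interpret calibration p \<alpha> w q w \<alpha> V "cball 0 1" 1 1
  proof
    show "V \<in> borel_measurable borel" unfolding V_def by measurable
    fix y :: "real ^ 2" assume y: "y \<in> cball 0 1"
    show "0 \<le> V y" by (simp add: V_def)
    have "(y $ 1)\<^sup>2 \<le> 1" using y component_le_norm_cart[of y 1] power_mono[of "\<bar>y $ 1\<bar>" 1 2] by simp
    then show "(y $ 1)\<^sup>2 \<le> 1 * (1 + V y)" using \<open>0 \<le> V y\<close> by simp
    fix \<epsilon> A11 A12 A21 A22 :: real assume \<epsilon>: "0 < \<epsilon>"
    \<comment> \<open>After the trace is split off, only \<open>w y * (A21 + A12)\<close> remains,
      and for \<kappa> = 1 the quadratic form is (A21 + A12)^2 + (A11 - A22)^2.\<close>
    have "0 \<le> (sqrt \<epsilon> * (A21 + A12) - w y / sqrt \<epsilon>)\<^sup>2" by simp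
    also have "\<dots> = \<epsilon> * (A21 + A12)\<^sup>2 + (w y)\<^sup>2 / \<epsilon> - 2 * (w y * (A21 + A12))"
      using \<epsilon> by (simp add: power2_diff power_mult_distrib power_divide)
    finally have 1: "2 * (w y * (A21 + A12)) \<le> \<epsilon> * (A21 + A12)\<^sup>2 + (w y)\<^sup>2 / \<epsilon>" by simp
    have 2: "(w y)\<^sup>2 / \<epsilon> \<le> V y / \<epsilon>" using Vw[OF y] \<epsilon> by (intro divide_right_mono) auto
    have "(A21 + A12)\<^sup>2 \<le> (A21 + A12)\<^sup>2 + (A11 - A22)\<^sup>2" by simp
    also have "\<dots> = A11\<^sup>2 + A12\<^sup>2 + A21\<^sup>2 + A22\<^sup>2 - 2 * 1 * (A11 * A22 - A12 * A21)"
      by (simp add: power2_eq_square algebra_simps)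
    finally have 3: "\<epsilon> * (A21 + A12)\<^sup>2 \<le> \<epsilon> * (A11\<^sup>2 + A12\<^sup>2 + A21\<^sup>2 + A22\<^sup>2 - 2 * 1 * (A11 * A22 - A12 * A21))"
      using \<epsilon> by (intro mult_left_mono) auto
    have eq: "\<alpha> y * A11 + w y * A21 + w y * A12 + \<alpha> y * A22 = (\<alpha> y + \<alpha> y) / 2 * (A11 + A22) + w y * (A21 + A12)"
      by (simp add: algebra_simps)
    show "\<alpha> y * A11 + w y * A21 + w y * A12 + \<alpha> y * A22 \<le> (\<alpha> y + \<alpha> y) / 2 * (A11 + A22) +
        (\<epsilon> * (A11\<^sup>2 + A12\<^sup>2 + A21\<^sup>2 + A22\<^sup>2 - 2 * 1 * (A11 * A22 - A12 * A21)) + V y / \<epsilon>) / 2"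
      unfolding eq
    proof (intro add_left_mono)
      have *: "t \<le> (X' + R') / 2" if "2 * t \<le> X + R" "R \<le> R'" "X \<le> X'" for t X R X' R' :: real
        using that by (simp add: le_divide_eq)
      show "w y * (A21 + A12) \<le> (\<epsilon> * (A11\<^sup>2 + A12\<^sup>2 + A21\<^sup>2 + A22\<^sup>2 - 2 * 1 * (A11 * A22 - A12 * A21)) + V y / \<epsilon>) / 2"
        by (rule *[OF 1 2 3])
    qed
  qed (use gp gq c\<alpha> b\<alpha> in auto)
  have Fd: "F 1 - F (-1) = 2 * integral {0..1} (\<lambda>t. (1 - t\<^sup>2) powr \<beta>)"
  proof -
    have "(k has_integral F 1 - F 0) {0..1}" "(k has_integral F 0 - F (-1)) {-1..0}"
      by (auto intro!: fundamental_theorem_of_calculus has_field_derivative_at_within[OF F]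
          simp: has_real_derivative_iff_has_vector_derivative[symmetric])
    moreover from this(2) have "((\<lambda>t. k (- t)) has_integral F 0 - F (-1)) {- 0..- (- 1)}"
      by (simp only: has_integral_reflect_real)
    then have "(k has_integral F 0 - F (-1)) {0..1}" by (simp add: k_def[abs_def])
    moreover have "integral {0..1} k = integral {0..1} (\<lambda>t. (1 - t\<^sup>2) powr \<beta>)"
    proof (rule integral_cong)
      fix t :: real assume "t \<in> {0..1}"
      then have "t\<^sup>2 \<le> 1" using power_mono[of t 1 2] by simp
      then show "k t = (1 - t\<^sup>2) powr \<beta>" by (simp add: k_def spow_def max_def)
    qed
    ultimately show ?thesis by (auto dest!: integral_unique)
  qed
  have v: "ap $ 1 = 0" "ap $ 2 = 1" "am $ 1 = 0" "am $ 2 = - 1" by (simp_all add: am ap)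
  have pp: "2 * (p ap - p am) = 4 * integral {0..1} (\<lambda>t. (1 - t\<^sup>2) powr \<beta>)"
    using Fd by (simp add: p_def P_def Q_def v)
  have "ennreal (2 * (p ap - p am)) \<le> Liminf (at_right 0) (\<lambda>\<epsilon>. energy V \<epsilon> (u \<epsilon>) disc)"
    using u range by (intro liminf_lower) auto
  also have "\<dots> = Liminf (at_right 0) (\<lambda>\<epsilon>. energy W \<epsilon> (u \<epsilon>) disc)"
  proof (rule Liminf_eq)
    show "\<forall>\<^sub>F \<epsilon> in at_right 0. energy V \<epsilon> (u \<epsilon>) disc = energy W \<epsilon> (u \<epsilon>) disc"
      unfolding eventually_at_filter
    proof (intro always_eventually allI impI)
      fix \<epsilon> :: real assume "\<epsilon> \<in> {0<..}"
      then have "AE x in lebesgue_on disc. norm (u \<epsilon> x) \<le> 1" using range by simp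
      then have "AE x in lebesgue_on disc. V (u \<epsilon> x) = W (u \<epsilon> x)"
      proof eventually_elim
        case (elim x)
        then have "(norm (u \<epsilon> x))\<^sup>2 \<le> 1" using power_mono[of "norm (u \<epsilon> x)" 1 2] by simp
        then show ?case using W[of "u \<epsilon> x"] elim by (simp add: V_def)
      qed
      then show "energy V \<epsilon> (u \<epsilon>) disc = energy W \<epsilon> (u \<epsilon>) disc"
        unfolding energy_def by (intro arg_cong2[where f = "(/)"] nn_integral_cong_AE) (auto elim!: eventually_mono)
    qed
  qed
  finally show ?thesis unfolding pp .
qed

subsection \<open>The radial potentials\<close>

text \<open>Cauchy-Schwarz for the sum of sqrt (ai Zi), without the roots: the mixed term is bounded
  by the arithmetic-geometric mean inequality for a1 Z2 and a2 Z1.\<close>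

lemma cauchy_two:
  fixes T1 T2 a1 a2 Z1 Z2 :: real
  assumes "T1\<^sup>2 \<le> a1 * Z1" "T2\<^sup>2 \<le> a2 * Z2" "0 \<le> a1" "0 \<le> a2" "0 \<le> Z1" "0 \<le> Z2"
  shows "(T1 + T2)\<^sup>2 \<le> (a1 + a2) * (Z1 + Z2)"
proof -
  have "(T1 * T2)\<^sup>2 = T1\<^sup>2 * T2\<^sup>2" by (simp add: power_mult_distrib)
  also have "\<dots> \<le> (a1 * Z1) * (a2 * Z2)" using assms by (intro mult_mono) auto
  also have "\<dots> = (a1 * Z2) * (a2 * Z1)" by simp
  also have "\<dots> \<le> ((a1 * Z2 + a2 * Z1) / 2)\<^sup>2"
  proof -
    have "0 \<le> ((a1 * Z2 - a2 * Z1) / 2)\<^sup>2" by simp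
    then show ?thesis by (simp add: power2_eq_square field_simps)
  qed
  finally have sq: "(T1 * T2)\<^sup>2 \<le> ((a1 * Z2 + a2 * Z1) / 2)\<^sup>2" .
  have "0 \<le> a1 * Z2 + a2 * Z1" using assms by simp
  then have "0 \<le> (a1 * Z2 + a2 * Z1) / 2" by simp
  from power2_le_imp_le[OF sq this] have le: "2 * (T1 * T2) \<le> a1 * Z2 + a2 * Z1" by simp
  have "(T1 + T2)\<^sup>2 = T1\<^sup>2 + T2\<^sup>2 + 2 * (T1 * T2)" by (simp add: power2_sum)
  also have "\<dots> \<le> a1 * Z1 + a2 * Z2 + (a1 * Z2 + a2 * Z1)"
    by (intro add_mono assms(1,2) le)
  also have "\<dots> = (a1 + a2) * (Z1 + Z2)" by (simp add: algebra_simps)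
  finally show ?thesis .
qed

text \<open>The quadratic form dominating the trace-free part of the differential of the calibration,
  after multiplication by \<open>x\<^sup>2 + y\<^sup>2\<close>; it is sharp on the axis \<open>x = 0\<close>.\<close>

lemma calibration_form:
  fixes x y :: real
  assumes \<kappa>: "0 \<le> \<kappa>" "\<kappa> < 1" and \<mu>: "\<mu>\<^sup>2 \<le> 8 * (1 + \<kappa>)" and s: "s = x\<^sup>2 + y\<^sup>2"
  shows "(x * y * (\<mu> - 2 - 2 * \<kappa>) * (x\<^sup>2 - y\<^sup>2) / 2 * (A11 - A22)
      + (\<kappa> * x ^ 4 + (\<mu> - 1 - \<kappa>) * x\<^sup>2 * y\<^sup>2 + y ^ 4) * A21
      + (\<kappa> * y ^ 4 + (\<mu> - 1 - \<kappa>) * x\<^sup>2 * y\<^sup>2 + x ^ 4) * A12)\<^sup>2 \<le>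
    s ^ 4 * (A11\<^sup>2 + A12\<^sup>2 + A21\<^sup>2 + A22\<^sup>2 - 2 * \<kappa> * (A11 * A22 - A12 * A21))"
proof -
  \<comment> \<open>In these coordinates the form is diagonal: \<open>e\<close> and \<open>h\<close>
    have weight (1 + \<kappa>) / 2, while \<open>d\<close> and the trace have weight (1 - \<kappa>)
    / 2. \<open>T1\<close> collects the terms in \<open>e\<close> and \<open>h\<close>,
    \<open>T2\<close> the term in \<open>d\<close>.\<close>
  define k e h d where "k = 1 + \<kappa>" and "e = A11 - A22" and "h = A21 + A12" and "d = A21 - A12"
  define X Y where "X = x\<^sup>2" and "Y = y\<^sup>2"
  define c where "c = (X - Y)\<^sup>2"
  have k: "k > 0" using \<kappa> by (simp add: k_def)
  have sXY: "s = X + Y" "X \<ge> 0" "Y \<ge> 0" by (auto simp: s X_def Y_def)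
  have c: "0 \<le> c" "c \<le> s\<^sup>2"
  proof -
    have "s\<^sup>2 - c = 4 * (X * Y)" by (simp add: sXY c_def power2_eq_square algebra_simps)
    then show "c \<le> s\<^sup>2" using sXY by (smt (verit) mult_nonneg_nonneg)
  qed (simp add: c_def)
  define T1 where "T1 = (x * y * (\<mu> - 2 * k) * (X - Y) * e + (k * c + 2 * \<mu> * X * Y) * h) / 2"
  define T2 where "T2 = (\<kappa> - 1) * (X - Y) * s * d / 2"
  \<comment> \<open>The bounds for \<open>T1\<close> and \<open>T2\<close> are balanced so that
    \<open>a1 + a2\<close> is exactly the fourth power of \<open>s\<close>, since k / 2 + (1 -
    \<kappa>) / 2 = 1.\<close>
  define a1 where "a1 = s\<^sup>2 * ((s\<^sup>2 - c) + k * c / 2)"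
  define a2 where "a2 = (1 - \<kappa>) / 2 * c * s\<^sup>2"
  define Z1 where "Z1 = k / 2 * (e\<^sup>2 + h\<^sup>2)"
  define Z2 where "Z2 = (1 - \<kappa>) / 2 * d\<^sup>2"
  have X4: "x ^ 4 = X\<^sup>2" "y ^ 4 = Y\<^sup>2" by (simp_all add: X_def Y_def flip: power_mult)
  have T: "x * y * (\<mu> - 2 - 2 * \<kappa>) * (x\<^sup>2 - y\<^sup>2) / 2 * (A11 - A22)
      + (\<kappa> * x ^ 4 + (\<mu> - 1 - \<kappa>) * x\<^sup>2 * y\<^sup>2 + y ^ 4) * A21
      + (\<kappa> * y ^ 4 + (\<mu> - 1 - \<kappa>) * x\<^sup>2 * y\<^sup>2 + x ^ 4) * A12 = T1 + T2"
    unfolding X4 X_def[symmetric] Y_def[symmetric] T1_def T2_def c_def k_def e_def h_def d_def sXY(1)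
    by (simp add: power2_eq_square field_simps)
  have "(2 * T1)\<^sup>2 \<le> ((x * y * (\<mu> - 2 * k) * (X - Y))\<^sup>2 + (k * c + 2 * \<mu> * X * Y)\<^sup>2) * (e\<^sup>2 + h\<^sup>2)"
  proof -
    have *: "(p * e + q * h)\<^sup>2 \<le> (p\<^sup>2 + q\<^sup>2) * (e\<^sup>2 + h\<^sup>2)" for p q :: real
    proof -
      have "0 \<le> (p * h - q * e)\<^sup>2" by simp
      then show ?thesis by (simp add: power2_eq_square algebra_simps)
    qed
    have half: "2 * (z / 2) = z" for z :: real by simp
    show ?thesis unfolding T1_def half by (rule *)
  qed
  also have "(x * y * (\<mu> - 2 * k) * (X - Y))\<^sup>2 + (k * c + 2 * \<mu> * X * Y)\<^sup>2 = s\<^sup>2 * (\<mu>\<^sup>2 / 4 * (s\<^sup>2 - c) + k\<^sup>2 * c)"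
  proof -
    have "(x * y * (\<mu> - 2 * k) * (X - Y))\<^sup>2 = X * Y * (\<mu> - 2 * k)\<^sup>2 * c"
      by (simp add: X_def Y_def c_def power_mult_distrib)
    moreover have "4 * (X * Y * (\<mu> - 2 * k)\<^sup>2 * c + (k * c + 2 * \<mu> * X * Y)\<^sup>2) = s\<^sup>2 * (\<mu>\<^sup>2 * (s\<^sup>2 - c) + 4 * (k\<^sup>2 * c))"
      unfolding sXY(1) c_def by algebra
    ultimately show ?thesis by (simp add: distrib_left)
  qed
  also have "\<dots> * (e\<^sup>2 + h\<^sup>2) \<le> s\<^sup>2 * (2 * k * (s\<^sup>2 - c) + k\<^sup>2 * c) * (e\<^sup>2 + h\<^sup>2)"
    \<comment> \<open>The hypothesis on \<mu> is used as \<mu>^2 / 4 \<le> 2 k, the coefficient of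
      s^2 - c = 4 X Y. On the axes this term vanishes.\<close>
    using \<mu> c by (intro mult_right_mono mult_left_mono add_right_mono) (auto simp: k_def)
  also have "\<dots> = 4 * (a1 * Z1)"
    by (simp add: a1_def Z1_def power2_eq_square field_simps)
  finally have 1: "T1\<^sup>2 \<le> a1 * Z1" by (simp add: power_mult_distrib)
  have 2: "T2\<^sup>2 \<le> a2 * Z2"
    by (simp add: T2_def a2_def Z2_def c_def power2_eq_square field_simps)
  have "(T1 + T2)\<^sup>2 \<le> (a1 + a2) * (Z1 + Z2)"
    using 1 2 c k \<kappa> by (intro cauchy_two) (auto simp: a1_def a2_def Z1_def Z2_def)
  also have "a1 + a2 = s ^ 4"
    by (simp add: a1_def a2_def k_def power2_eq_square power4_eq_xxxx field_simps)
  also have "s ^ 4 * (Z1 + Z2) \<le> s ^ 4 * (A11\<^sup>2 + A12\<^sup>2 + A21\<^sup>2 + A22\<^sup>2 - 2 * \<kappa> * (A11 * A22 - A12 * A21))"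
  proof (intro mult_left_mono)
    have "A11\<^sup>2 + A12\<^sup>2 + A21\<^sup>2 + A22\<^sup>2 - 2 * \<kappa> * (A11 * A22 - A12 * A21) = Z1 + Z2 + (1 - \<kappa>) / 2 * (A11 + A22)\<^sup>2"
      by (simp add: Z1_def Z2_def k_def e_def h_def d_def power2_eq_square field_simps)
    moreover have "0 \<le> (1 - \<kappa>) / 2 * (A11 + A22)\<^sup>2" using \<kappa> by simp
    ultimately show "Z1 + Z2 \<le> A11\<^sup>2 + A12\<^sup>2 + A21\<^sup>2 + A22\<^sup>2 - 2 * \<kappa> * (A11 * A22 - A12 * A21)" by linarith
  qed simp
  finally show ?thesis unfolding T .
qed

section \<open>The radial calibration and its truncation\<close>

locale radial_well =
  fixes n m :: nat
  assumes m: "m \<ge> 1"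
begin

text \<open>With \<open>n\<close> in place of \<open>n - 1\<close>, the potential is \<open>(s v)\<^sup>2\<close> where \<open>s = |y|\<^sup>2\<close>.
  The constants \<open>\<kappa>\<close> and \<open>\<mu>\<close> are such that \<open>2 s Q'\<close> and \<open>2 \<kappa> s v'\<close> contain the same multiple of \<open>Q\<close>, which
  therefore cancels from the trace-free part of the differential of the calibration \<open>(f1, f2)\<close>.\<close>

definition "a = real (2 * n + 3)"
definition "b = real (2 * n + 2 * m + 3)"
definition "\<kappa> = 3 / (a * b)"
definition "\<mu> = 1 + 3 / a + 3 / b - 3 / (a * b)"
definition "v s = s ^ n - s ^ (n + m)" for s :: real
definition "Q s = s ^ n / a - s ^ (n + m) / b" for s :: real
definition "v' s = real n * s ^ (n - 1) - real (n + m) * s ^ (n + m - 1)" for s :: real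
definition "Q' s = real n * s ^ (n - 1) / a - real (n + m) * s ^ (n + m - 1) / b" for s :: real

lemma ab: "a \<ge> 3" "b \<ge> 5" using m by (auto simp: a_def b_def)

lemma kappa: "0 \<le> \<kappa>" "\<kappa> \<le> 1 / 5"
proof -
  have "3 * 5 \<le> a * b" using ab by (intro mult_mono) auto
  then show "0 \<le> \<kappa>" "\<kappa> \<le> 1 / 5" using ab by (auto simp: \<kappa>_def divide_le_eq)
qed

text \<open>From a \<ge> 3 and b \<ge> 5 one gets \<mu> \<le> 1 + 1 + 3 / 5, whose square is below
  8.\<close>

lemma lambda: "\<mu>\<^sup>2 \<le> 8 * (1 + \<kappa>)"
proof -
  have "3 / a \<le> 1" "3 / b \<le> 3 / 5" using ab by (auto simp: divide_le_eq)
  moreover have "3 / (a * b) = \<kappa>" by (simp add: \<kappa>_def)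
  ultimately have "\<mu> \<le> 13 / 5" using kappa by (simp add: \<mu>_def)
  moreover have "0 \<le> \<mu>"
  proof -
    have "3 / (a * b) \<le> 1" using kappa by (simp add: \<kappa>_def)
    moreover have "0 \<le> 3 / a" "0 \<le> 3 / b" using ab by auto
    ultimately show ?thesis unfolding \<mu>_def by linarith
  qed
  ultimately have "\<mu>\<^sup>2 \<le> (13 / 5)\<^sup>2" by (intro power_mono)
  also have "\<dots> \<le> 8 * (1 + \<kappa>)" using kappa by (simp add: power2_eq_square)
  finally show ?thesis .
qed

lemma derivs: "(v has_real_derivative v' s) (at s)" "(Q has_real_derivative Q' s) (at s)"
  unfolding v_def[abs_def] v'_def Q_def[abs_def] Q'_def
  by (intro DERIV_diff DERIV_cdivide; rule DERIV_cong[OF DERIV_pow]; simp)+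

text \<open>The operator 2 s d/ds multiplies the two monomials by 2 n = a - 3 and 2 (n + m) = b - 3,
  and \<kappa> a b = 3. The first identity says that y^3 Q (y^2) has derivative y^2 v (y^2), a
  square root of the potential on the axis; this is what makes the calibration sharp there.\<close>

lemma ode: "2 * s * Q' s = v s - 3 * Q s" "2 * \<kappa> * s * v' s = (\<mu> - 1 - 2 * \<kappa>) * v s - 3 * Q s"
proof -
  have pred: "s * (real k * s ^ (k - 1)) = real k * s ^ k" for k by (cases k) auto
  define x y where "x = s ^ n" and "y = s ^ (n + m)"
  have p: "2 * (s * (real n * s ^ (n - 1))) = (a - 3) * x"
    "2 * (s * (real (n + m) * s ^ (n + m - 1))) = (b - 3) * y"
    unfolding pred x_def y_def by (simp_all add: a_def b_def algebra_simps)
  have ne: "a \<noteq> 0" "b \<noteq> 0" using ab by auto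
  have d: "(a - 3) * x / a = x - 3 * (x / a)" "(b - 3) * y / b = y - 3 * (y / b)"
    using ne by (simp_all add: left_diff_distrib diff_divide_distrib)
  have "2 * s * Q' s = 2 * (s * (real n * s ^ (n - 1))) / a - 2 * (s * (real (n + m) * s ^ (n + m - 1))) / b"
    by (simp add: Q'_def right_diff_distrib mult.assoc)
  also have "\<dots> = v s - 3 * Q s" unfolding p d by (simp add: v_def Q_def x_def y_def)
  finally show "2 * s * Q' s = v s - 3 * Q s" .
  have k: "\<kappa> * a = 3 / b" "\<kappa> * b = 3 / a" using ne by (simp_all add: \<kappa>_def)
  have m1: "\<mu> - 1 - 2 * \<kappa> = 3 / a + 3 / b - 3 * \<kappa>" by (simp add: \<mu>_def \<kappa>_def)
  have "2 * \<kappa> * s * v' s = \<kappa> * (2 * (s * (real n * s ^ (n - 1))) - 2 * (s * (real (n + m) * s ^ (n + m - 1))))"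
    by (simp add: v'_def right_diff_distrib)
  also have "\<dots> = (\<kappa> * a) * x - 3 * \<kappa> * x - (\<kappa> * b) * y + 3 * \<kappa> * y" unfolding p by (simp add: algebra_simps)
  also have "\<dots> = (3 / a + 3 / b - 3 * \<kappa>) * (x - y) - 3 * (x / a - y / b)"
    unfolding k by (simp add: algebra_simps add_divide_distrib diff_divide_distrib)
  finally show "2 * \<kappa> * s * v' s = (\<mu> - 1 - 2 * \<kappa>) * v s - 3 * Q s"
    unfolding m1 v_def Q_def x_def y_def .
qed

definition S :: "real ^ 2 \<Rightarrow> real" where "S y = y $ 1 * y $ 1 + y $ 2 * y $ 2"
text \<open>\<open>f1\<close> and \<open>f2\<close> are interchanged by swapping the coordinates.
  Below, \<open>f11\<close> and \<open>f12\<close> are the partial derivatives of \<open>f1\<close>,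
  and \<open>f21\<close> and \<open>f22\<close> those of \<open>f2\<close>.\<close>

definition "f1 y = y $ 2 * (\<kappa> * v (S y) * (y $ 1 * y $ 1) + Q (S y) * (y $ 2 * y $ 2))" for y
definition "f2 y = y $ 1 * (\<kappa> * v (S y) * (y $ 2 * y $ 2) + Q (S y) * (y $ 1 * y $ 1))" for y
definition "f11 y = y $ 2 * (2 * \<kappa> * v (S y) * y $ 1 + 2 * y $ 1 * (\<kappa> * v' (S y) * (y $ 1)\<^sup>2 + Q' (S y) * (y $ 2)\<^sup>2))" for y
definition "f12 y = \<kappa> * v (S y) * (y $ 1)\<^sup>2 + 3 * Q (S y) * (y $ 2)\<^sup>2 + 2 * (y $ 2)\<^sup>2 * (\<kappa> * v' (S y) * (y $ 1)\<^sup>2 + Q' (S y) * (y $ 2)\<^sup>2)" for y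
definition "f21 y = \<kappa> * v (S y) * (y $ 2)\<^sup>2 + 3 * Q (S y) * (y $ 1)\<^sup>2 + 2 * (y $ 1)\<^sup>2 * (\<kappa> * v' (S y) * (y $ 2)\<^sup>2 + Q' (S y) * (y $ 1)\<^sup>2)" for y
definition "f22 y = y $ 1 * (2 * \<kappa> * v (S y) * y $ 2 + 2 * y $ 2 * (\<kappa> * v' (S y) * (y $ 2)\<^sup>2 + Q' (S y) * (y $ 1)\<^sup>2))" for y

lemma S_norm: "S y = (norm y)\<^sup>2" unfolding S_def norm_vec2_sq by (simp add: power2_eq_square)

lemma S_grad: "has_grad S (\<lambda>y. 2 * y $ 1) (\<lambda>y. 2 * y $ 2)"
  unfolding S_def[abs_def]
  by (rule has_grad_cong[OF has_grad_add[OF has_grad_mult[OF has_grad_nth(1,1)] has_grad_mult[OF has_grad_nth(2,2)]]]) auto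

lemma f_grad: "has_grad f1 f11 f12" "has_grad f2 f21 f22"
proof -
  note n = has_grad_nth
  note s = has_grad_mult[OF n(1,1)] has_grad_mult[OF n(2,2)]
  note c = has_grad_chain[OF derivs(1) S_grad] has_grad_chain[OF derivs(2) S_grad]
  note kc = has_grad_mult[OF has_grad_const[of \<kappa>] c(1)]
  show "has_grad f1 f11 f12" unfolding f1_def[abs_def]
    by (rule has_grad_cong[OF has_grad_mult[OF n(2) has_grad_add[OF has_grad_mult[OF kc s(1)] has_grad_mult[OF c(2) s(2)]]]])
       (auto simp: f11_def f12_def power2_eq_square algebra_simps)
  show "has_grad f2 f21 f22" unfolding f2_def[abs_def]
    by (rule has_grad_cong[OF has_grad_mult[OF n(1) has_grad_add[OF has_grad_mult[OF kc s(2)] has_grad_mult[OF c(2) s(1)]]]])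
       (auto simp: f21_def f22_def power2_eq_square algebra_simps)
qed

definition "form A11 A12 A21 A22 = A11\<^sup>2 + A12\<^sup>2 + A21\<^sup>2 + A22\<^sup>2 - 2 * \<kappa> * (A11 * A22 - A12 * A21)" for A11 A12 A21 A22 :: real

lemma form_ge: "(1 - \<kappa>) * (A11\<^sup>2 + A12\<^sup>2 + A21\<^sup>2 + A22\<^sup>2) \<le> form A11 A12 A21 A22"
proof -
  have "0 \<le> \<kappa> * ((A11 - A22)\<^sup>2 + (A12 + A21)\<^sup>2)" using kappa by simp
  then show ?thesis by (simp add: form_def power2_eq_square algebra_simps)
qed

text \<open>Multiplication by \<open>S y\<close> lets \<open>ode\<close> eliminate the derivatives
  of \<open>v\<close> and \<open>Q\<close>; what remains is \<open>v (S y)\<close> times the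
  expression bounded in \<open>calibration_form\<close>. At the origin, where one cannot divide
  again, the left side is zero.\<close>

lemma base_bound:
  "\<bar>(f11 y - f22 y) / 2 * (A11 - A22) + f12 y * A21 + f21 y * A12\<bar> \<le> \<bar>S y * v (S y)\<bar> * sqrt (form A11 A12 A21 A22)"
proof (cases "S y = 0")
  case True
  then have "y $ 1 * y $ 1 + y $ 2 * y $ 2 = 0" by (simp add: S_def)
  then have "y $ 1 = 0" "y $ 2 = 0" by (auto simp: add_nonneg_eq_0_iff)
  then show ?thesis by (simp add: True f11_def f22_def f12_def f21_def)
next
  case False
  define s where "s = S y"
  define x z where "x = y $ 1" and "z = y $ 2"
  have sp: "s > 0" using False by (simp add: s_def S_norm)
  have sx: "s = x\<^sup>2 + z\<^sup>2" by (simp add: s_def S_def x_def z_def power2_eq_square)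
  note o = ode[of s]
  have D1: "s * (f11 y - f22 y) = v s * (x * z * (\<mu> - 2 - 2 * \<kappa>) * (x\<^sup>2 - z\<^sup>2))"
  proof -
    have "s * (f11 y - f22 y) = x * z * (x\<^sup>2 - z\<^sup>2) * (2 * \<kappa> * s * v' s - 2 * s * Q' s)"
      by (simp add: f11_def f22_def s_def[symmetric] x_def[symmetric] z_def[symmetric] algebra_simps)
    also have "\<dots> = v s * (x * z * (\<mu> - 2 - 2 * \<kappa>) * (x\<^sup>2 - z\<^sup>2))" unfolding o by (simp add: algebra_simps)
    finally show ?thesis .
  qed
  have B: "s * f12 y = v s * (\<kappa> * x ^ 4 + (\<mu> - 1 - \<kappa>) * x\<^sup>2 * z\<^sup>2 + z ^ 4)"
  proof -
    have "s * f12 y = \<kappa> * v s * x\<^sup>2 * s + 3 * Q s * z\<^sup>2 * s + z\<^sup>2 * ((2 * \<kappa> * s * v' s) * x\<^sup>2 + (2 * s * Q' s) * z\<^sup>2)"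
      by (simp add: f12_def s_def[symmetric] x_def[symmetric] z_def[symmetric] algebra_simps)
    also have "\<dots> = v s * (\<kappa> * x ^ 4 + (\<mu> - 1 - \<kappa>) * x\<^sup>2 * z\<^sup>2 + z ^ 4)"
      unfolding o unfolding sx by (simp add: power2_eq_square power4_eq_xxxx algebra_simps)
    finally show ?thesis .
  qed
  have C: "s * f21 y = v s * (\<kappa> * z ^ 4 + (\<mu> - 1 - \<kappa>) * x\<^sup>2 * z\<^sup>2 + x ^ 4)"
  proof -
    have "s * f21 y = \<kappa> * v s * z\<^sup>2 * s + 3 * Q s * x\<^sup>2 * s + x\<^sup>2 * ((2 * \<kappa> * s * v' s) * z\<^sup>2 + (2 * s * Q' s) * x\<^sup>2)"
      by (simp add: f21_def s_def[symmetric] x_def[symmetric] z_def[symmetric] algebra_simps)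
    also have "\<dots> = v s * (\<kappa> * z ^ 4 + (\<mu> - 1 - \<kappa>) * x\<^sup>2 * z\<^sup>2 + x ^ 4)"
      unfolding o unfolding sx by (simp add: power2_eq_square power4_eq_xxxx algebra_simps)
    finally show ?thesis .
  qed
  let ?L = "(f11 y - f22 y) / 2 * (A11 - A22) + f12 y * A21 + f21 y * A12"
  let ?l = "x * z * (\<mu> - 2 - 2 * \<kappa>) * (x\<^sup>2 - z\<^sup>2) / 2 * (A11 - A22)
      + (\<kappa> * x ^ 4 + (\<mu> - 1 - \<kappa>) * x\<^sup>2 * z\<^sup>2 + z ^ 4) * A21
      + (\<kappa> * z ^ 4 + (\<mu> - 1 - \<kappa>) * x\<^sup>2 * z\<^sup>2 + x ^ 4) * A12"
  have "s * ?L = (s * (f11 y - f22 y)) / 2 * (A11 - A22) + (s * f12 y) * A21 + (s * f21 y) * A12"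
    by (simp add: algebra_simps)
  also have "\<dots> = v s * ?l" unfolding D1 B C by (simp add: algebra_simps)
  finally have eq: "s * ?L = v s * ?l" .
  have "?l\<^sup>2 \<le> s ^ 4 * form A11 A12 A21 A22"
    unfolding form_def using kappa lambda sx by (intro calibration_form) auto
  then have "(v s)\<^sup>2 * ?l\<^sup>2 \<le> (v s)\<^sup>2 * (s ^ 4 * form A11 A12 A21 A22)" by (rule mult_left_mono) simp
  then have "(s * ?L)\<^sup>2 \<le> (v s)\<^sup>2 * (s ^ 4 * form A11 A12 A21 A22)" unfolding eq by (simp only: power_mult_distrib)
  then have "s\<^sup>2 * ?L\<^sup>2 \<le> s\<^sup>2 * ((s * v s)\<^sup>2 * form A11 A12 A21 A22)"
    by (simp add: power_mult_distrib power4_eq_xxxx power2_eq_square mult_ac)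
  then have "?L\<^sup>2 \<le> (s * v s)\<^sup>2 * form A11 A12 A21 A22" using sp by simp
  then have "sqrt (?L\<^sup>2) \<le> sqrt ((s * v s)\<^sup>2 * form A11 A12 A21 A22)" by (rule real_sqrt_le_mono)
  then show ?thesis by (simp add: real_sqrt_mult s_def)
qed


lemma S_nonneg: "0 \<le> S y" by (simp add: S_norm)

text \<open>For s \<ge> 4 the higher power is at least four times the lower one, so it dominates.
  Far from the wells \<open>v\<close> therefore controls the coefficients of the calibration, and
  the potential controls the square of the argument.\<close>

lemma v_large:
  assumes s: "s \<ge> 4"
  shows "\<kappa> * \<bar>v s\<bar> + \<bar>Q s\<bar> \<le> 2 * \<bar>v s\<bar>" "3 \<le> \<bar>v s\<bar>"
proof -
  have s1: "1 \<le> s ^ n" "4 \<le> s ^ m"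
  proof -
    show "1 \<le> s ^ n" using s by (intro one_le_power) auto
    have "s ^ 1 \<le> s ^ m" using s m by (intro power_increasing) auto
    then show "4 \<le> s ^ m" using s by simp
  qed
  define z where "z = s ^ (n + m)"
  have zn: "s ^ n * 4 \<le> z" unfolding z_def power_add using s1 by (intro mult_left_mono) auto
  have v: "\<bar>v s\<bar> = z - s ^ n" using zn s1 by (simp add: v_def z_def[symmetric])
  have "0 \<le> s ^ n / a" "s ^ n / a \<le> s ^ n / 3" "0 \<le> z / b" "z / b \<le> z / 5"
  proof -
    have "0 \<le> s ^ n" "0 \<le> z" using s1 zn by linarith+
    then show "0 \<le> s ^ n / a" "s ^ n / a \<le> s ^ n / 3" "0 \<le> z / b" "z / b \<le> z / 5"
      using ab by (auto intro!: divide_left_mono mult_pos_pos divide_nonneg_nonneg simp del: divide_le_eq_numeral1 le_divide_eq_numeral1)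
  qed
  then have "\<bar>Q s\<bar> \<le> z" using zn s1 by (simp add: Q_def z_def[symmetric])
  moreover have "\<kappa> * \<bar>v s\<bar> \<le> 1 / 5 * \<bar>v s\<bar>" using kappa by (intro mult_right_mono) auto
  ultimately show "\<kappa> * \<bar>v s\<bar> + \<bar>Q s\<bar> \<le> 2 * \<bar>v s\<bar>" using v zn s1 by linarith
  show "3 \<le> \<bar>v s\<bar>" using v zn s1 by linarith
qed

text \<open>These are the products that arise when the cutoff is differentiated. The bound is 2
  \<open>S y\<close> times a square root of the potential; the extra factor \<open>S y\<close> is
  why the cutoff must decay logarithmically.\<close>

lemma f_large:
  assumes s: "S y \<ge> 4" and i: "i = 1 \<or> i = 2"
  shows "\<bar>y $ i * f1 y\<bar> \<le> 2 * (S y)\<^sup>2 * \<bar>v (S y)\<bar>" "\<bar>y $ i * f2 y\<bar> \<le> 2 * (S y)\<^sup>2 * \<bar>v (S y)\<bar>"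
proof -
  have yy: "\<bar>y $ j * y $ k\<bar> \<le> S y" for j k
  proof -
    have "\<bar>y $ j\<bar> * \<bar>y $ k\<bar> \<le> norm y * norm y" by (intro mult_mono component_le_norm_cart) auto
    then show ?thesis by (simp add: S_norm abs_mult power2_eq_square)
  qed
  have "\<bar>\<kappa> * v (S y) * (y $ j * y $ j) + Q (S y) * (y $ k * y $ k)\<bar> \<le> S y * (2 * \<bar>v (S y)\<bar>)" for j k
  proof -
    have "\<bar>\<kappa> * v (S y) * (y $ j * y $ j) + Q (S y) * (y $ k * y $ k)\<bar> \<le>
      \<kappa> * \<bar>v (S y)\<bar> * \<bar>y $ j * y $ j\<bar> + \<bar>Q (S y)\<bar> * \<bar>y $ k * y $ k\<bar>"
      using kappa by (simp add: abs_mult order_trans[OF abs_triangle_ineq])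
    also have "\<dots> \<le> \<kappa> * \<bar>v (S y)\<bar> * S y + \<bar>Q (S y)\<bar> * S y"
      by (intro add_mono mult_left_mono yy) (use kappa in auto)
    also have "\<dots> = S y * (\<kappa> * \<bar>v (S y)\<bar> + \<bar>Q (S y)\<bar>)" by (simp add: algebra_simps)
    also have "\<dots> \<le> S y * (2 * \<bar>v (S y)\<bar>)" using v_large[OF s] S_nonneg by (intro mult_left_mono) auto
    finally show ?thesis .
  qed
  then have "\<bar>y $ i * y $ l\<bar> * \<bar>\<kappa> * v (S y) * (y $ j * y $ j) + Q (S y) * (y $ k * y $ k)\<bar> \<le> S y * (S y * (2 * \<bar>v (S y)\<bar>))" for j k l
    using yy S_nonneg by (intro mult_mono) auto
  from this[of 2 1 2] this[of 1 2 1]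
  show "\<bar>y $ i * f1 y\<bar> \<le> 2 * (S y)\<^sup>2 * \<bar>v (S y)\<bar>" "\<bar>y $ i * f2 y\<bar> \<le> 2 * (S y)\<^sup>2 * \<bar>v (S y)\<bar>"
    unfolding f1_def f2_def by (simp_all add: abs_mult power2_eq_square mult_ac)
qed

lemma form_nonneg: "0 \<le> form A11 A12 A21 A22"
proof -
  have "0 \<le> (1 - \<kappa>) * (A11\<^sup>2 + A12\<^sup>2 + A21\<^sup>2 + A22\<^sup>2)"
    using kappa by (intro mult_nonneg_nonneg) auto
  then show ?thesis using form_ge by (rule order_trans)
qed

text \<open>Since \<kappa> \<le> 1 / 5, each entry is at most 5 / 4 times the root of the form, and
  four entries occur on the left.\<close>

lemma abs_sum_le_form: "\<bar>A11 - A22\<bar> + \<bar>A21\<bar> + \<bar>A12\<bar> \<le> 5 * sqrt (form A11 A12 A21 A22)"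
proof -
  define N where "N = A11\<^sup>2 + A12\<^sup>2 + A21\<^sup>2 + A22\<^sup>2"
  have N0: "0 \<le> N" by (simp add: N_def)
  have "4 / 5 * N \<le> (1 - \<kappa>) * N" using kappa N0 by (intro mult_right_mono) auto
  also have "\<dots> \<le> form A11 A12 A21 A22" unfolding N_def by (rule form_ge)
  finally have "N \<le> (5 / 4)\<^sup>2 * form A11 A12 A21 A22" using N0 by (simp add: power2_eq_square)
  then have "sqrt N \<le> sqrt ((5 / 4)\<^sup>2 * form A11 A12 A21 A22)" by (rule real_sqrt_le_mono)
  also have "\<dots> = 5 / 4 * sqrt (form A11 A12 A21 A22)" by (simp only: real_sqrt_mult) simp
  finally have N: "sqrt N \<le> 5 / 4 * sqrt (form A11 A12 A21 A22)" .
  have le: "\<bar>t\<bar> \<le> sqrt N" if "t\<^sup>2 \<le> N" for t using that by (simp add: real_le_rsqrt)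
  have "A11\<^sup>2 \<le> N" "A12\<^sup>2 \<le> N" "A21\<^sup>2 \<le> N" "A22\<^sup>2 \<le> N" by (simp_all add: N_def)
  then have "\<bar>A11\<bar> \<le> sqrt N" "\<bar>A12\<bar> \<le> sqrt N" "\<bar>A21\<bar> \<le> sqrt N" "\<bar>A22\<bar> \<le> sqrt N" by (auto intro: le)
  then show ?thesis using N by linarith
qed

text \<open>The differential of \<open>(f1, f2)\<close> is unbounded. A cutoff \<open>c\<close> that decays logarithmically slowly, with
  \<open>20 t |c' t| \<le> \<eta>\<close>, makes it bounded at the expense of the factor \<open>1 - \<eta>\<close>.\<close>

lemma liminf_almost:
  fixes am ap :: "real ^ 2"
  assumes am: "am = vector [0, -1]" and ap: "ap = vector [0, 1]"
    and W: "\<And>y. W y = (S y * v (S y))\<^sup>2"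
    and u: "u \<in> families am ap" and \<eta>: "0 < \<eta>" "\<eta> < 1"
  shows "ennreal ((1 - \<eta>) * (4 * (1 / a - 1 / b))) \<le> Liminf (at_right 0) (\<lambda>\<epsilon>. energy W \<epsilon> (u \<epsilon>) disc)"
proof -
  have "\<forall>t. \<bar>t\<bar> > 1 \<longrightarrow> bump t = 0" by (intro allI impI bump(3)) auto
  then have "kern bump" unfolding kern_def using bump(1) by blast
  then obtain B where B: "B > 0" "\<And>t. \<bar>bump t\<bar> \<le> B" using kern_bound by blast
  \<comment> \<open>\<open>B\<close> bounds the derivative of \<open>ramp\<close>. The 20 is 2 * 2 *
    5: two products in each coefficient of \<open>R\<close> below, the 2 in \<open>f_large\<close>,
    the 5 in \<open>abs_sum_le_form\<close>.\<close>
  define \<mu>0 where "\<mu>0 = \<eta> / (20 * B)"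
  have \<mu>0: "\<mu>0 > 0" using \<eta> B by (simp add: \<mu>0_def)
  \<comment> \<open>The shift by ln 5 starts the cutoff at t = 4, where \<open>v_large\<close>
    becomes available; it is 1 at both wells, which have t = 1.\<close>
  define l where "l t = \<mu>0 * (ln (1 + t) - ln 5)" for t :: real
  define c where "c t = 1 - ramp (l t)" for t
  define c' where "c' t = - (bump (l t) * (\<mu>0 / (1 + t)))" for t
  have dc: "(c has_real_derivative c' t) (at t)" if "t \<ge> 0" for t
  proof -
    have "(l has_real_derivative \<mu>0 / (1 + t)) (at t)"
      unfolding l_def[abs_def] using that by (auto intro!: derivative_eq_intros)
    from DERIV_diff[OF DERIV_const[of 1] DERIV_chain2[OF ramp(1) this]]
    show ?thesis by (simp add: c_def[abs_def] c'_def)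
  qed
  have c01: "0 \<le> c t" "c t \<le> 1" for t by (auto simp: c_def ramp)
  have c4: "c t = 1" "c' t = 0" if "0 \<le> t" "t \<le> 4" for t
  proof -
    have "l t \<le> 0" using that \<mu>0 by (auto simp: l_def mult_le_0_iff)
    then show "c t = 1" "c' t = 0" by (auto simp: c_def c'_def ramp bump)
  qed
  have cbig: "c t = 0" "c' t = 0" if "t \<ge> exp (ln 5 + 1 / \<mu>0)" for t
  proof -
    have "ln (exp (ln 5 + 1 / \<mu>0)) \<le> ln (1 + t)" using that by (intro ln_mono) (auto intro: less_le_trans[OF exp_gt_zero])
    then have "\<mu>0 * (1 / \<mu>0) \<le> l t" unfolding l_def using \<mu>0 by (intro mult_left_mono) auto
    then have "1 \<le> l t" using \<mu>0 by simp
    then show "c t = 0" "c' t = 0" by (auto simp: c_def c'_def ramp bump)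
  qed
  have c'b: "20 * t * \<bar>c' t\<bar> \<le> \<eta>" if "t \<ge> 0" for t
  proof -
    have "\<bar>c' t\<bar> = \<bar>bump (l t)\<bar> * (\<mu>0 / (1 + t))" using that \<mu>0 by (simp add: c'_def abs_mult)
    also have "\<dots> \<le> B * (\<mu>0 / (1 + t))" using B that \<mu>0 by (intro mult_right_mono) auto
    finally have "20 * t * \<bar>c' t\<bar> \<le> 20 * t * (B * (\<mu>0 / (1 + t)))" using that by (intro mult_left_mono) auto
    also have "\<dots> = (20 * (B * \<mu>0)) * (t / (1 + t))" by (simp add: mult_ac)
    also have "20 * (B * \<mu>0) = \<eta>" using B(1) by (simp add: \<mu>0_def)
    also have "\<eta> * (t / (1 + t)) \<le> \<eta> * 1" using that \<eta> by (intro mult_left_mono) auto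
    finally show ?thesis by simp
  qed
  have gc: "has_grad (\<lambda>y. c (S y)) (\<lambda>y. c' (S y) * (2 * y $ 1)) (\<lambda>y. c' (S y) * (2 * y $ 2))"
    by (rule has_grad_chain_at[OF dc[OF S_nonneg] S_grad])
  define e where "e = 1 - \<eta>"
  define p where "p y = e * (c (S y) * f1 y)" for y
  define q where "q y = e * (c (S y) * f2 y)" for y
  define p1 where "p1 y = e * (c' (S y) * (2 * y $ 1) * f1 y + c (S y) * f11 y)" for y
  define p2 where "p2 y = e * (c' (S y) * (2 * y $ 2) * f1 y + c (S y) * f12 y)" for y
  define q1 where "q1 y = e * (c' (S y) * (2 * y $ 1) * f2 y + c (S y) * f21 y)" for y
  define q2 where "q2 y = e * (c' (S y) * (2 * y $ 2) * f2 y + c (S y) * f22 y)" for y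
  have gp: "has_grad p p1 p2"
    unfolding p_def by (rule has_grad_cong[OF has_grad_mult[OF has_grad_const has_grad_mult[OF gc f_grad(1)]]]) (auto simp: p1_def p2_def)
  have gq: "has_grad q q1 q2"
    unfolding q_def by (rule has_grad_cong[OF has_grad_mult[OF has_grad_const has_grad_mult[OF gc f_grad(2)]]]) (auto simp: q1_def q2_def)
  have cS: "continuous_on UNIV S" using has_grad_continuous[OF S_grad] .
  have cl: "continuous_on UNIV (\<lambda>y. l (S y))" unfolding l_def
  proof (intro continuous_intros cS ballI)
    show "1 + S y \<noteq> 0" for y using S_nonneg[of y] by simp
  qed
  have ccS: "continuous_on UNIV (\<lambda>y. c (S y))" using has_grad_continuous[OF gc] .
  have cc'S: "continuous_on UNIV (\<lambda>y. c' (S y))" unfolding c'_def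
  proof (intro continuous_intros cS ballI)
    show "continuous_on UNIV (\<lambda>y. bump (l (S y)))"
      by (rule continuous_on_compose2[OF smooth_continuous[OF bump(1)] cl]) auto
    show "1 + S y \<noteq> 0" for y using S_nonneg[of y] by simp
  qed
  have cv: "continuous_on UNIV (\<lambda>y. v (S y))" "continuous_on UNIV (\<lambda>y. Q (S y))"
    "continuous_on UNIV (\<lambda>y. v' (S y))" "continuous_on UNIV (\<lambda>y. Q' (S y))"
    unfolding v_def Q_def v'_def Q'_def using ab by (auto intro!: continuous_intros cS)
  have cf: "continuous_on UNIV f1" "continuous_on UNIV f2" using has_grad_continuous[OF f_grad(1)] has_grad_continuous[OF f_grad(2)] by auto
  have cff: "continuous_on UNIV f11" "continuous_on UNIV f12" "continuous_on UNIV f21" "continuous_on UNIV f22"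
    unfolding f11_def f12_def f21_def f22_def by (intro continuous_intros cv)+
  have cp: "continuous_on UNIV p1" "continuous_on UNIV p2" "continuous_on UNIV q1" "continuous_on UNIV q2"
    unfolding p1_def p2_def q1_def q2_def by (intro continuous_intros ccS cc'S cf cff)+
  define T where "T = exp (ln 5 + 1 / \<mu>0)"
  have zT: "c (S y) = 0" "c' (S y) = 0" if "norm y > T" for y
  proof -
    have "T \<ge> 1" using \<mu>0 by (simp add: T_def)
    then have "norm y * 1 \<le> norm y * norm y" using that by (intro mult_left_mono) auto
    then have "T \<le> S y" using that by (simp add: S_norm power2_eq_square)
    then show "c (S y) = 0" "c' (S y) = 0" unfolding T_def by (auto intro: cbig)
  qed
  have z: "p1 y = 0" "p2 y = 0" "q1 y = 0" "q2 y = 0" if "norm y > T" for y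
    using zT[OF that] by (auto simp: p1_def p2_def q1_def q2_def)
  obtain C1 C2 C3 C4 where C: "\<And>y. \<bar>p1 y\<bar> \<le> C1" "\<And>y. \<bar>p2 y\<bar> \<le> C2" "\<And>y. \<bar>q1 y\<bar> \<le> C3" "\<And>y. \<bar>q2 y\<bar> \<le> C4"
    using bounded_compact_support[OF cp(1) z(1)] bounded_compact_support[OF cp(2) z(2)]
      bounded_compact_support[OF cp(3) z(3)] bounded_compact_support[OF cp(4) z(4)] by blast
  \<comment> \<open>The summand 4 serves the growth condition S y \<le> 4 (1 + W y).\<close>
  define C where "C = \<bar>C1\<bar> + \<bar>C2\<bar> + \<bar>C3\<bar> + \<bar>C4\<bar> + 4"
  have key: "\<bar>(p1 y - q2 y) / 2 * (A11 - A22) + p2 y * A21 + q1 y * A12\<bar> \<le> \<bar>S y * v (S y)\<bar> * sqrt (form A11 A12 A21 A22)" for y A11 A12 A21 A22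
  proof -
    define L where "L = (f11 y - f22 y) / 2 * (A11 - A22) + f12 y * A21 + f21 y * A12"
    define R where "R = (y $ 1 * f1 y - y $ 2 * f2 y) * (A11 - A22) + 2 * (y $ 2 * f1 y) * A21 + 2 * (y $ 1 * f2 y) * A12"
    define X where "X = \<bar>S y * v (S y)\<bar> * sqrt (form A11 A12 A21 A22)"
    have form0: "0 \<le> form A11 A12 A21 A22"
      by (rule form_nonneg)
    have X0: "X \<ge> 0" using form0 by (simp add: X_def)
    have eq: "(p1 y - q2 y) / 2 * (A11 - A22) + p2 y * A21 + q1 y * A12 = e * (c (S y) * L) + e * (c' (S y) * R)"
      by (simp add: p1_def p2_def q1_def q2_def L_def R_def field_simps)
    have "\<bar>L\<bar> \<le> X" unfolding L_def X_def by (rule base_bound)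
    then have "\<bar>c (S y) * L\<bar> \<le> 1 * X"
      unfolding abs_mult[of "c (S y)"] using c01 by (intro mult_mono) auto
    have e01: "0 \<le> e" "e \<le> 1" using \<eta> by (auto simp: e_def)
    have em: "\<bar>e * t\<bar> \<le> e * M" if "\<bar>t\<bar> \<le> M" for t M
      using mult_left_mono[OF that e01(1)] e01(1) by (simp add: abs_mult)
    have 1: "\<bar>e * (c (S y) * L)\<bar> \<le> e * X"
      by (rule em) (use \<open>\<bar>c (S y) * L\<bar> \<le> 1 * X\<close> in simp)
    have "\<bar>c' (S y) * R\<bar> \<le> \<eta> * X"
    proof (cases "S y \<le> 4")
      case True
      then show ?thesis using c4(2)[of "S y"] S_nonneg X0 \<eta> by simp
    next
      case False
      define K where "K = 2 * (S y)\<^sup>2 * \<bar>v (S y)\<bar>"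
      have K0: "K \<ge> 0" by (simp add: K_def)
      have f: "\<bar>y $ 1 * f1 y\<bar> \<le> K" "\<bar>y $ 2 * f1 y\<bar> \<le> K" "\<bar>y $ 1 * f2 y\<bar> \<le> K" "\<bar>y $ 2 * f2 y\<bar> \<le> K"
        using f_large[of y] False unfolding K_def by auto
      have "\<bar>(y $ 1 * f1 y - y $ 2 * f2 y) * (A11 - A22)\<bar> \<le> 2 * K * \<bar>A11 - A22\<bar>"
        "\<bar>2 * (y $ 2 * f1 y) * A21\<bar> \<le> 2 * K * \<bar>A21\<bar>" "\<bar>2 * (y $ 1 * f2 y) * A12\<bar> \<le> 2 * K * \<bar>A12\<bar>"
        unfolding abs_mult[of _ "A11 - A22"] abs_mult[of _ A21] abs_mult[of _ A12]
        using f by (intro mult_right_mono; simp)+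
      then have "\<bar>R\<bar> \<le> 2 * K * (\<bar>A11 - A22\<bar> + \<bar>A21\<bar> + \<bar>A12\<bar>)"
        unfolding R_def distrib_left by linarith
      also have "\<dots> \<le> 2 * K * (5 * sqrt (form A11 A12 A21 A22))" using K0 by (intro mult_left_mono abs_sum_le_form) auto
      also have "\<dots> = 20 * S y * X" using S_nonneg[of y] by (simp add: K_def X_def power2_eq_square abs_mult)
      finally have "\<bar>c' (S y)\<bar> * \<bar>R\<bar> \<le> \<bar>c' (S y)\<bar> * (20 * S y * X)" by (intro mult_left_mono) auto
      also have "\<dots> = (20 * S y * \<bar>c' (S y)\<bar>) * X" by simp
      also have "\<dots> \<le> \<eta> * X" using c'b[OF S_nonneg] X0 by (intro mult_right_mono) auto
      finally show ?thesis by (simp add: abs_mult)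
    qed
    then have "\<bar>e * (c' (S y) * R)\<bar> \<le> e * (\<eta> * X)" by (rule em)
    also have "\<dots> \<le> 1 * (\<eta> * X)" using e01 X0 \<eta> by (intro mult_right_mono) auto
    finally have 2: "\<bar>e * (c' (S y) * R)\<bar> \<le> \<eta> * X" by simp
    have "\<bar>e * (c (S y) * L) + e * (c' (S y) * R)\<bar> \<le> e * X + \<eta> * X" using 1 2 by linarith
    also have "\<dots> = X" by (simp add: e_def algebra_simps)
    finally show ?thesis unfolding eq X_def .
  qed
  interpret calibration p p1 p2 q q1 q2 W UNIV \<kappa> C
  proof
    show "W \<in> borel_measurable borel"
      unfolding W[abs_def] by (intro borel_measurable_continuous_onI continuous_intros cS cv)
    show "0 \<le> \<kappa>" "\<kappa> \<le> 1" using kappa by auto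
    fix y :: "real ^ 2"
    show "\<bar>p1 y\<bar> \<le> C" "\<bar>p2 y\<bar> \<le> C" "\<bar>q1 y\<bar> \<le> C" "\<bar>q2 y\<bar> \<le> C"
      using C[of y] unfolding C_def by linarith+
    show W0: "0 \<le> W y" by (simp add: W)
    have y1: "(y $ 1)\<^sup>2 \<le> S y" by (simp add: S_def power2_eq_square)
    have "S y \<le> 4 * (1 + W y)"
    proof (cases "S y \<le> 4")
      case False
      have "S y * 1 \<le> \<bar>S y\<bar> * \<bar>v (S y)\<bar>" using v_large[of "S y"] False by (intro mult_mono) auto
      then have le: "S y \<le> \<bar>S y * v (S y)\<bar>" using False by (simp add: abs_mult)
      then have "1 \<le> \<bar>S y * v (S y)\<bar>" using False by linarith
      with le have "S y * 1 \<le> \<bar>S y * v (S y)\<bar> * \<bar>S y * v (S y)\<bar>" by (intro mult_mono) auto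
      also have "\<dots> = W y" by (simp add: W power2_eq_square)
      finally show ?thesis using W0 by simp
    qed (use W0 in simp)
    also have "\<dots> \<le> C * (1 + W y)" using W0 by (intro mult_right_mono) (auto simp: C_def)
    finally show "(y $ 1)\<^sup>2 \<le> C * (1 + W y)" using y1 by simp
    fix \<epsilon> A11 A12 A21 A22 :: real assume \<epsilon>: "0 < \<epsilon>"
    define F where "F = form A11 A12 A21 A22"
    define w where "w = \<bar>S y * v (S y)\<bar>"
    have F0: "0 \<le> F"
      unfolding F_def by (rule form_nonneg)
    have "0 \<le> (sqrt \<epsilon> * sqrt F - w / sqrt \<epsilon>)\<^sup>2" by simp
    also have "\<dots> = \<epsilon> * F + W y / \<epsilon> - 2 * (w * sqrt F)"
      using \<epsilon> F0 by (simp add: power2_diff power_mult_distrib power_divide W w_def)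
    finally have am: "w * sqrt F \<le> (\<epsilon> * F + W y / \<epsilon>) / 2" by simp
    have "p1 y * A11 + p2 y * A21 + q1 y * A12 + q2 y * A22 = (p1 y + q2 y) / 2 * (A11 + A22) +
      ((p1 y - q2 y) / 2 * (A11 - A22) + p2 y * A21 + q1 y * A12)" by (simp add: field_simps)
    also have "\<dots> \<le> (p1 y + q2 y) / 2 * (A11 + A22) + w * sqrt F"
      using key[of y A11 A22 A21 A12] by (intro add_left_mono) (simp add: w_def F_def abs_le_iff)
    also have "\<dots> \<le> (p1 y + q2 y) / 2 * (A11 + A22) + (\<epsilon> * F + W y / \<epsilon>) / 2" using am by (intro add_left_mono)
    finally show "p1 y * A11 + p2 y * A21 + q1 y * A12 + q2 y * A22 \<le> (p1 y + q2 y) / 2 * (A11 + A22) +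
        (\<epsilon> * (A11\<^sup>2 + A12\<^sup>2 + A21\<^sup>2 + A22\<^sup>2 - 2 * \<kappa> * (A11 * A22 - A12 * A21)) + W y / \<epsilon>) / 2"
      by (simp add: F_def form_def)
  qed (use gp gq cp in auto)
  have vv: "ap $ 1 = 0" "ap $ 2 = 1" "am $ 1 = 0" "am $ 2 = - 1" by (simp_all add: am ap)
  have "2 * (p ap - p am) = (1 - \<eta>) * (4 * (1 / a - 1 / b))"
    using c4(1)[of 1] by (simp add: p_def f1_def S_def vv Q_def e_def algebra_simps)
  then show ?thesis using liminf_lower[OF u] by simp
qed

theorem liminf_radial_well:
  fixes am ap :: "real ^ 2"
  assumes am: "am = vector [0, -1]" and ap: "ap = vector [0, 1]"
    and W: "\<And>y. W y = (S y * v (S y))\<^sup>2" and u: "u \<in> families am ap"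
  shows "ennreal (4 * (1 / a - 1 / b)) \<le> Liminf (at_right 0) (\<lambda>\<epsilon>. energy W \<epsilon> (u \<epsilon>) disc)" (is "_ \<le> ?L")
proof (rule ccontr)
  define X where "X = 4 * (1 / a - 1 / b)"
  assume "\<not> ?thesis"
  then have lt: "?L < ennreal X" by (simp add: X_def)
  then have "?L < \<infinity>" by (auto intro: less_le_trans)
  then obtain l where l: "?L = ennreal l" "l \<ge> 0" by (cases ?L) auto
  with lt have lX: "l < X" by (simp add: ennreal_less_iff)
  \<comment> \<open>With this loss, (1 - \<eta>) X is the mean of \<open>X\<close> and
    \<open>l\<close>, hence still above \<open>l\<close>.\<close>
  define \<eta> where "\<eta> = (X - l) / (2 * X)"
  have X: "X > 0" using lX l by simp
  have \<eta>: "0 < \<eta>" "\<eta> < 1" using lX l X by (auto simp: \<eta>_def divide_less_eq)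
  have "ennreal ((1 - \<eta>) * X) \<le> ennreal l"
    using liminf_almost[OF am ap W u \<eta>] l unfolding X_def by simp
  then have "(1 - \<eta>) * X \<le> l" using l by (simp add: ennreal_le_iff)
  moreover have "(1 - \<eta>) * X = (X + l) / 2" using X by (simp add: \<eta>_def field_simps)
  ultimately show False using lX by simp
qed

end

subsection \<open>Uniqueness of weak derivatives\<close>

lemma mconv_cutoff:
  assumes "norm x + 2 / real (Suc n) \<le> R"
  shows "mconv n (\<lambda>y. indicator (cball 0 R) y * f y) x = mconv n f x"
  unfolding mconv_eq
proof (intro Bochner_Integration.integral_cong refl)
  fix y :: "real ^ 2"
  show "indicator (cball 0 R) y * f y * moll2 n (x - y) = f y * moll2 n (x - y)"
  proof (cases "norm y \<le> R")
    case False
    have "norm y \<le> norm x + norm (x - y)" using norm_triangle_ineq[of x "y - x"] by (simp add: norm_minus_commute)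
    then have "norm (x - y) > 2 / real (Suc n)" using assms False by linarith
    then have "moll2 n (x - y) = 0" by (rule moll2(2))
    then show ?thesis by simp
  qed (simp add: indicator_def)
qed

text \<open>Both functions are integrable only on smaller discs, so their difference is cut off at a
  radius \<open>R\<close> between \<open>r\<close> and 1. Once the kernel is narrower than R - r,
  the mollified difference vanishes on the disc of radius \<open>r\<close>, while it converges to
  the difference in L1.\<close>

lemma AE_eq_of_mconv_eq:
  fixes h k :: "real ^ 2 \<Rightarrow> real"
  assumes eq: "\<And>n x. norm x + 2 / real (Suc n) < 1 \<Longrightarrow> mconv n h x = mconv n k x"
    and ih: "\<And>R. R < 1 \<Longrightarrow> integrable lborel (\<lambda>x. indicator (cball 0 R) x * h x)"
    and ik: "\<And>R. R < 1 \<Longrightarrow> integrable lborel (\<lambda>x. indicator (cball 0 R) x * k x)"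
  shows "AE x in lborel. x \<in> disc \<longrightarrow> h x = k x"
proof -
  have *: "AE x in lborel. norm x \<le> r \<longrightarrow> h x = k x" if r: "r < 1" for r
  proof -
    define R where "R = (1 + r) / 2"
    have R: "r < R" "R < 1" using r by (auto simp: R_def)
    define d where "d x = indicator (cball 0 R) x * h x - indicator (cball 0 R) x * k x" for x
    have d: "integrable lborel d" unfolding d_def using ih[OF R(2)] ik[OF R(2)] by simp
    then have [measurable]: "d \<in> borel_measurable borel" by auto
    have "LpN 1 d < \<infinity>"
    proof -
      have "LpN 1 d = (\<integral>\<^sup>+x. ennreal (norm (d x)) \<partial>lborel)" by (simp add: LpN_def)
      then show ?thesis using d unfolding integrable_iff_bounded by simp
    qed
    then have lim: "(\<lambda>n. LpN 1 (\<lambda>x. mconv n d x - d x)) \<longlonglongrightarrow> 0" using d by (intro mconv_tendsto) auto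
    have "(\<lambda>n. 2 * (1 / real (Suc n))) \<longlonglongrightarrow> 2 * 0"
      using LIMSEQ_inverse_real_of_nat unfolding inverse_eq_divide by (intro tendsto_mult tendsto_const)
    then have "\<forall>\<^sub>F n in sequentially. 2 * (1 / real (Suc n)) < R - r"
      using R by (intro order_tendstoD(2)) auto
    then have "\<forall>\<^sub>F n in sequentially. (\<integral>\<^sup>+x. ennreal \<bar>d x\<bar> * indicator (cball 0 r) x \<partial>lborel)
        \<le> LpN 1 (\<lambda>x. mconv n d x - d x)"
    proof eventually_elim
      case (elim n)
      have "mconv n d x = 0" if x: "norm x \<le> r" for x
      proof -
        have n: "norm x + 2 / real (Suc n) \<le> R" "norm x + 2 / real (Suc n) < 1" using x elim R by auto
        have "mconv n d x = mconv n (\<lambda>x. indicator (cball 0 R) x * h x) x - mconv n (\<lambda>x. indicator (cball 0 R) x * k x) x"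
          unfolding mconv_eq d_def left_diff_distrib
          using mconv_integrable[OF ih[OF R(2)]] mconv_integrable[OF ik[OF R(2)]]
          by (rule Bochner_Integration.integral_diff)
        then show ?thesis unfolding mconv_cutoff[OF n(1)] using eq[OF n(2)] by simp
      qed
      then show ?case unfolding LpN_def by (intro nn_integral_mono) (auto simp: indicator_def)
    qed
    then have "(\<integral>\<^sup>+x. ennreal \<bar>d x\<bar> * indicator (cball 0 r) x \<partial>lborel) \<le> 0"
      using lim by (intro tendsto_lowerbound[OF lim]) auto
    moreover have "(\<lambda>x. ennreal \<bar>d x\<bar> * indicator (cball 0 r) x) \<in> borel_measurable lborel"
      by (intro borel_measurable_times_ennreal borel_measurable_indicator) auto
    ultimately have "AE x in lborel. ennreal \<bar>d x\<bar> * indicator (cball 0 r) x = 0"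
      by (simp add: nn_integral_0_iff_AE)
    then show ?thesis
    proof eventually_elim
      case (elim x)
      show ?case
      proof
        assume "norm x \<le> r"
        with elim R show "h x = k x" by (auto simp: d_def indicator_def)
      qed
    qed
  qed
  have "AE x in lborel. \<forall>n. norm x \<le> 1 - 1 / real (Suc n) \<longrightarrow> h x = k x"
    unfolding AE_all_countable by (intro allI *) simp
  then show ?thesis
  proof eventually_elim
    case (elim x)
    show ?case
    proof
      assume "x \<in> disc"
      then have "1 - norm x > 0" by simp
      then obtain n where "inverse (real (Suc n)) < 1 - norm x" using reals_Archimedean by blast
      then show "h x = k x" using elim by (auto simp: inverse_eq_divide dest!: spec[of _ n])
    qed
  qed
qed

text \<open>Mollification determines a weak gradient: by \<open>mconv_weak_grad\<close> the
  mollified gradient depends on the function alone. The result identifies the value chosen by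
  \<open>weak_deriv\<close> with a classical derivative, as the upper bound requires.\<close>

lemma has_weak_deriv_unique:
  fixes v :: "real ^ 2 \<Rightarrow> real ^ 2"
  assumes G: "has_weak_deriv v G disc" and H: "has_weak_deriv v H disc"
  shows "AE x in lebesgue_on disc. G x = H x"
proof -
  have meas: "(\<lambda>x. v x $ i) \<in> borel_measurable (lebesgue_on disc)"
    "(\<lambda>x. F x $ i $ j) \<in> borel_measurable (lebesgue_on disc)" if "has_weak_deriv v F disc" for F i j
    using that unfolding has_weak_deriv_def
    by (intro borel_measurable_vec_nth borel_measurable_locally_integrable; blast)+
  have rep: "\<exists>g. g \<in> borel_measurable borel \<and> (\<forall>x. x \<notin> disc \<longrightarrow> g x = 0) \<and> (AE x in lebesgue_on disc. F x $ i $ j = g x)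
     \<and> (\<forall>R<1. integrable lborel (\<lambda>x. indicator (cball 0 R) x * g x))" if F: "has_weak_deriv v F disc" for F i j
  proof -
    obtain g where g: "g \<in> borel_measurable borel" "\<And>x. x \<notin> disc \<Longrightarrow> g x = 0" "AE x in lebesgue_on disc. F x $ i $ j = g x"
      using borel_representative[OF meas(2)[OF F, of i j]] by blast
    note [measurable] = g(1)
    have "integrable lborel (\<lambda>x. indicator (cball 0 R) x * g x)" if R: "R < 1" for R
    proof -
      have "cball 0 R \<subseteq> disc" using R by auto
      moreover have "F locally_integrable_on disc" using F by (simp add: has_weak_deriv_def)
      ultimately have "F absolutely_integrable_on cball 0 R" by (simp add: locally_integrable_on_def)
      then have "integrable lebesgue (\<lambda>x. indicator (cball 0 R) x *\<^sub>R F x)" by (simp add: set_integrable_def)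
      then have "(\<integral>\<^sup>+x. ennreal (norm (indicator (cball 0 R) x *\<^sub>R F x)) \<partial>lebesgue) < \<infinity>"
        by (simp add: integrable_iff_bounded)
      moreover have "(\<integral>\<^sup>+x. ennreal \<bar>indicator (cball 0 R) x * g x\<bar> \<partial>lebesgue)
        \<le> (\<integral>\<^sup>+x. ennreal (norm (indicator (cball 0 R) x *\<^sub>R F x)) \<partial>lebesgue)"
      proof (rule nn_integral_mono_AE)
        have "AE x in lebesgue. x \<in> disc \<longrightarrow> F x $ i $ j = g x"
          using g(3) by (subst (asm) AE_restrict_space_iff) auto
        then show "AE x in lebesgue. ennreal \<bar>indicator (cball 0 R) x * g x\<bar> \<le> ennreal (norm (indicator (cball 0 R) x *\<^sub>R F x))"
        proof eventually_elim
          case (elim x)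
          show ?case
          proof (cases "x \<in> cball 0 R")
            case True
            then have "g x = F x $ i $ j" using elim R by auto
            also have "\<bar>\<dots>\<bar> \<le> norm (F x $ i)" by (rule component_le_norm_cart)
            also have "\<dots> \<le> norm (F x)" by (rule Finite_Cartesian_Product.norm_nth_le)
            finally show ?thesis using True by (intro ennreal_leI) simp
          qed simp
        qed
      qed
      ultimately have "(\<integral>\<^sup>+x. ennreal \<bar>indicator (cball 0 R) x * g x\<bar> \<partial>lebesgue) < \<infinity>" by (rule le_less_trans[rotated])
      then have "(\<integral>\<^sup>+x. ennreal \<bar>indicator (cball 0 R) x * g x\<bar> \<partial>lborel) < \<infinity>"
        by (subst (asm) nn_integral_completion) auto
      moreover have "(\<lambda>x. indicator (cball 0 R) x * g x) \<in> borel_measurable lborel"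
        using g(1) by (intro borel_measurable_times borel_measurable_indicator) auto
      ultimately show ?thesis by (simp add: integrable_iff_bounded)
    qed
    with g show ?thesis by (intro exI[of _ g] conjI) auto
  qed
  have comp: "AE x in lebesgue_on disc. G x $ i $ 1 = H x $ i $ 1 \<and> G x $ i $ 2 = H x $ i $ 2" for i
  proof -
    obtain f where f: "f \<in> borel_measurable borel" "\<And>x. x \<notin> disc \<Longrightarrow> f x = 0" "AE x in lebesgue_on disc. v x $ i = f x"
      using borel_representative[OF meas(1)[OF G, of i]] by blast
    obtain g1 where g1: "g1 \<in> borel_measurable borel" "\<And>x. x \<notin> disc \<Longrightarrow> g1 x = 0" "AE x in lebesgue_on disc. G x $ i $ 1 = g1 x"
      "\<And>R. R < 1 \<Longrightarrow> integrable lborel (\<lambda>x. indicator (cball 0 R) x * g1 x)" using rep[OF G, of i 1] by blast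
    obtain g2 where g2: "g2 \<in> borel_measurable borel" "\<And>x. x \<notin> disc \<Longrightarrow> g2 x = 0" "AE x in lebesgue_on disc. G x $ i $ 2 = g2 x"
      "\<And>R. R < 1 \<Longrightarrow> integrable lborel (\<lambda>x. indicator (cball 0 R) x * g2 x)" using rep[OF G, of i 2] by blast
    obtain h1 where h1: "h1 \<in> borel_measurable borel" "\<And>x. x \<notin> disc \<Longrightarrow> h1 x = 0" "AE x in lebesgue_on disc. H x $ i $ 1 = h1 x"
      "\<And>R. R < 1 \<Longrightarrow> integrable lborel (\<lambda>x. indicator (cball 0 R) x * h1 x)" using rep[OF H, of i 1] by blast
    obtain h2 where h2: "h2 \<in> borel_measurable borel" "\<And>x. x \<notin> disc \<Longrightarrow> h2 x = 0" "AE x in lebesgue_on disc. H x $ i $ 2 = h2 x"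
      "\<And>R. R < 1 \<Longrightarrow> integrable lborel (\<lambda>x. indicator (cball 0 R) x * h2 x)" using rep[OF H, of i 2] by blast
    have wg: "weak_grad f g1 g2"
      by (rule weak_grad_representative[OF G f(1) g1(1) g2(1) f(2) g1(2) g2(2) f(3) g1(3) g2(3)])
    have wh: "weak_grad f h1 h2"
      by (rule weak_grad_representative[OF H f(1) h1(1) h2(1) f(2) h1(2) h2(2) f(3) h1(3) h2(3)])
    have eq: "mconv n g1 x = mconv n h1 x" "mconv n g2 x = mconv n h2 x" if "norm x + 2 / real (Suc n) < 1" for n x
      using mconv_weak_grad[OF wg that] mconv_weak_grad[OF wh that] by simp_all
    have "AE x in lborel. x \<in> disc \<longrightarrow> g1 x = h1 x"
      by (rule AE_eq_of_mconv_eq[OF eq(1) g1(4) h1(4)])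
    then have 1: "AE x in lebesgue_on disc. g1 x = h1 x" by (simp add: AE_disc)
    have "AE x in lborel. x \<in> disc \<longrightarrow> g2 x = h2 x"
      by (rule AE_eq_of_mconv_eq[OF eq(2) g2(4) h2(4)])
    then have 2: "AE x in lebesgue_on disc. g2 x = h2 x" by (simp add: AE_disc)
    from 1 2 g1(3) g2(3) h1(3) h2(3) show ?thesis by eventually_elim simp
  qed
  from comp[of 1] comp[of 2] show ?thesis
    by eventually_elim (simp add: vec_eq_iff forall_2)
qed

section \<open>Weak derivatives of continuously differentiable fields\<close>

lemma has_weak_deriv_C1:
  fixes u :: "real ^ 2 \<Rightarrow> real ^ 2"
  assumes g: "\<And>i. has_grad (\<lambda>x. u x $ i) (\<lambda>x. G x $ i $ 1) (\<lambda>x. G x $ i $ 2)"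
    and cu: "continuous_on UNIV u" and cG: "continuous_on UNIV G"
  shows "has_weak_deriv u G disc"
proof -
  have li: "f locally_integrable_on disc" if "continuous_on UNIV f" for f :: "real ^ 2 \<Rightarrow> 'a::euclidean_space"
    unfolding locally_integrable_on_def set_integrable_def
  proof (intro allI impI)
    fix K :: "(real ^ 2) set" assume "compact K \<and> K \<subseteq> disc"
    then have "integrable lborel (\<lambda>x. indicator K x *\<^sub>R f x)"
      by (intro borel_integrable_compact continuous_on_subset[OF that]) auto
    then show "integrable lebesgue (\<lambda>x. indicator K x *\<^sub>R f x)"
      by (subst integrable_completion) auto
  qed
  have "(\<integral>x. u x $ i * frechet_derivative \<phi> (at x) (axis j 1) \<partial>lebesgue_on disc) =
        - (\<integral>x. G x $ i $ j * \<phi> x \<partial>lebesgue_on disc)" if \<phi>: "\<phi> \<in> test_functions disc" for \<phi> i j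
  proof -
    define D where "D j x = frechet_derivative \<phi> (at x) (axis j 1)" for j x
    have "C_k (Suc 0) \<phi>" using \<phi> unfolding test_functions_def by blast
    then have d: "\<And>x. \<phi> differentiable at x" and cD: "\<And>j. continuous_on UNIV (D j)"
      by (auto simp: D_def[abs_def])
    have grad: "has_grad \<phi> (D 1) (D 2)"
      unfolding has_grad_def
    proof
      fix x
      have h: "(\<phi> has_derivative frechet_derivative \<phi> (at x)) (at x)" using d by (simp add: frechet_derivative_works)
      then have lin: "linear (frechet_derivative \<phi> (at x))" by (rule has_derivative_linear)
      have "frechet_derivative \<phi> (at x) = (\<lambda>k. D 1 x * k $ 1 + D 2 x * k $ 2)"
      proof
        fix k :: "real ^ 2"
        have "k = k $ 1 *\<^sub>R axis 1 1 + k $ 2 *\<^sub>R axis 2 1" by (simp add: vec_eq_iff forall_2 axis_def)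
        then have "frechet_derivative \<phi> (at x) k = frechet_derivative \<phi> (at x) (k $ 1 *\<^sub>R axis 1 1 + k $ 2 *\<^sub>R axis 2 1)" by simp
        also have "\<dots> = D 1 x * k $ 1 + D 2 x * k $ 2"
          by (simp add: linear_add[OF lin] linear_scale[OF lin] D_def)
        finally show "frechet_derivative \<phi> (at x) k = D 1 x * k $ 1 + D 2 x * k $ 2" .
      qed
      with h show "(\<phi> has_derivative (\<lambda>k. D 1 x * k $ 1 + D 2 x * k $ 2)) (at x)" by simp
    qed
    define S where "S = closure {x. \<phi> x \<noteq> 0}"
    have S: "compact S" "S \<subseteq> disc" using \<phi> by (auto simp: test_functions_def S_def)
    \<comment> \<open>The norm attains its maximum on the compact support, which lies in the open
      disc; an empty support is treated separately.\<close>
    obtain R where R: "R < 1" "\<And>x. norm x > R \<Longrightarrow> \<phi> x = 0"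
    proof (cases "S = {}")
      case True
      then have "\<phi> x = 0" for x using closure_subset[of "{x. \<phi> x \<noteq> 0}"] by (auto simp: S_def)
      then show ?thesis using that[of 0] by simp
    next
      case False
      obtain z where z: "z \<in> S" "\<And>y. y \<in> S \<Longrightarrow> norm y \<le> norm z"
        using continuous_attains_sup[OF S(1) False continuous_on_norm_id] by auto
      have "\<phi> x = 0" if "norm x > norm z" for x
        using z(2)[of x] that closure_subset[of "{x. \<phi> x \<noteq> 0}"] by (auto simp: S_def)
      then show ?thesis using that[of "norm z"] z(1) S(2) by auto
    qed
    have cui: "continuous_on UNIV (\<lambda>x. u x $ i)" and cGi: "\<And>j. continuous_on UNIV (\<lambda>x. G x $ i $ j)"
      using cu cG by (auto intro!: continuous_intros)
    have c\<phi>: "continuous_on UNIV \<phi>" by (rule has_grad_continuous[OF grad])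
    have hg: "has_grad (\<lambda>x. u x $ i * \<phi> x) (\<lambda>x. G x $ i $ 1 * \<phi> x + u x $ i * D 1 x) (\<lambda>x. G x $ i $ 2 * \<phi> x + u x $ i * D 2 x)"
      using has_grad_mult[OF g[of i] grad] by (simp add: has_grad_def algebra_simps)
    have Dz: "norm x > R \<Longrightarrow> D j x = 0" for j x
      using has_grad_zero[OF grad, of R x] R(2) exhaust_2[of j] by auto
    have "(\<integral>x. G x $ i $ j * \<phi> x + u x $ i * D j x \<partial>lborel) = 0"
    proof -
      have "(\<integral>x. G x $ i $ 1 * \<phi> x + u x $ i * D 1 x \<partial>lborel) = 0"
        "(\<integral>x. G x $ i $ 2 * \<phi> x + u x $ i * D 2 x \<partial>lborel) = 0"
        using R by (auto intro!: integral_grad_zero[OF hg, of R] continuous_intros cui cGi c\<phi> cD)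
      then show ?thesis using exhaust_2[of j] by auto
    qed
    moreover have "integrable lborel (\<lambda>x. G x $ i $ j * \<phi> x)" "integrable lborel (\<lambda>x. u x $ i * D j x)"
      using R Dz by (auto intro!: integrable_compact_support[of _ R] continuous_intros cui cGi c\<phi> cD)
    ultimately have "(\<integral>x. u x $ i * D j x \<partial>lborel) = - (\<integral>x. G x $ i $ j * \<phi> x \<partial>lborel)"
      by simp
    moreover have "(\<integral>x. u x $ i * D j x \<partial>lebesgue_on disc) = (\<integral>x. u x $ i * D j x \<partial>lborel)"
      "(\<integral>x. G x $ i $ j * \<phi> x \<partial>lebesgue_on disc) = (\<integral>x. G x $ i $ j * \<phi> x \<partial>lborel)"
      using R Dz by (auto intro!: integral_disc borel_measurable_continuous_onI continuous_intros cui cGi c\<phi> cD)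
    ultimately show ?thesis by (simp add: D_def)
  qed
  then show ?thesis unfolding has_weak_deriv_def using li[OF cu] li[OF cG] by blast
qed

lemma weak_deriv_C1:
  fixes u :: "real ^ 2 \<Rightarrow> real ^ 2"
  assumes "\<And>i. has_grad (\<lambda>x. u x $ i) (\<lambda>x. G x $ i $ 1) (\<lambda>x. G x $ i $ 2)"
    and "continuous_on UNIV u" "continuous_on UNIV G"
  shows "AE x in lebesgue_on disc. weak_deriv disc u x = G x"
proof -
  have w: "has_weak_deriv u G disc" using assms by (rule has_weak_deriv_C1)
  then have "has_weak_deriv u (weak_deriv disc u) disc"
    unfolding weak_deriv_def by (rule someI[of "\<lambda>G. has_weak_deriv u G disc"])
  then show ?thesis using w by (rule has_weak_deriv_unique)
qed

subsection \<open>Transition profiles\<close>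

lemma diff_ge_of_deriv_ge:
  fixes F :: "real \<Rightarrow> real"
  assumes "\<And>x. (F has_real_derivative F' x) (at x)" "\<And>x. c \<le> F' x" "x \<le> y"
  shows "c * (y - x) \<le> F y - F x"
proof (cases "x = y")
  case False
  with assms obtain z where "F y - F x = (y - x) * F' z" using MVT2[of x y F F'] by auto
  moreover have "(y - x) * c \<le> (y - x) * F' z" using assms by (intro mult_left_mono) auto
  ultimately show ?thesis by (simp add: mult.commute)
qed simp

lemma filterlim_at_top_linear:
  assumes "\<And>x. x \<ge> 0 \<Longrightarrow> c * x \<le> (f x :: real)" "c > 0"
  shows "filterlim f at_top at_top"
proof (rule filterlim_at_top_mono)
  show "filterlim (\<lambda>x. c * x) at_top at_top"
    using assms(2) by (intro filterlim_tendsto_pos_mult_at_top[OF tendsto_const]) (auto simp: filterlim_ident)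
  show "\<forall>\<^sub>F x in at_top. c * x \<le> f x"
    using eventually_ge_at_top[of 0] by eventually_elim (rule assms(1))
qed

text \<open>Separation of variables: an antiderivative of 1 / r has slope at least 1 / M, so it is
  strictly increasing and onto, and its inverse solves the equation. Continuity of \<open>r\<close>
  is all the regularity required.\<close>

lemma autonomous_ode_solution:
  fixes r :: "real \<Rightarrow> real"
  assumes cr: "continuous_on UNIV r" and r: "\<And>x. \<eta> \<le> r x" "\<And>x. r x \<le> M" and \<eta>: "\<eta> > 0"
  obtains z where "\<And>x. (z has_real_derivative r (z x)) (at x)" "z 0 = 0"
proof -
  have rpos: "r x > 0" for x using r(1)[of x] \<eta> by linarith
  have Mpos: "M > 0" using rpos[of 0] r(2)[of 0] by linarith
  have "continuous_on UNIV (\<lambda>s. 1 / r s)"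
    using rpos by (intro continuous_intros cr) (auto simp: less_le)
  then obtain T where T: "\<And>x. (T has_real_derivative 1 / r x) (at x)" using antiderivative_exists by blast
  define F where "F x = T x - T 0" for x
  have dF: "(F has_real_derivative 1 / r x) (at x)" for x
    unfolding F_def[abs_def] using DERIV_diff[OF T DERIV_const[of "T 0"]] by simp
  have F0: "F 0 = 0" by (simp add: F_def)
  have cF: "isCont F x" for x using dF by (rule DERIV_isCont)
  have grow: "1 / M * (y - x) \<le> F y - F x" if "x \<le> y" for x y
    using dF _ that by (rule diff_ge_of_deriv_ge) (use r rpos in \<open>simp add: frac_le\<close>)
  have mono: "F x < F y" if "x < y" for x y
  proof -
    have "0 < 1 / M * (y - x)" using that Mpos by simp
    with grow[of x y] that show ?thesis by linarith
  qed
  have inj: "inj F" by (intro strict_mono_imp_inj_on strict_monoI mono)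
  have surj: "\<exists>s. F s = x" for x
  proof -
    define b where "b = M * \<bar>x\<bar>"
    have b0: "b \<ge> 0" using Mpos by (simp add: b_def)
    have "\<bar>x\<bar> \<le> F b" "F (- b) \<le> - \<bar>x\<bar>"
      using grow[of 0 b] grow[of "- b" 0] b0 Mpos F0 by (auto simp: b_def)
    then have "F (- b) \<le> x" "x \<le> F b" by linarith+
    with b0 cF show ?thesis using IVT[of F "- b" x b] by auto
  qed
  define z where "z = inv F"
  have Fz: "F (z x) = x" for x unfolding z_def using surj by (intro f_inv_into_f) (metis rangeI)
  have zF: "z (F x) = x" for x unfolding z_def using inj by simp
  have cz: "isCont z x" for x
    using isCont_inverse_function[of 1 "z x" z F] cF zF Fz by simp
  show thesis
  proof
    show "(z has_real_derivative r (z x)) (at x)" for x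
      using DERIV_inverse_function[of F "1 / r (z x)" z x "x - 1" "x + 1"] dF rpos[of "z x"] Fz cz
      by (simp add: less_le)
    show "z 0 = 0" using zF[of 0] F0 by simp
  qed
qed

text \<open>The substitution \<open>g = tanh \<circ> z\<close> turns the equation for \<open>g\<close> into \<open>z' = r (tanh z)\<close>, whose right-hand side
  is bounded away from zero, so that \<open>z\<close> is the inverse of an antiderivative.\<close>

lemma transition_profile:
  fixes r :: "real \<Rightarrow> real"
  assumes cr: "continuous_on UNIV r" and r: "\<And>t. \<bar>t\<bar> \<le> 1 \<Longrightarrow> \<eta> \<le> r t" "\<And>t. \<bar>t\<bar> \<le> 1 \<Longrightarrow> r t \<le> M"
    and \<eta>: "\<eta> > 0"
  obtains g where "\<And>x. (g has_real_derivative (1 - (g x)\<^sup>2) * r (g x)) (at x)" "\<And>x. \<bar>g x\<bar> < 1" "g 0 = 0"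
    "(g \<longlongrightarrow> 1) at_top" "(g \<longlongrightarrow> - 1) at_bot"
proof -
  have tb: "\<bar>tanh x\<bar> < 1" for x :: real using tanh_real_lt_1[of x] tanh_real_gt_neg1[of x] by linarith
  have rt: "\<eta> \<le> r (tanh x)" "r (tanh x) \<le> M" for x using r[of "tanh x"] tb[of x] by auto
  have "continuous_on UNIV (\<lambda>x. r (tanh x))"
    by (intro continuous_on_compose2[OF cr] continuous_intros) auto
  from autonomous_ode_solution[OF this rt \<eta>] obtain z where
    z: "\<And>x. (z has_real_derivative r (tanh (z x))) (at x)" "z 0 = 0" by blast
  have lin: "\<eta> * x \<le> z x" if "x \<ge> 0" for x
    using diff_ge_of_deriv_ge[OF z(1) rt(1) that] z(2) by simp
  have lin': "z x \<le> \<eta> * x" if "x \<le> 0" for x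
    using diff_ge_of_deriv_ge[OF z(1) rt(1) that] z(2) by simp
  have top: "filterlim z at_top at_top" using lin \<eta> by (rule filterlim_at_top_linear)
  have bot: "filterlim z at_bot at_bot"
    unfolding filterlim_at_bot_mirror filterlim_uminus_at_bot
  proof (rule filterlim_at_top_linear[of \<eta>])
    show "\<eta> * x \<le> - z (- x)" if "x \<ge> 0" for x using lin'[of "- x"] that by simp
  qed (rule \<eta>)
  show thesis
  proof
    show "((\<lambda>x. tanh (z x)) has_real_derivative (1 - (tanh (z x))\<^sup>2) * r (tanh (z x))) (at x)" for x
    proof -
      have "cosh (z x) \<noteq> 0" by simp
      then show ?thesis using DERIV_chain2[OF has_field_derivative_tanh[OF _ DERIV_ident] z(1)] by simp
    qed
    show "\<bar>tanh (z x)\<bar> < 1" for x by (rule tb)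
    show "tanh (z 0) = 0" using z(2) by simp
    show "((\<lambda>x. tanh (z x)) \<longlongrightarrow> 1) at_top" by (rule filterlim_compose[OF tanh_real_at_top top])
    show "((\<lambda>x. tanh (z x)) \<longlongrightarrow> - 1) at_bot" by (rule filterlim_compose[OF tanh_real_at_bot bot])
  qed
qed

section \<open>One-dimensional transition fields\<close>

lemma nn_integral_disc_const: "(\<integral>\<^sup>+x. c \<partial>lebesgue_on disc) = c * ennreal area"
proof -
  have "(\<integral>\<^sup>+x. c \<partial>lebesgue_on disc) = (\<integral>\<^sup>+x. c * indicator disc x \<partial>lborel)"
    by (rule nn_integral_disc) simp
  also have "\<dots> = c * emeasure lborel disc" by (rule nn_integral_cmult_indicator) simp
  finally show ?thesis by (simp only: emeasure_disc)
qed

lemma Lp_2_continuous: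
  fixes f :: "real ^ 2 \<Rightarrow> 'a::euclidean_space"
  assumes c: "continuous_on UNIV f"
  shows "f \<in> Lp 2 disc"
proof -
  have "compact (f ` cball 0 1)" by (intro compact_continuous_image continuous_on_subset[OF c]) auto
  then obtain B where "\<forall>y\<in>f ` cball 0 1. norm y \<le> B"
    using compact_imp_bounded bounded_iff by blast
  then have B: "norm (f x) \<le> B" if "x \<in> cball 0 1" for x using that by auto
  have "(\<integral>\<^sup>+x. ennreal (norm (f x) powr 2) \<partial>lebesgue_on disc) \<le> (\<integral>\<^sup>+x. ennreal (B\<^sup>2) \<partial>lebesgue_on disc)"
  proof (intro nn_integral_mono ennreal_leI)
    fix x assume "x \<in> space (lebesgue_on disc)"
    then have "norm (f x) \<le> B" by (intro B) auto
    then show "norm (f x) powr 2 \<le> B\<^sup>2" unfolding powr_2 by (intro power_mono) auto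
  qed
  also have "\<dots> < \<infinity>" unfolding nn_integral_disc_const by (simp add: ennreal_mult_less_top)
  finally have "Lp_norm 2 disc f < \<infinity>" by (simp only: Lp_norm_finite_iff)
  moreover have "f \<in> borel_measurable (lebesgue_on disc)"
    by (intro measurable_restrict_space1 measurable_completion) (simp add: borel_measurable_continuous_onI c)
  ultimately show ?thesis by (simp add: Lp_def)
qed

lemma norm_vec2_0: "norm (vec2 0 t) = \<bar>t\<bar>"
proof (rule power2_eq_imp_eq)
  show "(norm (vec2 0 t))\<^sup>2 = \<bar>t\<bar>\<^sup>2" by (simp add: norm_vec2_sq)
qed auto

text \<open>\<open>v\<close> is a speed for the profile that may exceed the root of \<open>W\<close>
  on the segment between the wells; this slack admits a perturbed potential. The increment of
  \<open>V\<close> over [-1, 1] is the resulting transition cost.\<close>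

locale transition =
  fixes g v V :: "real \<Rightarrow> real" and W :: "real ^ 2 \<Rightarrow> real"
  assumes g: "\<And>x. (g has_real_derivative v (g x)) (at x)" "\<And>x. \<bar>g x\<bar> < 1" "g 0 = 0"
    "(g \<longlongrightarrow> 1) at_top" "(g \<longlongrightarrow> - 1) at_bot"
    and cv: "continuous_on UNIV v" and v0: "\<And>t. \<bar>t\<bar> \<le> 1 \<Longrightarrow> 0 \<le> v t"
    and V: "\<And>t. (V has_real_derivative v t) (at t)"
    and W: "\<And>t. \<bar>t\<bar> \<le> 1 \<Longrightarrow> W (vec2 0 t) \<le> (v t)\<^sup>2"
begin

definition u :: "real \<Rightarrow> real ^ 2 \<Rightarrow> real ^ 2" where
  "u \<epsilon> x = vec2 0 (g (x $ 1 / \<epsilon>))"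

definition Du :: "real \<Rightarrow> real ^ 2 \<Rightarrow> real ^ 2 ^ 2" where
  "Du \<epsilon> x = (\<chi> i j. if i = 2 \<and> j = 1 then v (g (x $ 1 / \<epsilon>)) / \<epsilon> else 0)"

lemma continuous_g: "continuous_on UNIV g"
  by (intro continuous_at_imp_continuous_on ballI DERIV_isCont[OF g(1)])

lemma deriv_g: "((\<lambda>s. g (s / \<epsilon>)) has_real_derivative v (g (s / \<epsilon>)) / \<epsilon>) (at s)"
  using DERIV_chain2[where f = g and g = "\<lambda>s. s / \<epsilon>" and x = s and s = UNIV,
    OF g(1) DERIV_cdivide[OF DERIV_ident]] by simp

lemma continuous_vg: "continuous_on UNIV (\<lambda>x :: real ^ 2. v (g (x $ 1 / \<epsilon>)))" if "\<epsilon> > 0"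
  using that by (intro continuous_on_compose2[OF cv] continuous_on_compose2[OF continuous_g]
    continuous_on_divide continuous_on_component continuous_on_id continuous_on_const) auto

lemma continuous_u: "continuous_on UNIV (u \<epsilon>)" "continuous_on UNIV (Du \<epsilon>)" if "\<epsilon> > 0"
proof -
  show "continuous_on UNIV (u \<epsilon>)"
    unfolding u_def[abs_def] using that
    by (intro continuous_intros continuous_on_compose2[OF continuous_g]) auto
  show "continuous_on UNIV (Du \<epsilon>)"
    unfolding Du_def[abs_def]
  proof (intro continuous_on_vec_lambda)
    fix i j :: 2
    show "continuous_on UNIV (\<lambda>x :: real ^ 2. if i = 2 \<and> j = 1 then v (g (x $ 1 / \<epsilon>)) / \<epsilon> else 0)"
      using that by (cases "i = 2 \<and> j = 1") (auto intro!: continuous_intros continuous_vg)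
  qed
qed

lemma has_grad_u: "has_grad (\<lambda>x. u \<epsilon> x $ i) (\<lambda>x. Du \<epsilon> x $ i $ 1) (\<lambda>x. Du \<epsilon> x $ i $ 2)" if "\<epsilon> > 0"
proof -
  from has_grad_chain[of "\<lambda>s. g (s / \<epsilon>)", OF deriv_g has_grad_nth(1)]
  have "has_grad (\<lambda>x. g (x $ 1 / \<epsilon>)) (\<lambda>x. v (g (x $ 1 / \<epsilon>)) / \<epsilon>) (\<lambda>_. 0)" by simp
  moreover have "i = 1 \<or> i = 2" by (rule exhaust_2)
  ultimately show ?thesis using has_grad_const[of 0] by (auto simp: u_def Du_def)
qed

lemma weak_deriv_u: "AE x in lebesgue_on disc. weak_deriv disc (u \<epsilon>) x = Du \<epsilon> x" if "\<epsilon> > 0"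
  using that by (intro weak_deriv_C1 has_grad_u continuous_u)

lemma u_W12: "u \<epsilon> \<in> W12 disc" if "\<epsilon> > 0"
  using that has_weak_deriv_C1[OF has_grad_u continuous_u] Lp_2_continuous[OF continuous_u(1)]
    Lp_2_continuous[OF continuous_u(2)] by (auto simp: W12_def)

lemma div_u: "Lp_norm s disc (weak_div disc (u \<epsilon>)) = 0" if "\<epsilon> > 0" "s > 0"
proof -
  have "(\<integral>\<^sup>+x. ennreal (norm (weak_div disc (u \<epsilon>) x) powr s) \<partial>lebesgue_on disc) = (\<integral>\<^sup>+x. 0 \<partial>lebesgue_on disc)"
    using weak_deriv_u[OF that(1)]
    by (intro nn_integral_cong_AE) (auto elim!: eventually_mono simp: weak_div_def trace_def sum_2 Du_def)
  then show ?thesis using that by (simp add: Lp_norm_def)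
qed

lemma V_mono: "V s \<le> V t" if "- 1 \<le> s" "s \<le> t" "t \<le> 1"
proof (rule DERIV_nonneg_imp_nondecreasing[OF that(2)])
  fix x assume "s \<le> x" "x \<le> t"
  then have "0 \<le> v x" using that by (intro v0) auto
  with V[of x] show "\<exists>y. (V has_real_derivative y) (at x) \<and> 0 \<le> y" by blast
qed

text \<open>Equipartition: as the profile has speed \<open>v\<close>, both parts of the density are
  at most v^2 / \<epsilon>, and their sum is the derivative of 2 V along the profile. The disc is
  enlarged to a square, whose side 2 cancels the factor 1 / 2 of the energy.\<close>

lemma energy_u:
  assumes "\<epsilon> > 0"
  shows "energy W \<epsilon> (u \<epsilon>) disc \<le> ennreal (2 * (V 1 - V (- 1)))"
proof -
  define k where "k s = 2 * (v (g (s / \<epsilon>)) * (v (g (s / \<epsilon>)) / \<epsilon>))" for s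
  have k0: "k s \<ge> 0" for s using v0 assms by (simp add: k_def)
  have ck: "continuous_on UNIV k" unfolding k_def using assms
    by (intro continuous_intros continuous_on_compose2[OF cv] continuous_on_compose2[OF continuous_g]) auto
  then have [measurable]: "k \<in> borel_measurable borel" by (rule borel_measurable_continuous_onI)
  have k1: "(\<lambda>x :: real ^ 2. k (x $ 1)) \<in> borel_measurable borel"
    by (intro borel_measurable_continuous_onI continuous_on_compose2[OF ck] continuous_intros) auto
  define K where "K = (\<integral>\<^sup>+s. ennreal (k s) * indicator {- 1..1} s \<partial>lborel)"
  have "K = ennreal (2 * V (g (1 / \<epsilon>)) - 2 * V (g (- 1 / \<epsilon>)))"
    unfolding K_def
  proof (rule nn_integral_FTC_Icc)
    fix s :: real
    from DERIV_cmult[OF DERIV_chain2[OF V deriv_g], of 2]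
    show "((\<lambda>s. 2 * V (g (s / \<epsilon>))) has_real_derivative k s) (at s)" by (simp add: k_def)
  qed (auto simp: k0)
  also have "\<dots> \<le> ennreal (2 * (V 1 - V (- 1)))"
  proof (intro ennreal_leI)
    have "V (g (1 / \<epsilon>)) \<le> V 1" "V (- 1) \<le> V (g (- 1 / \<epsilon>))"
      using g(2)[of "1 / \<epsilon>"] g(2)[of "- 1 / \<epsilon>"] by (auto intro!: V_mono)
    then show "2 * V (g (1 / \<epsilon>)) - 2 * V (g (- 1 / \<epsilon>)) \<le> 2 * (V 1 - V (- 1))" by simp
  qed
  finally have K: "K \<le> ennreal (2 * (V 1 - V (- 1)))" .
  have "(\<integral>\<^sup>+x. ennreal (\<epsilon> * (norm (weak_deriv disc (u \<epsilon>) x))\<^sup>2 + W (u \<epsilon> x) / \<epsilon>) \<partial>lebesgue_on disc)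
    \<le> (\<integral>\<^sup>+x. ennreal (k (x $ 1)) \<partial>lebesgue_on disc)"
  proof (rule nn_integral_mono_AE)
    from weak_deriv_u[OF assms]
    show "AE x in lebesgue_on disc. ennreal (\<epsilon> * (norm (weak_deriv disc (u \<epsilon>) x))\<^sup>2 + W (u \<epsilon> x) / \<epsilon>) \<le> ennreal (k (x $ 1))"
    proof eventually_elim
      case (elim x)
      define w where "w = v (g (x $ 1 / \<epsilon>))"
      have n: "(norm (Du \<epsilon> x))\<^sup>2 = (w / \<epsilon>)\<^sup>2" by (simp add: norm_mat2_sq Du_def w_def)
      have "W (u \<epsilon> x) \<le> w\<^sup>2" using W[of "g (x $ 1 / \<epsilon>)"] g(2)[of "x $ 1 / \<epsilon>"] by (simp add: u_def w_def)
      then have "W (u \<epsilon> x) / \<epsilon> \<le> w\<^sup>2 / \<epsilon>" using assms by (intro divide_right_mono) auto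
      moreover have "\<epsilon> * (w / \<epsilon>)\<^sup>2 = w\<^sup>2 / \<epsilon>" using assms by (simp add: power2_eq_square)
      moreover have "k (x $ 1) = w\<^sup>2 / \<epsilon> + w\<^sup>2 / \<epsilon>" by (simp add: k_def w_def power2_eq_square)
      ultimately show ?case unfolding elim n by (intro ennreal_leI) simp
    qed
  qed
  also have "\<dots> = (\<integral>\<^sup>+x. ennreal (k (x $ 1)) * indicator disc x \<partial>lborel)"
    using k1 by (intro nn_integral_disc) simp
  also have "\<dots> \<le> (\<integral>\<^sup>+x. ennreal (k (x $ 1)) * indicator {- 1..1} (x $ 1) * indicator {- 1..1} ((x :: real ^ 2) $ 2) \<partial>lborel)"
  proof (rule nn_integral_mono)
    fix x :: "real ^ 2"
    show "ennreal (k (x $ 1)) * indicator disc x \<le> ennreal (k (x $ 1)) * indicator {- 1..1} (x $ 1) * indicator {- 1..1} (x $ 2)"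
      using component_le_norm_cart[of x 1] component_le_norm_cart[of x 2] by (auto simp: indicator_def abs_le_iff)
  qed
  also have "\<dots> = (\<integral>\<^sup>+s. \<integral>\<^sup>+t. ennreal (k s) * indicator {- 1..1} s * indicator {- 1..1} (t :: real) \<partial>lborel \<partial>lborel)"
  proof (subst nn_integral_vec2)
    have [measurable]: "(\<lambda>x :: real ^ 2. x $ i) \<in> borel_measurable borel" for i
      by (intro borel_measurable_continuous_onI continuous_intros)
    show "(\<lambda>x :: real ^ 2. ennreal (k (x $ 1)) * indicator {- 1..1} (x $ 1) * indicator {- 1..1} (x $ 2)) \<in> borel_measurable borel"
      by measurable
  qed simp
  also have "\<dots> = (\<integral>\<^sup>+s. ennreal (k s) * indicator {- 1..1} s * 2 \<partial>lborel)"
    by (intro nn_integral_cong, subst nn_integral_cmult_indicator) auto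
  also have "\<dots> = K * 2" unfolding K_def by (rule nn_integral_multc) measurable
  also have "\<dots> \<le> ennreal (2 * (V 1 - V (- 1))) * 2" using K by (rule mult_right_mono) simp
  finally have "energy W \<epsilon> (u \<epsilon>) disc \<le> ennreal (2 * (V 1 - V (- 1))) * 2 / 2"
    unfolding energy_def by (rule divide_right_mono_ennreal)
  also have "\<dots> = ennreal (2 * (V 1 - V (- 1)))" by (rule ennreal_mult_divide_eq) auto
  finally show ?thesis .
qed

lemma u_tendsto_jump:
  "((\<lambda>\<epsilon>. Lp_norm 1 disc (\<lambda>x. u \<epsilon> x - jump (vec2 0 (- 1)) (vec2 0 1) x)) \<longlongrightarrow> 0) (at_right 0)"
  unfolding Lp_norm_1 tendsto_at_iff_sequentially comp_def
proof (intro allI impI)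
  fix X :: "nat \<Rightarrow> real" assume X: "\<forall>i. X i \<in> {0<..} - {0}" "X \<longlonglongrightarrow> 0"
  let ?j = "jump (vec2 0 (- 1)) (vec2 0 1)"
  have X0: "X i > 0" for i using X(1) by auto
  have Xinf: "filterlim (\<lambda>i. inverse (X i)) at_top sequentially"
    using X(2) X0 by (intro filterlim_inverse_at_top) auto
  have "(\<lambda>i. \<integral>\<^sup>+x. ennreal (norm (u (X i) x - ?j x)) \<partial>lebesgue_on disc) \<longlonglongrightarrow> (\<integral>\<^sup>+x. 0 \<partial>lebesgue_on disc)"
  proof (rule nn_integral_dominated_convergence[where w = "\<lambda>_. 2"])
    show "(\<lambda>x. ennreal (norm (u (X i) x - ?j x))) \<in> borel_measurable (lebesgue_on disc)" for i
    proof (intro measurable_restrict_space1 measurable_completion)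
      have [measurable]: "?j \<in> borel_measurable borel" "u (X i) \<in> borel_measurable borel"
        using jump_measurable[of "\<lambda>x. x"] continuous_u(1)[OF X0] by (auto intro: borel_measurable_continuous_onI)
      show "(\<lambda>x. ennreal (norm (u (X i) x - ?j x))) \<in> borel_measurable lborel" by simp
    qed
    show "AE x in lebesgue_on disc. ennreal (norm (u (X i) x - ?j x)) \<le> 2" for i
    proof (rule AE_I2)
      fix x :: "real ^ 2"
      have "norm (u (X i) x - ?j x) \<le> norm (u (X i) x) + norm (?j x)" by (rule norm_triangle_ineq4)
      also have "\<dots> \<le> 1 + 1" using g(2)[of "x $ 1 / X i"] by (intro add_mono) (auto simp: u_def jump_def norm_vec2_0)
      finally show "ennreal (norm (u (X i) x - ?j x)) \<le> 2" using ennreal_leI[of _ 2] by simp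
    qed
    show "(\<integral>\<^sup>+x. 2 \<partial>lebesgue_on disc) < \<infinity>" unfolding nn_integral_disc_const by (simp add: ennreal_mult_less_top)
    show "AE x in lebesgue_on disc. (\<lambda>i. ennreal (norm (u (X i) x - ?j x))) \<longlonglongrightarrow> 0"
    proof (rule AE_I2)
      fix x :: "real ^ 2"
      have "(\<lambda>i. g (x $ 1 / X i)) \<longlonglongrightarrow> ?j x $ 2"
      proof -
        consider "x $ 1 > 0" | "x $ 1 < 0" | "x $ 1 = 0" by linarith
        then show ?thesis
        proof cases
          case 1
          have "filterlim (\<lambda>i. x $ 1 * inverse (X i)) at_top sequentially"
            using 1 Xinf by (rule filterlim_tendsto_pos_mult_at_top[OF tendsto_const])
          from filterlim_compose[OF g(4) this] show ?thesis using 1 by (simp add: jump_def divide_inverse)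
        next
          case 2
          have "filterlim (\<lambda>i. x $ 1 * inverse (X i)) at_bot sequentially"
            using 2 Xinf by (rule filterlim_tendsto_neg_mult_at_bot[OF tendsto_const])
          from filterlim_compose[OF g(5) this] show ?thesis using 2 by (simp add: jump_def divide_inverse)
        next
          \<comment> \<open>The normalisation \<open>g 0 = 0\<close> agrees with the value 0 that
            \<open>jump\<close> has on the interface.\<close>
          case 3
          then show ?thesis by (simp add: jump_def g(3))
        qed
      qed
      then have "(\<lambda>i. \<bar>g (x $ 1 / X i) - ?j x $ 2\<bar>) \<longlonglongrightarrow> 0"
        by (intro tendsto_rabs_zero LIM_zero)
      moreover have "norm (u (X i) x - ?j x) = \<bar>g (x $ 1 / X i) - ?j x $ 2\<bar>" for i
      proof -
        have "u (X i) x - ?j x = vec2 0 (g (x $ 1 / X i) - ?j x $ 2)"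
          by (simp add: u_def jump_def vec_eq_iff forall_2)
        then show ?thesis by (simp only: norm_vec2_0)
      qed
      ultimately have "(\<lambda>i. norm (u (X i) x - ?j x)) \<longlonglongrightarrow> 0" by simp
      then show "(\<lambda>i. ennreal (norm (u (X i) x - ?j x))) \<longlonglongrightarrow> 0"
        using tendsto_ennrealI[of _ 0] by simp
    qed
  qed simp_all
  then show "(\<lambda>i. \<integral>\<^sup>+x. ennreal (norm (u (X i) x - ?j x)) \<partial>lebesgue_on disc) \<longlonglongrightarrow> 0" by simp
qed

lemma u_families: "u \<in> families (vec2 0 (- 1)) (vec2 0 1)"
proof -
  have "\<forall>\<^sub>F \<epsilon> in at_right 0. ennreal (\<epsilon> powr (- 1)) * Lp_norm 3 disc (weak_div disc (u \<epsilon>)) = 0"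
    using eventually_at_right_less[of 0] by eventually_elim (simp add: div_u)
  then have "((\<lambda>\<epsilon>. ennreal (\<epsilon> powr (- 1)) * Lp_norm 3 disc (weak_div disc (u \<epsilon>))) \<longlongrightarrow> 0) (at_right 0)"
    by (rule tendsto_eventually)
  moreover have "(1 :: real) > 0" "(3 :: real) > 2" by auto
  ultimately have "\<exists>\<tau>>0. \<exists>s>2. ((\<lambda>\<epsilon>. ennreal (\<epsilon> powr (- \<tau>)) * Lp_norm s disc (weak_div disc (u \<epsilon>))) \<longlongrightarrow> 0) (at_right 0)"
    by blast
  then show ?thesis unfolding families_def using u_W12 u_tendsto_jump by blast
qed

lemma min_energy_le: "min_energy W (vec2 0 (- 1)) (vec2 0 1) \<le> ennreal (V 1 - V (- 1))"
proof -
  have "Liminf (at_right 0) (\<lambda>\<epsilon>. energy W \<epsilon> (u \<epsilon>) disc) \<le> Liminf (at_right 0) (\<lambda>\<epsilon> :: real. ennreal (2 * (V 1 - V (- 1))))"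
    by (intro Liminf_mono eventually_mono[OF eventually_at_right_less energy_u])
  also have "\<dots> = ennreal (2 * (V 1 - V (- 1)))" by (intro Liminf_const) simp
  finally have "min_energy W (vec2 0 (- 1)) (vec2 0 1) \<le> ennreal (2 * (V 1 - V (- 1))) / 2"
    unfolding min_energy_def by (intro divide_right_mono_ennreal INF_lower2[OF u_families])
  also have "\<dots> = ennreal (V 1 - V (- 1))"
    using V_mono[of "- 1" 1] by (simp add: divide_ennreal flip: ennreal_numeral)
  finally show ?thesis .
qed

end

text \<open>Since \<open>W\<close> vanishes at the origin, the optimal profile would not get past it; adding \<open>\<eta> (1 - t\<^sup>2)\<close> to the
  square root of the potential keeps its speed positive.\<close>

lemma min_energy_power_well_le:
  fixes n m :: nat
  assumes m: "m \<ge> 1" and W: "\<And>y. W y = norm y ^ (4 * n) * (1 - norm y ^ (2 * m))\<^sup>2"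
  shows "min_energy W (vec2 0 (- 1)) (vec2 0 1) \<le>
    ennreal (2 * (1 / (2 * real n + 1) - 1 / (2 * real n + 2 * real m + 1)))"
proof (rule ennreal_le_epsilon)
  fix e :: real assume e: "e > 0"
  \<comment> \<open>The integral of 1 - t^2 over [-1, 1] is 4 / 3, so the perturbation contributes
    exactly \<open>e\<close> to the cost.\<close>
  define \<eta> where "\<eta> = 3 / 4 * e"
  have \<eta>: "\<eta> > 0" using e by (simp add: \<eta>_def)
  \<comment> \<open>The root of the potential with 1 - t^2 divided out by a geometric sum:
    \<open>transition_profile\<close> expects that factor separately.\<close>
  define P where "P t = t ^ (2 * n) * (\<Sum>j<m. (t\<^sup>2) ^ j)" for t :: real
  define v where "v t = (1 - t\<^sup>2) * (\<eta> + P t)" for t :: real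
  define V where "V t = t ^ (2 * n + 1) / (2 * real n + 1) - t ^ (2 * n + 2 * m + 1) / (2 * real n + 2 * real m + 1)
    + \<eta> * (t - t ^ 3 / 3)" for t :: real
  have geo: "(1 - t\<^sup>2) * P t = t ^ (2 * n) * (1 - t ^ (2 * m))" for t
  proof -
    have "(1 - t\<^sup>2) * P t = t ^ (2 * n) * ((1 - t\<^sup>2) * (\<Sum>j<m. (t\<^sup>2) ^ j))"
      unfolding P_def by (rule mult.left_commute)
    then show ?thesis by (simp only: one_diff_power_eq[symmetric] power_mult)
  qed
  have P: "0 \<le> P t" "P t \<le> real m" if "\<bar>t\<bar> \<le> 1" for t
  proof -
    have t1: "t\<^sup>2 \<le> 1" using that by (simp add: abs_square_le_1)
    have t2: "t ^ (2 * n) \<le> 1" using power_le_one[of "t\<^sup>2" n] t1 by (simp add: power_mult)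
    have "0 \<le> (\<Sum>j<m. (t\<^sup>2) ^ j)" by (intro sum_nonneg) auto
    moreover have "(\<Sum>j<m. (t\<^sup>2) ^ j) \<le> (\<Sum>j<m. 1)" using t1 by (intro sum_mono power_le_one[of "t\<^sup>2"]) auto
    ultimately have s: "0 \<le> (\<Sum>j<m. (t\<^sup>2) ^ j)" "(\<Sum>j<m. (t\<^sup>2) ^ j) \<le> real m" by auto
    then show "0 \<le> P t" by (simp add: P_def power_mult)
    have "P t \<le> 1 * real m" unfolding P_def using t2 s by (intro mult_mono) auto
    then show "P t \<le> real m" by simp
  qed
  have cP: "continuous_on UNIV P" unfolding P_def by (intro continuous_intros)
  obtain g where g: "\<And>x. (g has_real_derivative (1 - (g x)\<^sup>2) * (\<eta> + P (g x))) (at x)" "\<And>x. \<bar>g x\<bar> < 1" "g 0 = 0"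
    "(g \<longlongrightarrow> 1) at_top" "(g \<longlongrightarrow> - 1) at_bot"
  proof (rule transition_profile[of "\<lambda>t. \<eta> + P t" \<eta> "\<eta> + real m"])
    show "continuous_on UNIV (\<lambda>t. \<eta> + P t)" by (intro continuous_intros cP)
  qed (use P \<eta> in auto)
  interpret transition g v V W
  proof
    show "(g has_real_derivative v (g x)) (at x)" for x using g(1) by (simp add: v_def)
    show "continuous_on UNIV v" unfolding v_def by (intro continuous_intros cP)
    fix t :: real
    show "(V has_real_derivative v t) (at t)"
    proof -
      have "v t = t ^ (2 * n) - t ^ (2 * n + 2 * m) + \<eta> * (1 - t\<^sup>2)"
        using geo[of t] by (simp add: v_def algebra_simps power_add)
      moreover have "((\<lambda>t. t ^ Suc k / real (Suc k)) has_real_derivative t ^ k) (at t)" for k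
        using DERIV_cdivide[OF DERIV_pow[of "Suc k" t], of "real (Suc k)"] by simp
      from DERIV_add[OF DERIV_diff[OF this[of "2 * n"] this[of "2 * n + 2 * m"]]
          DERIV_cmult[OF DERIV_diff[OF DERIV_ident this[of 2]], of \<eta>]]
      have "((\<lambda>t. t ^ Suc (2 * n) / real (Suc (2 * n)) - t ^ Suc (2 * n + 2 * m) / real (Suc (2 * n + 2 * m))
        + \<eta> * (t - t ^ Suc 2 / real (Suc 2))) has_real_derivative t ^ (2 * n) - t ^ (2 * n + 2 * m) + \<eta> * (1 - t\<^sup>2)) (at t)" .
      moreover have "V = (\<lambda>t. t ^ Suc (2 * n) / real (Suc (2 * n)) - t ^ Suc (2 * n + 2 * m) / real (Suc (2 * n + 2 * m))
        + \<eta> * (t - t ^ Suc 2 / real (Suc 2)))"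
        by (simp add: V_def fun_eq_iff numeral_3_eq_3 add_ac)
      ultimately show ?thesis by simp
    qed
    assume t: "\<bar>t\<bar> \<le> 1"
    then have t1: "0 \<le> 1 - t\<^sup>2" by (simp add: abs_square_le_1)
    show "0 \<le> v t" using t1 P(1)[OF t] \<eta> by (simp add: v_def)
    have even: "\<bar>t\<bar> ^ (4 * n) = (t ^ (2 * n))\<^sup>2" "\<bar>t\<bar> ^ (2 * m) = t ^ (2 * m)"
      by (simp_all add: power_even_abs flip: power_mult)
    have "W (vec2 0 t) = ((1 - t\<^sup>2) * P t)\<^sup>2"
      unfolding W norm_vec2_0 even geo by (simp add: power_mult_distrib)
    also have "\<dots> \<le> (v t)\<^sup>2" unfolding v_def
      using t1 P(1)[OF t] \<eta> by (intro power_mono mult_left_mono) auto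
    finally show "W (vec2 0 t) \<le> (v t)\<^sup>2" .
  qed (fact g)+
  have "V 1 - V (- 1) = 2 * (1 / (2 * real n + 1) - 1 / (2 * real n + 2 * real m + 1)) + e"
    by (simp add: V_def \<eta>_def)
  moreover have "0 \<le> 2 * (1 / (2 * real n + 1) - 1 / (2 * real n + 2 * real m + 1))"
    by (simp add: frac_le)
  ultimately show "min_energy W (vec2 0 (- 1)) (vec2 0 1) \<le>
    ennreal (2 * (1 / (2 * real n + 1) - 1 / (2 * real n + 2 * real m + 1))) + ennreal e"
    using min_energy_le e by (simp flip: ennreal_plus)
qed

lemma min_energy_power_well_ge:
  fixes n m :: nat
  assumes n: "n \<ge> 1" and m: "m \<ge> 1" and W: "\<And>y. W y = norm y ^ (4 * n) * (1 - norm y ^ (2 * m))\<^sup>2"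
    and am: "am = vector [0, - 1]" and ap: "ap = vector [0, 1]"
  shows "ennreal (2 * (1 / (2 * real n + 1) - 1 / (2 * real n + 2 * real m + 1))) \<le> min_energy W am ap"
proof -
  interpret radial_well "n - 1" m using m by unfold_locales
  have ab: "a = 2 * real n + 1" "b = 2 * real n + 2 * real m + 1"
    unfolding a_def b_def using n by auto
  have Sn: "norm y ^ (2 * k) = S y ^ k" for y :: "real ^ 2" and k
    unfolding power_mult norm_vec2_sq by (simp add: S_def power2_eq_square)
  have WS: "W y = (S y * v (S y))\<^sup>2" for y
  proof -
    have "S y * v (S y) = S y ^ n - S y ^ (n + m)"
      unfolding v_def using n by (cases n) (simp_all add: right_diff_distrib)
    also have "\<dots> = S y ^ n * (1 - S y ^ m)" by (simp add: power_add algebra_simps)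
    finally have "(S y * v (S y))\<^sup>2 = S y ^ (2 * n) * (1 - S y ^ m)\<^sup>2"
      by (simp add: power_mult_distrib mult.commute flip: power_mult)
    moreover have "norm y ^ (4 * n) = S y ^ (2 * n)" using Sn[of y "2 * n"] by simp
    ultimately show ?thesis by (simp add: W Sn)
  qed
  have half: "ennreal (4 * x) / 2 = ennreal (2 * x)" if "0 \<le> x" for x
    using that by (simp add: divide_ennreal flip: ennreal_numeral)
  have "0 \<le> 1 / a - 1 / b" unfolding ab by (simp add: frac_le)
  then have "ennreal (2 * (1 / a - 1 / b)) = ennreal (4 * (1 / a - 1 / b)) / 2" by (simp only: half)
  also have "\<dots> \<le> min_energy W am ap"
    unfolding min_energy_def
    by (intro divide_right_mono_ennreal INF_greatest liminf_radial_well[OF am ap WS])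
  finally show ?thesis unfolding ab .
qed

theorem corollary33:
  fixes am ap :: "real ^ 2"
  assumes am: "am = vector [0, -1]" and ap: "ap = vector [0, 1]"
  shows "(\<forall>(n::nat) (m::nat) W.
            n \<ge> 1 \<and> m \<ge> 1 \<and>
            (\<forall>y. W y = norm y ^ (4 * n) * (1 - norm y ^ (2 * m))\<^sup>2) \<longrightarrow>
            min_energy W am ap =
              ennreal (4 * real m / ((2 * real n + 1) * (2 * real n + 2 * real m + 1)))) \<and>
         (\<forall>(\<beta>::real) W u.
            0 < \<beta> \<and> \<beta> < 1 \<and>
            (\<forall>y\<in>cball 0 1. W y = (1 - (norm y)\<^sup>2) powr (2 * \<beta>)) \<and>
            u \<in> families am ap \<and>
            (\<forall>\<epsilon>>0. AE x in lebesgue_on (ball 0 1). norm (u \<epsilon> x) \<le> 1) \<longrightarrow>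
            Liminf (at_right 0) (\<lambda>\<epsilon>. energy W \<epsilon> (u \<epsilon>) (ball 0 1))
              \<ge> ennreal (4 * integral {0..1} (\<lambda>t. (1 - t\<^sup>2) powr \<beta>)))"
proof (intro conjI allI impI; (elim conjE)?)
  fix n m :: nat and W :: "real ^ 2 \<Rightarrow> real"
  assume nm: "1 \<le> n" "1 \<le> m" and W: "\<forall>y. W y = norm y ^ (4 * n) * (1 - norm y ^ (2 * m))\<^sup>2"
  have v: "am = vec2 0 (- 1)" "ap = vec2 0 1" by (simp_all add: am ap vec_eq_iff forall_2)
  have "min_energy W am ap = ennreal (2 * (1 / (2 * real n + 1) - 1 / (2 * real n + 2 * real m + 1)))"
    using min_energy_power_well_le[OF nm(2), of W n] min_energy_power_well_ge[OF nm _ am ap, of W] W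
    by (auto simp: v intro: antisym)
  also have "2 * (1 / (2 * real n + 1) - 1 / (2 * real n + 2 * real m + 1)) =
    4 * real m / ((2 * real n + 1) * (2 * real n + 2 * real m + 1))"
  proof -
    define a b where "a = 2 * real n + 1" and "b = 2 * real n + 2 * real m + 1"
    have "a \<noteq> 0" "b \<noteq> 0" "4 * real m = 2 * (b - a)" by (simp_all add: a_def b_def)
    then have "2 * (1 / a - 1 / b) = 4 * real m / (a * b)" by (simp add: field_simps)
    then show ?thesis by (simp add: a_def b_def)
  qed
  finally show "min_energy W am ap = ennreal (4 * real m / ((2 * real n + 1) * (2 * real n + 2 * real m + 1)))" .
next
  fix \<beta> :: real and W :: "real ^ 2 \<Rightarrow> real" and u :: "real \<Rightarrow> real ^ 2 \<Rightarrow> real ^ 2"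
  assume "0 < \<beta>" "\<beta> < 1" "\<forall>y\<in>cball 0 1. W y = (1 - (norm y)\<^sup>2) powr (2 * \<beta>)"
    "u \<in> families am ap" "\<forall>\<epsilon>>0. AE x in lebesgue_on (ball 0 1). norm (u \<epsilon> x) \<le> 1"
  then show "ennreal (4 * integral {0..1} (\<lambda>t. (1 - t\<^sup>2) powr \<beta>)) \<le>
    Liminf (at_right 0) (\<lambda>\<epsilon>. energy W \<epsilon> (u \<epsilon>) (ball 0 1))"
    using liminf_small_exponent[OF am ap] by blast
qed

end
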